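(* There exists a complete, properly embedded harmonic torus (harmonic surface of genus $1$) with exactly one end, and this end is of type $(2,2,3)$.
   Context: Harmonic surface: let $X$ be a compact (connected) Riemann surface with finitely many distinguished points $p_1,\dots,p_n$, and $\omega_1,\omega_2,\omega_3$ meromorphic 1-forms on $X$, holomorphic on $X'=X\setminus\{p_1,\dots,p_n\}$, such that all periods $\int_\gamma(\omega_1,\omega_2,\omega_3)$ over closed cycles $\gamma$ in $X'$ are imaginary. The harmonic surface is the harmonic map $f=\operatorname{Re}\int^z(\omega_1,\omega_2,\omega_3):X'\to\mathbb{R}^3$. Its genus is the genus of $X$; its ends are the restrictions of $f$ to punctured neighborhoods of the $p_j$. It is properly embedded if $f$ is a proper injective immersion, and complete if the induced metric is complete. Type of an end: in a local coordinate $z$ centered at the puncture, let $n_k$ be the pole order of $\omega_k$ at $0$ (with $n_k=0$ if $\omega_k$ is holomorphic there). Two ends are affinely equivalent if they differ by composition with an invertible real affine map of $\mathbb{R}^3$. An end is in reduced form if $n_1\le n_2\le n_3$ and $(n_1,n_2,n_3)$ is lexicographically minimal among all affinely equivalent ends; the type of an end is the tuple $(n_1,n_2,n_3)$ of an affinely equivalent end in reduced form. *)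

theory Defs
  imports
    "HOL-Complex_Analysis.Complex_Analysis"
    "HOL-Library.Function_Algebras"
begin

section \<open>Riemann surfaces\<close>

text \<open>A chart is a pair of its domain and its coordinate function; the values of the coordinate
  function outside of the domain are irrelevant. The complex structure is given by an atlas, which
  need not be maximal.\<close>

type_synonym 'a chart = "'a set \<times> ('a \<Rightarrow> complex)"

definition chart_inv :: "'a chart \<Rightarrow> complex \<Rightarrow> 'a" where
  "chart_inv c = inv_into (fst c) (snd c)"

definition is_chart :: "'a topology \<Rightarrow> 'a chart \<Rightarrow> bool" where
  "is_chart X c \<longleftrightarrow>
     openin X (fst c) \<and> open (snd c ` fst c) \<and>
     homeomorphic_map (subtopology X (fst c)) (top_of_set (snd c ` fst c)) (snd c)"

definition riemann_surface :: "'a topology \<Rightarrow> 'a chart set \<Rightarrow> bool" where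
  "riemann_surface X A \<longleftrightarrow>
     topspace X \<noteq> {} \<and> connected_space X \<and> Hausdorff_space X \<and>
     (\<forall>c\<in>A. is_chart X c) \<and> (\<Union>c\<in>A. fst c) = topspace X \<and>
     (\<forall>c\<in>A. \<forall>d\<in>A. (snd d \<circ> chart_inv c) holomorphic_on (snd c ` (fst c \<inter> fst d)))"


section \<open>Holomorphic and meromorphic 1-forms\<close>

text \<open>A 1-form \<open>\<omega>\<close> is given by its coefficients: on the domain of the chart \<open>c\<close> with coordinate
  function \<open>z\<close>, we have \<open>\<omega> = \<omega> c dz\<close>, where \<open>\<omega> c\<close> is a function on the surface.\<close>

type_synonym 'a form = "'a chart \<Rightarrow> 'a \<Rightarrow> complex"

text \<open>The coefficient of \<open>dz\<close> as a function of \<open>z\<close>.\<close>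

definition coeff_in :: "'a chart \<Rightarrow> 'a form \<Rightarrow> complex \<Rightarrow> complex" where
  "coeff_in c \<omega> z = \<omega> c (chart_inv c z)"

definition holomorphic_form_on :: "'a chart set \<Rightarrow> 'a set \<Rightarrow> 'a form \<Rightarrow> bool" where
  "holomorphic_form_on A S \<omega> \<longleftrightarrow>
     (\<forall>c\<in>A. coeff_in c \<omega> holomorphic_on (snd c ` (fst c \<inter> S))) \<and>
     (\<forall>c\<in>A. \<forall>d\<in>A. \<forall>x \<in> fst c \<inter> fst d \<inter> S.
        \<omega> c x = \<omega> d x * deriv (snd d \<circ> chart_inv c) (snd c x))"

text \<open>Meromorphic 1-forms on the surface that are holomorphic outside of \<open>P\<close>. The values of the
  coefficients at the points of \<open>P\<close> play no role.\<close>

definition meromorphic_form :: "'a topology \<Rightarrow> 'a chart set \<Rightarrow> 'a set \<Rightarrow> 'a form \<Rightarrow> bool" where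
  "meromorphic_form X A P \<omega> \<longleftrightarrow>
     holomorphic_form_on A (topspace X - P) \<omega> \<and>
     (\<forall>c\<in>A. coeff_in c \<omega> meromorphic_on (snd c ` fst c))"

text \<open>The vector space of holomorphic 1-forms on the surface. Coefficients are normalised to \<open>0\<close>
  where they carry no meaning, so that every holomorphic 1-form is represented exactly once.\<close>

definition holomorphic_forms :: "'a topology \<Rightarrow> 'a chart set \<Rightarrow> 'a form set" where
  "holomorphic_forms X A =
     {\<omega>. holomorphic_form_on A (topspace X) \<omega> \<and> (\<forall>c x. c \<notin> A \<or> x \<notin> fst c \<longrightarrow> \<omega> c x = 0)}"

text \<open>The genus of a compact Riemann surface is the complex dimension of its space of holomorphic
  1-forms.\<close>

definition genus :: "'a topology \<Rightarrow> 'a chart set \<Rightarrow> nat" where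
  "genus X A = vector_space.dim (\<lambda>a \<omega> c x. a * \<omega> c x) (holomorphic_forms X A)"


section \<open>Integration along paths\<close>

definition piecewise_C1_path :: "'a topology \<Rightarrow> 'a chart set \<Rightarrow> (real \<Rightarrow> 'a) \<Rightarrow> bool" where
  "piecewise_C1_path X A \<gamma> \<longleftrightarrow>
     pathin X \<gamma> \<and>
     (\<forall>c\<in>A. \<forall>a b. 0 \<le> a \<and> a \<le> b \<and> b \<le> 1 \<and> \<gamma> ` {a..b} \<subseteq> fst c \<longrightarrow>
        (snd c \<circ> \<gamma>) piecewise_C1_differentiable_on {a..b})"

text \<open>The value of \<open>\<omega>\<close> on the velocity of \<open>\<gamma>\<close> at time \<open>t\<close>. By the transformation rule for the
  coefficients, it does not depend on the chosen chart.\<close>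

definition form_velocity :: "'a chart set \<Rightarrow> 'a form \<Rightarrow> (real \<Rightarrow> 'a) \<Rightarrow> real \<Rightarrow> complex" where
  "form_velocity A \<omega> \<gamma> t =
     (let c = (SOME c. c \<in> A \<and> \<gamma> t \<in> fst c)
      in \<omega> c (\<gamma> t) * vector_derivative (snd c \<circ> \<gamma>) (at t within {0..1}))"

definition form_integral :: "'a chart set \<Rightarrow> 'a form \<Rightarrow> (real \<Rightarrow> 'a) \<Rightarrow> complex" where
  "form_integral A \<omega> \<gamma> = integral {0..1} (form_velocity A \<omega> \<gamma>)"


section \<open>Harmonic surfaces\<close>

abbreviation punctured :: "'a topology \<Rightarrow> 'a set \<Rightarrow> 'a topology" where
  "punctured X P \<equiv> subtopology X (topspace X - P)"

text \<open>The condition on \<open>f\<close> states that \<open>f = Re \<integral>\<^sup>z (\<omega>\<^sub>1, \<omega>\<^sub>2, \<omega>\<^sub>3)\<close>; the base point of the integral is left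
  open, i.e. \<open>f\<close> is determined up to an additive constant. The values of \<open>f\<close> on \<open>P\<close> are
  irrelevant.\<close>

definition harmonic_surface ::
  "'a topology \<Rightarrow> 'a chart set \<Rightarrow> 'a set \<Rightarrow> (3 \<Rightarrow> 'a form) \<Rightarrow> ('a \<Rightarrow> real^3) \<Rightarrow> bool" where
  "harmonic_surface X A P \<omega> f \<longleftrightarrow>
     riemann_surface X A \<and> compact_space X \<and>
     finite P \<and> P \<subseteq> topspace X \<and>
     (\<forall>k. meromorphic_form X A P (\<omega> k)) \<and>
     (\<forall>\<gamma>. piecewise_C1_path (punctured X P) A \<gamma> \<and> \<gamma> 0 = \<gamma> 1 \<longrightarrow>
        (\<forall>k. Re (form_integral A (\<omega> k) \<gamma>) = 0)) \<and>
     (\<forall>\<gamma>. piecewise_C1_path (punctured X P) A \<gamma> \<longrightarrow>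
        f (\<gamma> 1) - f (\<gamma> 0) = (\<chi> k. Re (form_integral A (\<omega> k) \<gamma>)))"

definition immersion_on :: "'a chart set \<Rightarrow> 'a set \<Rightarrow> ('a \<Rightarrow> real^3) \<Rightarrow> bool" where
  "immersion_on A S f \<longleftrightarrow>
     (\<forall>c\<in>A. \<forall>x \<in> fst c \<inter> S. \<exists>D. ((f \<circ> chart_inv c) has_derivative D) (at (snd c x)) \<and> inj D)"

definition properly_embedded ::
  "'a topology \<Rightarrow> 'a chart set \<Rightarrow> 'a set \<Rightarrow> ('a \<Rightarrow> real^3) \<Rightarrow> bool" where
  "properly_embedded X A P f \<longleftrightarrow>
     continuous_map (punctured X P) euclidean f \<and> proper_map (punctured X P) euclidean f \<and>
     inj_on f (topspace X - P) \<and> immersion_on A (topspace X - P) f"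

text \<open>The length of \<open>\<gamma>\<close> with respect to the metric induced by \<open>f\<close> is the Euclidean length of
  \<open>f \<circ> \<gamma>\<close>.\<close>

definition induced_length :: "('a \<Rightarrow> real^3) \<Rightarrow> (real \<Rightarrow> 'a) \<Rightarrow> ennreal" where
  "induced_length f \<gamma> =
     (\<integral>\<^sup>+ t\<in>{0..1}. ennreal (norm (vector_derivative (f \<circ> \<gamma>) (at t within {0..1}))) \<partial>lborel)"

text \<open>The infimum is finite, since any two points are joined by a path of finite length.\<close>

definition induced_dist ::
  "'a topology \<Rightarrow> 'a chart set \<Rightarrow> 'a set \<Rightarrow> ('a \<Rightarrow> real^3) \<Rightarrow> 'a \<Rightarrow> 'a \<Rightarrow> real" where
  "induced_dist X A P f x y =
     enn2real (INF \<gamma> \<in> {\<gamma>. piecewise_C1_path (punctured X P) A \<gamma> \<and> \<gamma> 0 = x \<and> \<gamma> 1 = y}.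
       induced_length f \<gamma>)"

definition complete_surface ::
  "'a topology \<Rightarrow> 'a chart set \<Rightarrow> 'a set \<Rightarrow> ('a \<Rightarrow> real^3) \<Rightarrow> bool" where
  "complete_surface X A P f \<longleftrightarrow>
     immersion_on A (topspace X - P) f \<and>
     Metric_space (topspace X - P) (induced_dist X A P f) \<and>
     Metric_space.mcomplete (topspace X - P) (induced_dist X A P f)"


section \<open>The type of an end\<close>

definition pole_order :: "(complex \<Rightarrow> complex) \<Rightarrow> complex \<Rightarrow> nat" where
  "pole_order g z = (if is_pole g z then nat (- zorder g z) else 0)"

text \<open>The pole order of \<open>\<omega>\<close> at \<open>p\<close>, which does not depend on the chart.\<close>

definition has_pole_order :: "'a chart set \<Rightarrow> 'a \<Rightarrow> 'a form \<Rightarrow> nat \<Rightarrow> bool" where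
  "has_pole_order A p \<omega> m \<longleftrightarrow>
     (\<forall>c\<in>A. p \<in> fst c \<longrightarrow> pole_order (coeff_in c \<omega>) (snd c p) = m)"

definition has_pole_orders ::
  "'a chart set \<Rightarrow> 'a \<Rightarrow> (3 \<Rightarrow> 'a form) \<Rightarrow> nat \<times> nat \<times> nat \<Rightarrow> bool" where
  "has_pole_orders A p \<omega> = (\<lambda>(n1, n2, n3).
     has_pole_order A p (\<omega> 1) n1 \<and> has_pole_order A p (\<omega> 2) n2 \<and> has_pole_order A p (\<omega> 3) n3)"

text \<open>An end is given by the 1-forms \<open>\<omega>\<close> and the map \<open>f = Re \<integral>\<^sup>z \<omega>\<close> near the puncture. Composing \<open>f\<close>
  with the affine map \<open>v \<mapsto> L v + b\<close> replaces the triple \<open>\<omega>\<close> by \<open>L \<omega>\<close>.\<close>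

definition affinely_equivalent ::
  "(3 \<Rightarrow> 'a form) \<times> ('a \<Rightarrow> real^3) \<Rightarrow> (3 \<Rightarrow> 'a form) \<times> ('a \<Rightarrow> real^3) \<Rightarrow> bool" where
  "affinely_equivalent = (\<lambda>(\<omega>, f) (\<omega>', f').
     \<exists>(L :: real^3^3) b. invertible L \<and>
       f' = (\<lambda>x. L *v f x + b) \<and>
       \<omega>' = (\<lambda>k c x. \<Sum>j\<in>UNIV. of_real (L $ k $ j) * \<omega> j c x))"

definition lex_less :: "(nat \<times> nat \<times> nat) rel" where
  "lex_less = less_than <*lex*> (less_than <*lex*> less_than)"

definition reduced_end ::
  "'a chart set \<Rightarrow> 'a \<Rightarrow> (3 \<Rightarrow> 'a form) \<times> ('a \<Rightarrow> real^3) \<Rightarrow> nat \<times> nat \<times> nat \<Rightarrow> bool" where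
  "reduced_end A p E = (\<lambda>(n1, n2, n3).
     has_pole_orders A p (fst E) (n1, n2, n3) \<and> n1 \<le> n2 \<and> n2 \<le> n3 \<and>
     (\<forall>E' m. affinely_equivalent E E' \<and> has_pole_orders A p (fst E') m \<longrightarrow>
        (m, (n1, n2, n3)) \<notin> lex_less))"

definition has_end_type ::
  "'a chart set \<Rightarrow> 'a \<Rightarrow> (3 \<Rightarrow> 'a form) \<times> ('a \<Rightarrow> real^3) \<Rightarrow> nat \<times> nat \<times> nat \<Rightarrow> bool" where
  "has_end_type A p E n \<longleftrightarrow> (\<exists>E'. affinely_equivalent E E' \<and> reduced_end A p E' n)"

end

theory Submission
  imports Defs
begin

text \<open>The torus is \<open>\<complex>/\<int>[\<i>]\<close> with its puncture at \<open>0\<close>, and the surface is \<open>z \<mapsto> (G z, Re (\<wp> z))\<close>,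
  where \<open>G z = \<zeta> z - \<kappa> cnj z\<close> is the doubly periodic, harmonic correction of the Weierstrass \<open>\<zeta>\<close>-function.
  Both \<open>Re G = Re (\<zeta> z - \<kappa> z)\<close> and \<open>Im G = Re (- \<i> (\<zeta> z + \<kappa> z))\<close> are real parts of holomorphic functions.

  The half-periods are mapped to \<open>e, 0, - e\<close> by \<open>\<wp>\<close>, and Rolle's theorem on the edge \<open>1/2 + \<i> y\<close> yields
  \<open>0 < \<kappa> < e\<close>. With \<open>\<wp>'\<^sup>2 = 4 \<wp> (\<wp>\<^sup>2 - e\<^sup>2)\<close>, the immersion property becomes an algebraic statement. For
  injectivity, \<open>\<wp>\<close> maps the quarter \<open>0 < Re z, Im z < 1/2\<close> conformally onto the lower half plane, and
  \<open>Im G\<close> has the derivative \<open>Re ((\<kappa> - \<wp>) / \<wp>') > 0\<close> along the vertical lines there. So \<open>Im G\<close> separates the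
  points of the quarter with the same \<open>Re \<wp>\<close>, and comparison with the boundary values gives
  \<open>Im G < 0 < Re G\<close>. By symmetry, \<open>G\<close> maps the four quarters of the fundamental square to different
  quadrants. The edges are mapped to the axes, and there \<open>\<wp>\<close> is real and nearly injective.\<close>

section \<open>The Weierstrass functions of the square lattice\<close>

text \<open>An end of type (2,2,3) calls for two forms with double poles whose real combinations all
  keep order 2, and a third form of order 3. The forms wp dz, i wp dz and wp' dz are the simplest
  elliptic choice. The obstacle is that \<open>wzeta\<close>, the primitive of - wp, has
  quasi-periods, while the real parts of two coordinates must become single-valued at once.
  Multiples of dz correct this. On the square lattice one real constant \<kappa> serves both
  coordinates, since the rotation by i forces the quasi-period of i to be - i \<kappa>. The position
  of \<kappa> strictly between the critical values 0 and e carries the geometry: for s > 0 the cubic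
  x (x^2 - e^2) + s (x - \<kappa>)^2 is negative at \<kappa> and positive at 0 and e. The reality of
  its roots yields both the monotonicity of Im G in a quarter and most of the immersion property. G
  is not holomorphic, so injectivity is not a matter of counting preimages; instead, the fibres of
  Re wp in a quarter are arcs on which Im G is strictly monotone. Completeness compares the induced
  distance with the Euclidean distance of the images from below and with the coordinate distance
  from above.\<close>

lemma infsum_has_field_derivative:
  fixes f f' :: "'a \<Rightarrow> complex \<Rightarrow> complex"
  assumes "0 < r"
    and deriv: "\<And>l w. l \<in> I \<Longrightarrow> w \<in> cball z r \<Longrightarrow> (f l has_field_derivative f' l w) (at w)"
    and bound: "\<And>l w. l \<in> I \<Longrightarrow> w \<in> cball z r \<Longrightarrow> norm (f l w) \<le> M l"
    and M: "M summable_on I"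
  shows "\<exists>D. ((\<lambda>w. \<Sum>\<^sub>\<infinity>l\<in>I. f l w) has_field_derivative D) (at z) \<and> ((\<lambda>l. f' l z) has_sum D) I"
proof -
  \<comment> \<open>Weierstrass's theorem on termwise differentiation is applied to the net of
    finite partial sums. A majorant of the terms suffices: the convergence of the differentiated
    series at \<open>z\<close> is part of the conclusion of that theorem.\<close>
  have U: "uniform_limit (cball z r) (\<lambda>X w. \<Sum>l\<in>X. f l w) (\<lambda>w. \<Sum>\<^sub>\<infinity>l\<in>I. f l w)
      (finite_subsets_at_top I)"
    by (rule Weierstrass_m_test_general[OF bound M])
  have "eventually (\<lambda>X. X \<subseteq> I) (finite_subsets_at_top I)"
    by (auto simp: eventually_finite_subsets_at_top)
  then have ev: "eventually (\<lambda>X. continuous_on (cball z r) (\<lambda>w. \<Sum>l\<in>X. f l w) \<and>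
      (\<forall>w\<in>ball z r. ((\<lambda>w. \<Sum>l\<in>X. f l w) has_field_derivative (\<Sum>l\<in>X. f' l w)) (at w)))
      (finite_subsets_at_top I)"
  proof eventually_elim
    case (elim X)
    have *: "((\<lambda>w. \<Sum>l\<in>X. f l w) has_field_derivative (\<Sum>l\<in>X. f' l w)) (at w)"
      if "w \<in> cball z r" for w
      using deriv elim that by (intro DERIV_sum) blast
    show ?case
      using * by (auto intro!: continuous_at_imp_continuous_on DERIV_isCont)
  qed
  have "finite_subsets_at_top I \<noteq> bot"
    by simp
  then obtain g' where "\<And>w. w \<in> ball z r \<Longrightarrow>
      ((\<lambda>w. \<Sum>\<^sub>\<infinity>l\<in>I. f l w) has_field_derivative (g' w)) (at w) \<and>
      ((\<lambda>X. \<Sum>l\<in>X. f' l w) \<longlongrightarrow> g' w) (finite_subsets_at_top I)"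
    by (rule has_complex_derivative_uniform_limit[OF ev U _ \<open>0 < r\<close>]) (rule that)
  from this[of z] show ?thesis
    using \<open>0 < r\<close> unfolding has_sum_def by auto
qed

section \<open>The Gaussian lattice and the convergence of its sums\<close>

definition gauss_ints :: "complex set"
  where "gauss_ints = {z. Re z \<in> \<int> \<and> Im z \<in> \<int>}"

lemma gauss_ints_simps [simp, intro]:
  "0 \<in> gauss_ints" "1 \<in> gauss_ints" "\<i> \<in> gauss_ints"
  by (auto simp: gauss_ints_def)

lemma gauss_ints_add [intro]: "x \<in> gauss_ints \<Longrightarrow> y \<in> gauss_ints \<Longrightarrow> x + y \<in> gauss_ints"
  and gauss_ints_diff [intro]: "x \<in> gauss_ints \<Longrightarrow> y \<in> gauss_ints \<Longrightarrow> x - y \<in> gauss_ints"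
  and gauss_ints_minus_iff [simp]: "-x \<in> gauss_ints \<longleftrightarrow> x \<in> gauss_ints"
  and gauss_ints_mult_i_iff [simp]: "\<i> * x \<in> gauss_ints \<longleftrightarrow> x \<in> gauss_ints"
  and gauss_ints_cnj_iff [simp]: "cnj x \<in> gauss_ints \<longleftrightarrow> x \<in> gauss_ints"
  by (auto simp: gauss_ints_def)

lemma gauss_ints_add_iff [simp]:
  "y \<in> gauss_ints \<Longrightarrow> x + y \<in> gauss_ints \<longleftrightarrow> x \<in> gauss_ints"
  "y \<in> gauss_ints \<Longrightarrow> y + x \<in> gauss_ints \<longleftrightarrow> x \<in> gauss_ints"
  "y \<in> gauss_ints \<Longrightarrow> x - y \<in> gauss_ints \<longleftrightarrow> x \<in> gauss_ints"
  "y \<in> gauss_ints \<Longrightarrow> y - x \<in> gauss_ints \<longleftrightarrow> x \<in> gauss_ints"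
proof -
  assume y: "y \<in> gauss_ints"
  show *: "x + y \<in> gauss_ints \<longleftrightarrow> x \<in> gauss_ints" for x
    using gauss_ints_add[of x y] gauss_ints_diff[of "x + y" y] y by auto
  show "y + x \<in> gauss_ints \<longleftrightarrow> x \<in> gauss_ints" for x
    using *[of x] by (simp add: add.commute)
  show "x - y \<in> gauss_ints \<longleftrightarrow> x \<in> gauss_ints"
    using *[of "x - y"] by simp
  show "y - x \<in> gauss_ints \<longleftrightarrow> x \<in> gauss_ints"
    using *[of "-x"] by simp
qed

lemma gauss_ints_eq_image: "gauss_ints = (\<lambda>(m, n). Complex (of_int m) (of_int n)) ` UNIV"
proof (intro equalityI subsetI)
  fix z assume "z \<in> gauss_ints"
  then obtain m n where "Re z = of_int m" "Im z = of_int n"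
    by (auto simp: gauss_ints_def Ints_def)
  then show "z \<in> (\<lambda>(m, n). Complex (of_int m) (of_int n)) ` UNIV"
    by (auto intro!: image_eqI[of _ _ "(m, n)"] simp: complex_eq_iff)
qed (auto simp: gauss_ints_def)

lemma countable_gauss_ints: "countable gauss_ints"
  unfolding gauss_ints_eq_image by (rule countable_image) simp

lemma connected_gauss_ints_compl: "connected (-gauss_ints)"
  by (rule path_connected_imp_connected, rule path_connected_complement_countable)
     (simp_all add: countable_gauss_ints)

lemma closed_gauss_ints: "closed gauss_ints"
proof -
  have "gauss_ints = Re -` \<int> \<inter> Im -` \<int>"
    by (auto simp: gauss_ints_def)
  moreover have "closed (Re -` \<int>)" "closed (Im -` \<int>)"
    by (rule closed_vimage; simp add: closed_Ints continuous_on_Re continuous_on_Im)+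
  ultimately show ?thesis
    by (metis closed_Int)
qed

lemma open_gauss_ints_compl: "open (-gauss_ints)"
  using closed_gauss_ints by auto

lemma norm_gauss_int_ge_1:
  assumes "z \<in> gauss_ints" "z \<noteq> 0"
  shows "norm z \<ge> 1"
proof -
  obtain m n where mn: "z = Complex (of_int m) (of_int n)"
    using assms(1) by (auto simp: gauss_ints_eq_image)
  have "m \<noteq> 0 \<or> n \<noteq> 0"
    using assms(2) mn by (auto simp: complex_eq_iff)
  then have "\<bar>Re z\<bar> \<ge> 1 \<or> \<bar>Im z\<bar> \<ge> 1"
    using mn by (simp, linarith)
  then show ?thesis
    using abs_Re_le_cmod[of z] abs_Im_le_cmod[of z] by linarith
qed

lemma closed_gauss_ints_Diff_0: "closed (gauss_ints - {0})"
proof -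
  have "gauss_ints - {0} = gauss_ints - ball 0 1"
    by (auto dest: norm_gauss_int_ge_1)
  then show ?thesis
    using closed_gauss_ints by auto
qed

abbreviation "gauss_ints' \<equiv> gauss_ints - {0}"

text \<open>The exponent is half of the 3 in the lattice sum and still exceeds 1, so that a product
  of two such series can majorise that sum.\<close>

lemma summable_on_int_powr: "(\<lambda>m::int. (1 + \<bar>of_int m\<bar>) powr (-3/2) :: real) summable_on UNIV"
proof -
  have "summable (\<lambda>n. of_nat n powr (-3/2) :: real)"
    by (simp add: summable_real_powr_iff)
  then have "summable (\<lambda>n. of_nat (Suc n) powr (-3/2) :: real)"
    by (subst summable_Suc_iff)
  then have N: "(\<lambda>n::nat. (1 + of_nat n) powr (-3/2) :: real) summable_on UNIV"
    by (intro summable_nonneg_imp_summable_on) auto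
  have 1: "(\<lambda>m::int. (1 + \<bar>of_int m\<bar>) powr (-3/2) :: real) summable_on range int"
    by (subst summable_on_reindex) (use N in \<open>simp_all add: o_def\<close>)
  have 2: "(\<lambda>m::int. (1 + \<bar>of_int m\<bar>) powr (-3/2) :: real) summable_on range (\<lambda>n. - int n)"
    by (subst summable_on_reindex) (use N in \<open>simp_all add: o_def inj_on_def\<close>)
  have "range int \<union> range (\<lambda>n. - int n) = UNIV"
    by (auto intro: int_cases2)
  then show ?thesis
    using summable_on_union[OF 1 2] by simp
qed

text \<open>For a nonzero lattice point, |l| \<ge> 1 gives (1 + |Re l|) (1 + |Im l|) \<le> 4 |l|^2.
  Raised to the power 3/2, this bounds 1 / |l|^3 by 8 times a product of terms of two convergent
  one-variable series.\<close>

lemma summable_on_gauss_ints: "(\<lambda>l. 1 / norm l ^ 3) summable_on gauss_ints'"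
proof -
  define a :: "int \<Rightarrow> real" where "a m = (1 + \<bar>of_int m\<bar>) powr (-3/2)" for m
  have a: "(a has_sum infsum a UNIV) UNIV"
    unfolding a_def by (rule has_sum_infsum[OF summable_on_int_powr])
  have a_nonneg: "a m \<ge> 0" for m
    by (simp add: a_def)
  have "(\<lambda>(m, n). a m * a n) summable_on UNIV \<times> UNIV"
  proof (rule summable_on_SigmaI[where g = "\<lambda>m. a m * infsum a UNIV"])
    show "((\<lambda>n. case (m, n) of (m, n) \<Rightarrow> a m * a n) has_sum a m * infsum a UNIV) UNIV" for m
      using has_sum_cmult_right[OF a] by simp
    show "(\<lambda>m. a m * infsum a UNIV) summable_on UNIV"
      using has_sum_cmult_left[OF a] by (rule has_sum_imp_summable)
  qed (simp_all add: a_nonneg)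
  then have "(\<lambda>(m, n). 8 * (a m * a n)) summable_on UNIV"
    using summable_on_cmult_right[of "\<lambda>(m, n). a m * a n" UNIV 8] by (simp add: case_prod_unfold)
  then have "(\<lambda>l. 8 * (a \<lfloor>Re l\<rfloor> * a \<lfloor>Im l\<rfloor>)) summable_on gauss_ints"
    unfolding gauss_ints_eq_image
    by (subst summable_on_reindex)
       (simp_all add: inj_on_def o_def case_prod_unfold)
  then have "(\<lambda>l. 8 * (a \<lfloor>Re l\<rfloor> * a \<lfloor>Im l\<rfloor>)) summable_on gauss_ints'"
    by (rule summable_on_subset) auto
  then show ?thesis
  proof (rule summable_on_comparison_test)
    fix l assume l: "l \<in> gauss_ints'"
    then have l1: "norm l \<ge> 1"
      using norm_gauss_int_ge_1 by auto
    have [simp]: "of_int \<lfloor>Re l\<rfloor> = Re l" "of_int \<lfloor>Im l\<rfloor> = Im l"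
      using l by (auto simp: gauss_ints_def)
    define X where "X = (1 + \<bar>Re l\<bar>) * (1 + \<bar>Im l\<bar>)"
    have X: "X > 0"
      unfolding X_def by (intro mult_pos_pos) auto
    have "X \<le> (2 * norm l) * (2 * norm l)"
      unfolding X_def using abs_Re_le_cmod[of l] abs_Im_le_cmod[of l] l1
      by (intro mult_mono) auto
    then have "X powr (3/2) \<le> ((2 * norm l) ^ 2) powr (3/2)"
      using X by (intro powr_mono2) (auto simp: power2_eq_square)
    also have "\<dots> = (2 * norm l) powr 3"
    proof -
      have "((2 * norm l) ^ 2) powr (3/2) = ((2 * norm l) powr 2) powr (3/2)"
        using l1 by (subst powr_numeral) auto
      then show ?thesis
        by (simp only: powr_powr) simp
    qed
    also have "\<dots> = 8 * norm l ^ 3"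
      using l1 by (simp add: powr_numeral power_mult_distrib)
    finally have "1 / (8 * norm l ^ 3) \<le> 1 / X powr (3/2)"
      using X l1 by (intro divide_left_mono mult_pos_pos) auto
    also have "1 / X powr (3/2) = X powr (-3/2)"
      by (simp add: powr_minus_divide)
    also have "\<dots> = a \<lfloor>Re l\<rfloor> * a \<lfloor>Im l\<rfloor>"
      by (simp add: a_def X_def powr_mult)
    finally show "1 / norm l ^ 3 \<le> 8 * (a \<lfloor>Re l\<rfloor> * a \<lfloor>Im l\<rfloor>)"
      by simp
  qed auto
qed

lemma gauss_ints_separation:
  assumes "z \<notin> gauss_ints'"
  obtains r c R where "r > 0" "c > 0" "R > 0"
    "\<And>w. w \<in> cball z r \<Longrightarrow> norm w \<le> R"
    "\<And>w l. w \<in> cball z r \<Longrightarrow> l \<in> gauss_ints' \<Longrightarrow> norm (w - l) \<ge> c * norm l"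
    "\<And>w l. w \<in> cball z r \<Longrightarrow> l \<in> gauss_ints' \<Longrightarrow> w - l \<noteq> 0"
proof -
  have "open (-gauss_ints')" "z \<in> -gauss_ints'"
    using closed_gauss_ints_Diff_0 assms by (simp_all only: open_closed double_complement) auto
  then obtain d where d: "d > 0" "ball z d \<subseteq> -gauss_ints'"
    by (meson open_contains_ball)
  define r where "r = d / 2"
  define R where "R = norm z + d"
  define c where "c = min (1/2) (r / (2 * R))"
  show ?thesis
  proof (rule that[of r c R])
    show "r > 0" "R > 0"
      using d by (auto simp: r_def R_def add_nonneg_pos)
    then show c: "c > 0"
      by (auto simp: c_def)
    show norm_w: "norm w \<le> R" if "w \<in> cball z r" for w
      using that norm_triangle_ineq[of z "w - z"] d
      by (auto simp: R_def r_def dist_norm norm_minus_commute)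
    show sep: "norm (w - l) \<ge> c * norm l" if w: "w \<in> cball z r" and l: "l \<in> gauss_ints'" for w l
    proof (cases "norm l \<ge> 2 * R")
      case True
      have "c * norm l \<le> 1/2 * norm l"
        by (intro mult_right_mono) (auto simp: c_def)
      also have "\<dots> \<le> norm l - norm w"
        using norm_w[OF w] True by simp
      also have "\<dots> \<le> norm (w - l)"
        by (metis norm_minus_commute norm_triangle_ineq2)
      finally show ?thesis .
    next
      case False
      have "l \<notin> ball z d"
        using d l by auto
      then have "d \<le> dist z l"
        by simp
      also have "\<dots> \<le> dist z w + dist w l"
        by (rule dist_triangle)
      finally have "r \<le> norm (w - l)"
        using w by (auto simp: r_def dist_norm)
      moreover have "c * norm l \<le> r / (2 * R) * (2 * R)"
        using False \<open>r > 0\<close> \<open>R > 0\<close> by (intro mult_mono) (auto simp: c_def)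
      ultimately show ?thesis
        using \<open>R > 0\<close> by auto
    qed
    show "w - l \<noteq> 0" if "w \<in> cball z r" "l \<in> gauss_ints'" for w l
    proof -
      have "0 < c * norm l"
        using that c by simp
      also have "\<dots> \<le> norm (w - l)"
        using sep that by blast
      finally show ?thesis
        by simp
    qed
  qed
qed

section \<open>The zeta- and wp-function as lattice sums, and their derivatives\<close>

definition zeta_sum :: "complex \<Rightarrow> complex"
  where "zeta_sum z = (\<Sum>\<^sub>\<infinity>l\<in>gauss_ints'. 1 / (z - l) + 1 / l + z / l ^ 2)"

definition wp_sum :: "complex \<Rightarrow> complex"
  where "wp_sum z = (\<Sum>\<^sub>\<infinity>l\<in>gauss_ints'. 1 / (z - l) ^ 2 - 1 / l ^ 2)"

text \<open>The term of the lattice point 0 is kept outside of the sum, so that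
  \<open>zeta_sum\<close> is analytic at 0 and the pole there is explicit. \<open>wp\<close> is
  split in the same way.\<close>

definition wzeta :: "complex \<Rightarrow> complex"
  where "wzeta z = 1 / z + zeta_sum z"

definition wp :: "complex \<Rightarrow> complex"
  where "wp z = 1 / z ^ 2 + wp_sum z"

text \<open>The summands 1 / l and w / l^2 cancel the terms of order 0 and 1 in the expansion of 1 /
  (w - l) in powers of w. What remains is one fraction with numerator w^2 and a denominator of third
  order in l.\<close>

lemma zeta_term_bound:
  fixes w l :: complex
  assumes "norm w \<le> R" "c * norm l \<le> norm (w - l)" "c > 0" "l \<noteq> 0"
  shows "norm (1 / (w - l) + 1 / l + w / l ^ 2) \<le> R ^ 2 / c * (1 / norm l ^ 3)"
proof -
  have pos: "0 < c * norm l"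
    using assms by simp
  then have "w - l \<noteq> 0"
    using assms(2) by auto
  have id: "1 / u + 1 / l + (u + l) / l ^ 2 = (u + l) ^ 2 / (u * l ^ 2)" if "u \<noteq> 0" for u
    using \<open>l \<noteq> 0\<close> that by (simp add: field_simps power2_eq_square)
  have "1 / (w - l) + 1 / l + w / l ^ 2 = w ^ 2 / ((w - l) * l ^ 2)"
    using id[OF \<open>w - l \<noteq> 0\<close>] by simp
  then have "norm (1 / (w - l) + 1 / l + w / l ^ 2) = norm w ^ 2 / (norm (w - l) * norm l ^ 2)"
    by (simp add: norm_divide norm_mult norm_power)
  also have "\<dots> \<le> R ^ 2 / ((c * norm l) * norm l ^ 2)"
    using assms pos by (intro frac_le power_mono mult_right_mono mult_pos_pos) auto
  also have "\<dots> = R ^ 2 / c * (1 / norm l ^ 3)"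
    by (simp add: power2_eq_square power3_eq_cube)
  finally show ?thesis .
qed

text \<open>Over the common denominator the numerator is w (2 l - w), of first order in l against
  fourth order below. The assumption |l| \<ge> 1 allows |w| to be absorbed into a multiple of
  |l|.\<close>

lemma wp_term_bound:
  fixes w l :: complex
  assumes "norm w \<le> R" "c * norm l \<le> norm (w - l)" "c > 0" "norm l \<ge> 1"
  shows "norm (1 / (w - l) ^ 2 - 1 / l ^ 2) \<le> R * (R + 2) / c ^ 2 * (1 / norm l ^ 3)"
proof -
  have l: "l \<noteq> 0"
    using assms by auto
  have R: "R \<ge> 0"
    using assms(1) norm_ge_zero order_trans by blast
  have pos: "0 < c * norm l"
    using assms l by simp
  then have nz: "w - l \<noteq> 0"
    using assms(2) by auto
  have id: "1 / u ^ 2 - 1 / l ^ 2 = (u + l) * (l - u) / (u ^ 2 * l ^ 2)" if "u \<noteq> 0" for u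
    using l that by (simp add: field_simps power2_eq_square)
  have "norm (1 / (w - l) ^ 2 - 1 / l ^ 2) =
      norm w * norm (2 * l - w) / (norm (w - l) ^ 2 * norm l ^ 2)"
    unfolding id[OF nz] by (simp add: norm_divide norm_mult norm_power)
  also have "\<dots> \<le> R * ((R + 2) * norm l) / ((c * norm l) ^ 2 * norm l ^ 2)"
  proof (intro frac_le mult_mono power_mono mult_pos_pos)
    have "norm (2 * l - w) \<le> 2 * norm l + R"
      using norm_triangle_ineq4[of "2 * l" w] assms(1) by (simp add: norm_mult)
    also have "R \<le> R * norm l"
      using R assms(4) by (simp add: mult_le_cancel_left1)
    finally show "norm (2 * l - w) \<le> (R + 2) * norm l"
      by (simp add: algebra_simps)
  qed (use assms pos R l in auto)
  also have "\<dots> = R * (R + 2) / c ^ 2 * (1 / norm l ^ 3)"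
    using l assms(3) by (simp add: divide_simps) (simp add: algebra_simps power2_eq_square power3_eq_cube power4_eq_xxxx)
  finally show ?thesis .
qed

lemma zeta_sum_has_field_derivative:
  assumes "z \<notin> gauss_ints'"
  shows "(zeta_sum has_field_derivative (- wp_sum z)) (at z)"
proof -
  obtain r c R where rcR: "r > 0" "c > 0" "R > 0"
    "\<And>w. w \<in> cball z r \<Longrightarrow> norm w \<le> R"
    "\<And>w l. w \<in> cball z r \<Longrightarrow> l \<in> gauss_ints' \<Longrightarrow> norm (w - l) \<ge> c * norm l"
    and nz: "\<And>w l. w \<in> cball z r \<Longrightarrow> l \<in> gauss_ints' \<Longrightarrow> w - l \<noteq> 0"
    by (rule gauss_ints_separation[OF assms]) (rule that)
  have "\<exists>D. ((\<lambda>w. \<Sum>\<^sub>\<infinity>l\<in>gauss_ints'. 1 / (w - l) + 1 / l + w / l ^ 2) has_field_derivative D) (at z) \<and>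
      ((\<lambda>l. - (1 / (z - l) ^ 2 - 1 / l ^ 2)) has_sum D) gauss_ints'"
  proof (rule infsum_has_field_derivative[OF \<open>r > 0\<close>])
    show "((\<lambda>w. 1 / (w - l) + 1 / l + w / l ^ 2) has_field_derivative - (1 / (w - l) ^ 2 - 1 / l ^ 2)) (at w)"
      if "l \<in> gauss_ints'" "w \<in> cball z r" for l w
      using nz[of w l] that
      by (auto intro!: derivative_eq_intros simp: field_simps power2_eq_square)
    show "norm (1 / (w - l) + 1 / l + w / l ^ 2) \<le> R ^ 2 / c * (1 / norm l ^ 3)"
      if "l \<in> gauss_ints'" "w \<in> cball z r" for l w
      using rcR that by (intro zeta_term_bound) auto
    show "(\<lambda>l. R ^ 2 / c * (1 / norm l ^ 3)) summable_on gauss_ints'"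
      by (intro summable_on_cmult_right summable_on_gauss_ints)
  qed
  then obtain D where D: "(zeta_sum has_field_derivative D) (at z)"
      "((\<lambda>l. - (1 / (z - l) ^ 2 - 1 / l ^ 2)) has_sum D) gauss_ints'"
    by (auto simp: zeta_sum_def[abs_def])
  then have "D = (\<Sum>\<^sub>\<infinity>l\<in>gauss_ints'. - (1 / (z - l) ^ 2 - 1 / l ^ 2))"
    by (simp add: infsumI)
  also have "\<dots> = - wp_sum z"
    unfolding wp_sum_def by (rule infsum_uminus)
  finally show ?thesis
    using D by simp
qed

lemma wp_sum_has_field_derivative:
  assumes "z \<notin> gauss_ints'"
  shows "\<exists>D. (wp_sum has_field_derivative D) (at z) \<and>
      ((\<lambda>l. - 2 / (z - l) ^ 3) has_sum D) gauss_ints'"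
proof -
  obtain r c R where rcR: "r > 0" "c > 0" "R > 0"
    "\<And>w. w \<in> cball z r \<Longrightarrow> norm w \<le> R"
    "\<And>w l. w \<in> cball z r \<Longrightarrow> l \<in> gauss_ints' \<Longrightarrow> norm (w - l) \<ge> c * norm l"
    and nz: "\<And>w l. w \<in> cball z r \<Longrightarrow> l \<in> gauss_ints' \<Longrightarrow> w - l \<noteq> 0"
    by (rule gauss_ints_separation[OF assms]) (rule that)
  show ?thesis
    unfolding wp_sum_def[abs_def]
  proof (rule infsum_has_field_derivative[OF \<open>r > 0\<close>])
    show "((\<lambda>w. 1 / (w - l) ^ 2 - 1 / l ^ 2) has_field_derivative - 2 / (w - l) ^ 3) (at w)"
      if "l \<in> gauss_ints'" "w \<in> cball z r" for l w
    proof -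
      define u where "u = w - l"
      have "u \<noteq> 0"
        using nz[of w l] that by (simp add: u_def)
      then have "((\<lambda>w. 1 / w ^ 2 - 1 / l ^ 2) has_field_derivative - 2 / u ^ 3) (at u)"
        by (auto intro!: derivative_eq_intros simp: field_simps power2_eq_square power3_eq_cube)
      then show ?thesis
        using DERIV_shift[of "\<lambda>w. 1 / w ^ 2 - 1 / l ^ 2" "- 2 / u ^ 3" w "-l"] by (simp add: u_def)
    qed
    show "norm (1 / (w - l) ^ 2 - 1 / l ^ 2) \<le> R * (R + 2) / c ^ 2 * (1 / norm l ^ 3)"
      if "l \<in> gauss_ints'" "w \<in> cball z r" for l w
      using rcR that norm_gauss_int_ge_1 by (intro wp_term_bound) auto
    show "(\<lambda>l. R * (R + 2) / c ^ 2 * (1 / norm l ^ 3)) summable_on gauss_ints'"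
      by (intro summable_on_cmult_right summable_on_gauss_ints)
  qed
qed

lemma not_gauss_ints_imp: "z \<notin> gauss_ints \<Longrightarrow> z \<notin> gauss_ints'" "z \<notin> gauss_ints \<Longrightarrow> z \<noteq> 0"
  by auto

lemma wzeta_has_field_derivative:
  assumes "z \<notin> gauss_ints"
  shows "(wzeta has_field_derivative (- wp z)) (at z)"
  unfolding wzeta_def[abs_def]
  by (rule derivative_eq_intros zeta_sum_has_field_derivative refl | use assms in force)+
     (use assms in \<open>auto simp: wp_def power2_eq_square\<close>)

lemma wp_has_field_derivative_wp_sum:
  assumes z: "z \<notin> gauss_ints"
  shows "(wp has_field_derivative (- 2 / z ^ 3 + deriv wp_sum z)) (at z)"
proof -
  have "((\<lambda>w. 1 / w ^ 2) has_field_derivative - 2 / z ^ 3) (at z)"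
    using not_gauss_ints_imp(2)[OF z]
    by (auto intro!: derivative_eq_intros simp: divide_simps)
       (simp add: algebra_simps power2_eq_square power3_eq_cube power4_eq_xxxx)
  moreover have "(wp_sum has_field_derivative deriv wp_sum z) (at z)"
    using wp_sum_has_field_derivative[of z] z DERIV_imp_deriv by blast
  ultimately show ?thesis
    unfolding wp_def[abs_def] by (rule DERIV_add)
qed

lemma deriv_wp_eq: "z \<notin> gauss_ints \<Longrightarrow> deriv wp z = - 2 / z ^ 3 + deriv wp_sum z"
  by (rule DERIV_imp_deriv[OF wp_has_field_derivative_wp_sum])

lemma wp_has_field_derivative: "z \<notin> gauss_ints \<Longrightarrow> (wp has_field_derivative deriv wp z) (at z)"
  using wp_has_field_derivative_wp_sum deriv_wp_eq by simp

text \<open>Differentiation removes the correction terms and leaves a sum over the whole lattice,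
  which a shift of the index turns into itself. Periodicity is therefore proved for
  \<open>deriv wp\<close> and then integrated to \<open>wp\<close> and \<open>wzeta\<close>.\<close>

lemma deriv_wp_has_sum:
  assumes z: "z \<notin> gauss_ints"
  shows "((\<lambda>l. - 2 / (z - l) ^ 3) has_sum deriv wp z) gauss_ints"
proof -
  obtain D where D: "(wp_sum has_field_derivative D) (at z)"
    "((\<lambda>l. - 2 / (z - l) ^ 3) has_sum D) gauss_ints'"
    using wp_sum_has_field_derivative not_gauss_ints_imp z by blast
  have "((\<lambda>l. - 2 / (z - l) ^ 3) has_sum (- 2 / (z - 0) ^ 3 + D)) (insert 0 gauss_ints')"
    by (rule has_sum_insert) (use D in auto)
  moreover have "insert 0 gauss_ints' = gauss_ints"
    by auto
  ultimately show ?thesis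
    using deriv_wp_eq[OF z] DERIV_imp_deriv[OF D(1)] by simp
qed

lemma wzeta_holomorphic: "wzeta holomorphic_on -gauss_ints"
  using wzeta_has_field_derivative by (subst holomorphic_on_open[OF open_gauss_ints_compl]) blast

lemma wp_holomorphic: "wp holomorphic_on -gauss_ints"
  using wp_has_field_derivative by (subst holomorphic_on_open[OF open_gauss_ints_compl]) blast

lemma deriv_wp_holomorphic: "deriv wp holomorphic_on -gauss_ints"
  by (intro holomorphic_deriv wp_holomorphic open_gauss_ints_compl)

lemma wzeta_analytic: "z \<notin> gauss_ints \<Longrightarrow> wzeta analytic_on {z}"
  and wp_analytic: "z \<notin> gauss_ints \<Longrightarrow> wp analytic_on {z}"
  and deriv_wp_analytic: "z \<notin> gauss_ints \<Longrightarrow> deriv wp analytic_on {z}"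
  using wzeta_holomorphic wp_holomorphic deriv_wp_holomorphic open_gauss_ints_compl
  by (auto simp: analytic_at)

section \<open>Periods and symmetries\<close>

lemma periodic_int_multiple:
  assumes "\<And>z. z \<in> D \<Longrightarrow> f (z + w) = f z" "\<And>z. z + w \<in> D \<longleftrightarrow> z \<in> D" "z \<in> D"
  shows "f (z + of_int m * w) = (f z :: 'a) \<and> (z :: complex) + of_int m * w \<in> D"
proof (induction m rule: int_induct[where k = 0])
  case base
  then show ?case using assms by simp
next
  case (step1 i)
  have eq: "z + of_int (i + 1) * w = (z + of_int i * w) + w"
    by (simp add: algebra_simps)
  show ?case
    unfolding eq using step1 assms(1,2)[of "z + of_int i * w"] by simp
next
  case (step2 i)
  have "z + of_int i * w = (z + of_int (i - 1) * w) + w"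
    by (simp add: algebra_simps)
  then show ?case
    using step2(2) assms(1,2)[of "z + of_int (i - 1) * w"] by metis
qed

lemma periodic_gauss_int:
  assumes per: "\<And>z. z \<in> D \<Longrightarrow> f (z + 1) = f z" "\<And>z. z \<in> D \<Longrightarrow> f (z + \<i>) = f z"
    and D: "\<And>z. z + 1 \<in> D \<longleftrightarrow> z \<in> D" "\<And>z. z + \<i> \<in> D \<longleftrightarrow> z \<in> D"
    and "z \<in> D" "l \<in> gauss_ints"
  shows "f (z + l) = (f z :: 'a)"
proof -
  obtain m n where l: "l = of_int m * 1 + of_int n * \<i>"
    using \<open>l \<in> gauss_ints\<close> by (auto simp: gauss_ints_eq_image complex_eq_iff)
  have 1: "f (z + of_int m * 1) = f z \<and> z + of_int m * 1 \<in> D"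
    by (rule periodic_int_multiple) fact+
  then have "f (z + of_int m * 1 + of_int n * \<i>) = f (z + of_int m * 1) \<and> z + of_int m * 1 + of_int n * \<i> \<in> D"
    by (intro periodic_int_multiple[where D = D]) (use per D in auto)
  then show ?thesis
    using 1 by (simp add: l add.assoc)
qed

lemma deriv_zero_gauss_ints_compl:
  assumes "\<And>z. z \<notin> gauss_ints \<Longrightarrow> (f has_field_derivative 0) (at z)" "x \<notin> gauss_ints" "y \<notin> gauss_ints"
  shows "f x = f y"
proof (rule has_derivative_zero_unique_connected[where f = f, OF open_gauss_ints_compl connected_gauss_ints_compl])
  show "(f has_derivative (\<lambda>x. 0)) (at x)" if "x \<in> - gauss_ints" for x
    using assms(1)[of x] that by (simp add: has_field_derivative_def lambda_zero)
qed (use assms in auto)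

lemma deriv_wp_periodic:
  assumes "z \<notin> gauss_ints" "m \<in> gauss_ints"
  shows "deriv wp (z + m) = deriv wp z"
proof (rule has_sum_unique)
  show "((\<lambda>l. - 2 / (z - l) ^ 3) has_sum deriv wp z) gauss_ints"
    by (rule deriv_wp_has_sum) fact
  have "((\<lambda>l. - 2 / (z + m - l) ^ 3) has_sum deriv wp (z + m)) gauss_ints"
    by (rule deriv_wp_has_sum) (use assms in auto)
  also have "((\<lambda>l. - 2 / (z + m - l) ^ 3) has_sum deriv wp (z + m)) gauss_ints \<longleftrightarrow>
      ((\<lambda>l. - 2 / (z - l) ^ 3) has_sum deriv wp (z + m)) gauss_ints"
    by (rule has_sum_reindex_bij_witness[of _ "\<lambda>l. l + m" "\<lambda>l. l - m"]) (use assms in \<open>auto simp: algebra_simps\<close>)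
  finally show "((\<lambda>l. - 2 / (z - l) ^ 3) has_sum deriv wp (z + m)) gauss_ints" .
qed

lemma wp_minus [simp]: "wp (- z) = wp z"
proof -
  have "wp_sum (- z) = wp_sum z"
    unfolding wp_sum_def
    by (rule infsum_reindex_bij_witness[of _ uminus uminus]) (auto simp: power2_eq_square algebra_simps)
  then show ?thesis
    by (simp add: wp_def)
qed

lemma wzeta_minus [simp]: "wzeta (- z) = - wzeta z"
proof -
  have "1 / (- z - l) + 1 / l + (- z) / l ^ 2 = - (1 / (z - (- l)) + 1 / (- l) + z / (- l) ^ 2)" for l
  proof -
    have "1 / (- z - l) = - (1 / (z + l))"
      by (metis add.commute minus_add_distrib minus_divide_right uminus_add_conv_diff diff_minus_eq_add minus_diff_eq)
    then show ?thesis
      by simp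
  qed
  then have "zeta_sum (- z) = (\<Sum>\<^sub>\<infinity>l\<in>gauss_ints'. - (1 / (z - (- l)) + 1 / (- l) + z / (- l) ^ 2))"
    by (simp add: zeta_sum_def)
  also have "\<dots> = (\<Sum>\<^sub>\<infinity>l\<in>gauss_ints'. - (1 / (z - l) + 1 / l + z / l ^ 2))"
    by (rule infsum_reindex_bij_witness[of _ uminus uminus]) auto
  also have "\<dots> = - zeta_sum z"
    unfolding zeta_sum_def by (rule infsum_uminus)
  finally show ?thesis
    by (simp add: wzeta_def)
qed

lemma wp_cnj: "wp (cnj z) = cnj (wp z)"
proof -
  have "cnj (wp_sum z) = (\<Sum>\<^sub>\<infinity>l\<in>gauss_ints'. cnj (1 / (z - l) ^ 2 - 1 / l ^ 2))"
    by (simp add: wp_sum_def del: complex_cnj_diff)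
  also have "\<dots> = wp_sum (cnj z)"
    unfolding wp_sum_def by (rule infsum_reindex_bij_witness[of _ cnj cnj]) auto
  finally show ?thesis
    by (simp add: wp_def)
qed

lemma wzeta_cnj: "wzeta (cnj z) = cnj (wzeta z)"
proof -
  have "cnj (zeta_sum z) = (\<Sum>\<^sub>\<infinity>l\<in>gauss_ints'. cnj (1 / (z - l) + 1 / l + z / l ^ 2))"
    by (simp add: zeta_sum_def del: complex_cnj_add)
  also have "\<dots> = zeta_sum (cnj z)"
    unfolding zeta_sum_def by (rule infsum_reindex_bij_witness[of _ cnj cnj]) auto
  finally show ?thesis
    by (simp add: wzeta_def)
qed

text \<open>Multiplication by i permutes the Gaussian lattice, a symmetry that only square lattices
  have. It makes \<open>wp\<close> vanish at the centre of the square, and its analogue for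
  \<open>wzeta\<close> ties the quasi-period of i to that of 1.\<close>

lemma wp_mult_i: "wp (\<i> * z) = - wp z"
proof -
  have "(1 / (\<i> * z - \<i> * l) ^ 2 - 1 / (\<i> * l) ^ 2) = - (1 / (z - l) ^ 2 - 1 / l ^ 2)" for l
  proof -
    have "(\<i> * z - \<i> * l) ^ 2 = - ((z - l) ^ 2)"
      by (simp add: power2_eq_square algebra_simps)
    then show ?thesis
      by (simp add: power_mult_distrib)
  qed
  then have "(\<Sum>\<^sub>\<infinity>l\<in>gauss_ints'. - (1 / (z - l) ^ 2 - 1 / l ^ 2)) = wp_sum (\<i> * z)"
    unfolding wp_sum_def
    by (intro infsum_reindex_bij_witness[of _ "\<lambda>l. - \<i> * l" "\<lambda>l. \<i> * l"]) simp_all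
  then have "wp_sum (\<i> * z) = - wp_sum z"
    unfolding wp_sum_def by (simp add: infsum_uminus[symmetric])
  then show ?thesis
    by (simp add: wp_def power_mult_distrib)
qed

lemma wzeta_mult_i: "wzeta (\<i> * z) = - \<i> * wzeta z"
proof -
  have *: "1 / (\<i> * u) = - \<i> * (1 / u)" for u
    by (cases "u = 0") (auto simp: field_simps)
  have "1 / (\<i> * z - \<i> * l) + 1 / (\<i> * l) + \<i> * z / (\<i> * l) ^ 2 =
      - \<i> * (1 / (z - l) + 1 / l + z / l ^ 2)" for l
    using *[of "z - l"] *[of l] by (simp add: algebra_simps power_mult_distrib)
  then have "(\<Sum>\<^sub>\<infinity>l\<in>gauss_ints'. - \<i> * (1 / (z - l) + 1 / l + z / l ^ 2)) = zeta_sum (\<i> * z)"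
    unfolding zeta_sum_def
    by (intro infsum_reindex_bij_witness[of _ "\<lambda>l. - \<i> * l" "\<lambda>l. \<i> * l"]) simp_all
  then have "zeta_sum (\<i> * z) = - \<i> * zeta_sum z"
    unfolding zeta_sum_def by (subst (asm) infsum_cmult_right') simp
  then show ?thesis
    using *[of z] by (simp add: wzeta_def algebra_simps)
qed

text \<open>The difference of both sides has derivative 0, and at - m / 2 it vanishes because
  \<open>wp\<close> is even. This requires that m / 2 is not a lattice point, so the argument is
  applied to 1 and i, which generate the lattice.\<close>

lemma wp_periodic:
  assumes "z \<notin> gauss_ints" "m \<in> gauss_ints"
  shows "wp (z + m) = wp z"
proof -
  have *: "wp (z + m) = wp z" if z: "z \<notin> gauss_ints" and m: "m \<in> gauss_ints" "m / 2 \<notin> gauss_ints" for z m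
  proof -
    have "wp (z + m) - wp z = wp (- (m / 2) + m) - wp (- (m / 2))"
    proof (rule deriv_zero_gauss_ints_compl[where f = "\<lambda>z. wp (z + m) - wp z"])
      fix z assume z: "z \<notin> gauss_ints"
      have "((\<lambda>z. wp (z + m)) has_field_derivative deriv wp (z + m)) (at z)"
        using wp_has_field_derivative[of "z + m"] z m by (simp add: DERIV_shift)
      from DERIV_diff[OF this wp_has_field_derivative[OF z]]
      show "((\<lambda>z. wp (z + m) - wp z) has_field_derivative 0) (at z)"
        using deriv_wp_periodic[of z m] z m by simp
    qed (use z m in auto)
    also have "\<dots> = 0"
      using wp_minus[of "m / 2"] by simp
    finally show ?thesis
      by simp
  qed
  have half: "1 / 2 \<notin> gauss_ints" "\<i> / 2 \<notin> gauss_ints"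
    using norm_gauss_int_ge_1[of "1 / 2"] norm_gauss_int_ge_1[of "\<i> / 2"] by (auto simp: norm_divide)
  show ?thesis
    by (rule periodic_gauss_int[where D = "-gauss_ints"]) (use * half assms in auto)
qed

text \<open>The quasi-period of the Weierstrass zeta-function for the period 1; it is real since the
  lattice is closed under conjugation. By Legendre's relation its value is pi.\<close>

definition wkappa :: real
  where "wkappa = 2 * Re (wzeta (1 / 2))"

lemma of_real_wkappa: "of_real wkappa = 2 * wzeta (1 / 2)"
proof -
  have "Im (wzeta (1 / 2)) = 0"
    using wzeta_cnj[of "1 / 2"] by (simp add: complex_eq_iff)
  then show ?thesis
    by (simp add: wkappa_def complex_eq_iff)
qed

text \<open>The difference is constant by the periodicity of \<open>wp\<close>; at - 1/2, oddness
  turns it into twice the value at 1/2.\<close>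

lemma wzeta_plus_1:
  assumes "z \<notin> gauss_ints"
  shows "wzeta (z + 1) = wzeta z + wkappa"
proof -
  have half: "- 1 / 2 \<notin> gauss_ints"
    using norm_gauss_int_ge_1[of "- 1 / 2"] by (auto simp: norm_divide)
  have "wzeta (z + 1) - wzeta z = wzeta (- 1 / 2 + 1) - wzeta (- 1 / 2)"
  proof (rule deriv_zero_gauss_ints_compl[where f = "\<lambda>z. wzeta (z + 1) - wzeta z"])
    fix z assume z: "z \<notin> gauss_ints"
    have "((\<lambda>z. wzeta (z + 1)) has_field_derivative - wp (z + 1)) (at z)"
      using wzeta_has_field_derivative[of "z + 1"] z by (simp add: DERIV_shift)
    from DERIV_diff[OF this wzeta_has_field_derivative[OF z]]
    show "((\<lambda>z. wzeta (z + 1) - wzeta z) has_field_derivative 0) (at z)"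
      using wp_periodic[of z 1] z by simp
  qed (use assms half in auto)
  also have "\<dots> = wkappa"
    using wzeta_minus[of "1 / 2"] by (simp add: of_real_wkappa)
  finally show ?thesis
    by (simp add: algebra_simps)
qed

lemma wzeta_plus_i:
  assumes "z \<notin> gauss_ints"
  shows "wzeta (z + \<i>) = wzeta z - \<i> * wkappa"
proof -
  define u where "u = - \<i> * z"
  have z: "z = \<i> * u"
    by (simp add: u_def)
  have "wzeta (z + \<i>) = wzeta (\<i> * (u + 1))"
    by (simp add: z distrib_left)
  also have "\<dots> = - \<i> * (wzeta u + wkappa)"
    unfolding wzeta_mult_i using wzeta_plus_1[of u] assms by (simp add: z)
  also have "\<dots> = - \<i> * wzeta u - \<i> * wkappa"
    by (simp add: distrib_left)
  also have "- \<i> * wzeta u = wzeta z"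
    unfolding z wzeta_mult_i ..
  finally show ?thesis .
qed

text \<open>The quasi-periods of \<open>wzeta\<close> are \<open>wkappa\<close> for \<open>1\<close> and \<open>- \<i> wkappa\<close> for \<open>\<i>\<close>. By the symmetry of the lattice
  they are proportional to the conjugates of the periods, so no linear term in \<open>z\<close> is needed.\<close>

definition wG :: "complex \<Rightarrow> complex"
  where "wG z = wzeta z - wkappa * cnj z"

lemma wG_periodic:
  assumes "z \<notin> gauss_ints" "m \<in> gauss_ints"
  shows "wG (z + m) = wG z"
  by (rule periodic_gauss_int[where D = "-gauss_ints"])
     (use assms in \<open>auto simp: wG_def wzeta_plus_1 wzeta_plus_i algebra_simps\<close>)

lemma wG_minus [simp]: "wG (- z) = - wG z"
  by (simp add: wG_def)

lemma wG_cnj: "wG (cnj z) = cnj (wG z)"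
  by (simp add: wG_def wzeta_cnj)

lemma wG_mult_i: "wG (\<i> * z) = - \<i> * wG z"
  by (simp add: wG_def wzeta_mult_i algebra_simps)

text \<open>\<open>wG\<close> is odd, and a half-period is congruent to its negative.\<close>

lemma wG_half_period:
  assumes "2 * z \<in> gauss_ints" "z \<notin> gauss_ints"
  shows "wG z = 0"
  using wG_periodic[of "-z" "2 * z"] assms by simp

lemma wzeta_periodic:
  assumes "z \<notin> gauss_ints" "m \<in> gauss_ints"
  shows "wzeta (z + m) = wzeta z + wkappa * cnj m"
  using wG_periodic[OF assms] by (simp add: wG_def algebra_simps)

section \<open>Meromorphy, leading terms at 0 and Liouville's theorem\<close>

lemma eventually_not_gauss_ints: "eventually (\<lambda>w. w \<notin> gauss_ints) (at z)"
proof -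
  have "open (- (gauss_ints - {z}))" 
  proof -
    have "gauss_ints - {z} = gauss_ints - ball z 1 \<or> z \<notin> gauss_ints"
    proof (cases "z \<in> gauss_ints")
      case True
      then show ?thesis
        using norm_gauss_int_ge_1[of "z - _"] by (force simp: dist_norm)
    qed auto
    then have "closed (gauss_ints - {z})"
      using closed_gauss_ints by (metis Diff_empty Diff_insert0 closed_Diff open_ball)
    then show ?thesis
      by (rule open_Compl)
  qed
  then have "eventually (\<lambda>w. w \<in> - (gauss_ints - {z})) (at z)"
    by (intro eventually_at_in_open') auto
  then show ?thesis
    using eventually_neq_at_within[of z] by eventually_elim auto
qed

lemma zeta_sum_holomorphic: "zeta_sum holomorphic_on -gauss_ints'"
  using zeta_sum_has_field_derivative
  by (subst holomorphic_on_open) (use closed_gauss_ints_Diff_0 in \<open>auto simp only: open_closed double_complement Compl_iff\<close>)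

lemma wp_sum_holomorphic: "wp_sum holomorphic_on -gauss_ints'"
  using wp_sum_has_field_derivative
  by (subst holomorphic_on_open) (use closed_gauss_ints_Diff_0 in \<open>auto simp only: open_closed double_complement Compl_iff\<close>)

lemma zeta_sum_analytic: "zeta_sum analytic_on {0}"
  and wp_sum_analytic: "wp_sum analytic_on {0}"
proof -
  have "open (-gauss_ints')"
    using closed_gauss_ints_Diff_0 by (simp only: open_closed double_complement)
  then show "zeta_sum analytic_on {0}" "wp_sum analytic_on {0}"
    using zeta_sum_holomorphic wp_sum_holomorphic by (auto simp: analytic_at)
qed

text \<open>The additive constant \<open>c\<close> admits quasi-periodic functions, so that the pole
  of \<open>wzeta\<close> at 0, like that of \<open>wp\<close>, can be carried to the other lattice
  points.\<close>

lemma meromorphic_gauss_periodicI: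
  assumes "f meromorphic_on {0}" "\<And>z. z \<notin> gauss_ints \<Longrightarrow> f analytic_on {z}"
    and "\<And>m. m \<in> gauss_ints \<Longrightarrow> \<exists>c. \<forall>z. z \<notin> gauss_ints \<longrightarrow> f (z + m) = f z + c"
  shows "f meromorphic_on UNIV"
proof -
  have "f meromorphic_on {z}" for z
  proof (cases "z \<in> gauss_ints")
    case True
    then obtain c where c: "\<And>w. w \<notin> gauss_ints \<Longrightarrow> f (w + z) = f w + c"
      using assms(3) by blast
    have "(\<lambda>w. f (w - z) + c) meromorphic_on {z}"
      by (intro meromorphic_on_add[OF meromorphic_on_compose[OF assms(1)] meromorphic_on_const])
         (auto intro!: analytic_intros)
    also have "?this \<longleftrightarrow> f meromorphic_on {z}"
    proof (rule meromorphic_on_cong[OF _ refl])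
      fix w assume w: "w \<in> {z}"
      show "\<forall>\<^sub>F w in at w. f (w - z) + c = f w"
        using eventually_not_gauss_ints[of w]
      proof eventually_elim
        case (elim w)
        then show ?case
          using c[of "w - z"] True by simp
      qed
    qed
    finally show ?thesis .
  qed (use assms(2) in \<open>auto intro: analytic_on_imp_meromorphic_on\<close>)
  then show ?thesis
    by (subst meromorphic_on_meromorphic_at) auto
qed

lemma wp_meromorphic: "wp meromorphic_on UNIV"
proof (rule meromorphic_gauss_periodicI)
  show "wp meromorphic_on {0}"
    unfolding wp_def[abs_def]
    by (intro meromorphic_intros analytic_on_imp_meromorphic_on[OF wp_sum_analytic])
  show "\<exists>c. \<forall>z. z \<notin> gauss_ints \<longrightarrow> wp (z + m) = wp z + c" if "m \<in> gauss_ints" for m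
    using wp_periodic that by (intro exI[of _ 0]) auto
qed (rule wp_analytic)

lemma wzeta_meromorphic: "wzeta meromorphic_on UNIV"
proof (rule meromorphic_gauss_periodicI)
  show "wzeta meromorphic_on {0}"
    unfolding wzeta_def[abs_def]
    by (intro meromorphic_intros analytic_on_imp_meromorphic_on[OF zeta_sum_analytic])
  show "\<exists>c. \<forall>z. z \<notin> gauss_ints \<longrightarrow> wzeta (z + m) = wzeta z + c" if "m \<in> gauss_ints" for m
    using wzeta_periodic that by auto
qed (rule wzeta_analytic)

lemma deriv_wp_meromorphic: "deriv wp meromorphic_on UNIV"
  by (intro meromorphic_intros wp_meromorphic)

lemma tendsto_wp_0: "((\<lambda>z. z ^ 2 * wp z) \<longlongrightarrow> 1) (at 0)"
proof -
  have "isCont wp_sum 0"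
    using wp_sum_analytic by (rule analytic_at_imp_isCont)
  then have "((\<lambda>z. 1 + z ^ 2 * wp_sum z) \<longlongrightarrow> 1 + 0 ^ 2 * wp_sum 0) (at 0)"
    by (intro tendsto_intros) (simp add: isCont_def)
  moreover have "eventually (\<lambda>z. 1 + z ^ 2 * wp_sum z = z ^ 2 * wp z) (at (0::complex))"
    using eventually_neq_at_within[of "0::complex"]
    by eventually_elim (simp add: wp_def field_simps)
  ultimately show ?thesis
    by (simp add: Lim_transform_eventually)
qed

lemma is_pole_wp_0: "is_pole wp 0"
proof -
  have "filterlim (\<lambda>z. 1 / z ^ 2) at_infinity (at (0 :: complex))"
    using is_pole_inverse_power[of 2 0] by (simp add: is_pole_def)
  from tendsto_mult_filterlim_at_infinity[OF tendsto_wp_0 _ this]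
  have "filterlim (\<lambda>z. z ^ 2 * wp z * (1 / z ^ 2)) at_infinity (at 0)"
    by simp
  also have "?this \<longleftrightarrow> filterlim wp at_infinity (at 0)"
    by (intro filterlim_cong refl eventually_mono[OF eventually_neq_at_within[of 0]]) simp
  finally show ?thesis
    by (simp add: is_pole_def)
qed

lemma tendsto_deriv_wp_0: "((\<lambda>z. z ^ 3 * deriv wp z) \<longlongrightarrow> - 2) (at 0)"
proof -
  have an: "deriv wp_sum analytic_on {0}"
    using wp_sum_analytic by (rule analytic_deriv)
  then have "isCont (deriv wp_sum) 0"
    by (rule analytic_at_imp_isCont)
  then have "((\<lambda>z. - 2 + z ^ 3 * deriv wp_sum z) \<longlongrightarrow> - 2 + 0 ^ 3 * deriv wp_sum 0) (at 0)"
    by (intro tendsto_intros) (simp add: isCont_def)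
  moreover have "eventually (\<lambda>z. - 2 + z ^ 3 * deriv wp_sum z = z ^ 3 * deriv wp z) (at 0)"
    using eventually_not_gauss_ints[of 0]
  proof eventually_elim
    case (elim z)
    then have z: "z \<noteq> 0"
      by auto
    show ?case
      using z deriv_wp_eq[OF elim] by (simp add: field_simps)
  qed
  ultimately show ?thesis
    by (simp add: Lim_transform_eventually)
qed

lemma eventually_at_shift:
  "eventually P (at (z + c)) \<longleftrightarrow> eventually (\<lambda>w. P (w + c)) (at (z :: complex))"
  using filtermap_at_shift[of "-c" z] by (simp add: filter_eq_iff eventually_filtermap)

text \<open>With the singularities removed, the function is entire and bounded by its values on a
  period square. Hypotheses and conclusion hold only on punctured neighbourhoods, because the values
  of a HOL function at its singularities (such as quotients by 0) are arbitrary.\<close>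

lemma elliptic_constant:
  assumes mero: "f meromorphic_on UNIV"
    and per: "\<And>z. eventually (\<lambda>s. f (s + 1) = f s) (at z)" "\<And>z. eventually (\<lambda>s. f (s + \<i>) = f s) (at z)"
    and no_pole: "\<And>z. \<not> is_pole f z"
  obtains c where "\<And>z. eventually (\<lambda>s. f s = c) (at z)"
proof -
  define g where "g = remove_sings f"
  have iso: "isolated_singularity_at f z" for z
    using mero by (meson meromorphic_on_isolated_singularity meromorphic_on_subset subset_UNIV)
  have "g analytic_on UNIV"
    unfolding g_def
    by (rule nicely_meromorphic_without_singularities[OF remove_sings_nicely_meromorphic[OF mero]])
       (simp add: iso no_pole)
  then have holo: "g holomorphic_on UNIV"
    by (rule analytic_imp_holomorphic)
  then have cont: "isCont g z" for z
    by (metis UNIV_I continuous_on_eq_continuous_at holomorphic_on_imp_continuous_on open_UNIV)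
  have ev: "eventually (\<lambda>s. g s = f s) (at z)" for z
    unfolding g_def by (rule eventually_remove_sings_eq_at[OF iso])
  \<comment> \<open>The periods of \<open>f\<close> are known only near, not at, the exceptional
    points; continuity of \<open>g\<close> extends them to every point through uniqueness of
    limits.\<close>
  have shift: "g (z + c) = g z" if "\<And>z. eventually (\<lambda>s. f (s + c) = f s) (at z)" for z c
  proof -
    have "eventually (\<lambda>s. g (s + c) = f (s + c)) (at z)"
      using ev[of "z + c"] by (simp add: eventually_at_shift)
    with ev[of z] that[of z] have "eventually (\<lambda>s. g s = g (s + c)) (at z)"
      by eventually_elim auto
    moreover have "(g \<longlongrightarrow> g z) (at z)"
      using cont by (simp add: isCont_def)
    ultimately have "((\<lambda>s. g (s + c)) \<longlongrightarrow> g z) (at z)"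
      by (rule Lim_transform_eventually[rotated])
    moreover have "isCont (\<lambda>s. g (s + c)) z"
      by (rule isCont_o2[OF _ cont]) simp
    then have "((\<lambda>s. g (s + c)) \<longlongrightarrow> g (z + c)) (at z)"
      by (simp add: isCont_def)
    ultimately show ?thesis
      using tendsto_unique trivial_limit_at by blast
  qed
  have per_g: "g (z + l) = g z" if "l \<in> gauss_ints" for z l
    by (rule periodic_gauss_int[where D = UNIV]) (use shift per that in auto)
  have "range g \<subseteq> g ` cbox 0 (1 + \<i>)"
  proof safe
    fix z
    define l where "l = Complex (of_int \<lfloor>Re z\<rfloor>) (of_int \<lfloor>Im z\<rfloor>)"
    have "g z = g (z - l)"
      using per_g[of l "z - l"] by (auto simp: l_def gauss_ints_def)
    moreover have "z - l \<in> cbox 0 (1 + \<i>)"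
      unfolding l_def by (auto simp: in_cbox_complex_iff; linarith)
    ultimately show "g z \<in> g ` cbox 0 (1 + \<i>)"
      by blast
  qed
  moreover have "bounded (g ` cbox 0 (1 + \<i>))"
    using cont by (intro compact_imp_bounded compact_continuous_image continuous_at_imp_continuous_on) auto
  ultimately have "bounded (range g)"
    by (metis bounded_subset)
  then obtain c where "\<And>z. g z = c"
    using Liouville_theorem[OF holo] by (auto simp: constant_on_def)
  then show ?thesis
    using ev that by (metis (mono_tags, lifting) eventually_mono)
qed

section \<open>Identities from Liouville's theorem\<close>

text \<open>The factorisation is an identity of total functions, with the derivative filled in at
  \<open>a\<close>; it can be substituted inside limits without any neighbourhood condition.\<close>

lemma analytic_factor_zero:
  assumes "f analytic_on {a}" "f a = 0"
  obtains g where "g analytic_on {a}" "g a = deriv f a" "\<And>z. f z = (z - a) * g z"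
proof -
  define g where "g z = (if z = a then deriv f a else f z / (z - a))" for z
  have eq: "f z = (z - a) * g z" for z
    using assms(2) by (simp add: g_def)
  have "g analytic_on {a}"
  proof (rule pole_theorem_analytic_0[of f _ a])
    show "\<exists>d>0. \<forall>w\<in>ball z d - {a}. f w = (w - a) * g w" for z
      by (intro exI[of _ "1 :: real"] conjI ballI eq) simp
  qed (use assms in \<open>simp_all add: g_def\<close>)
  with eq show ?thesis
    by (intro that[of g]) (auto simp: g_def)
qed

lemma tendsto_imp_not_is_pole: "(f \<longlongrightarrow> c) (at z) \<Longrightarrow> \<not> is_pole f (z :: complex)"
  using not_tendsto_and_filterlim_at_infinity[of "at z" f c] by (auto simp: is_pole_def)

lemma eventually_const_tendsto_eq:
  fixes f :: "complex \<Rightarrow> complex"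
  assumes "eventually (\<lambda>s. f s = c) (at z)" "(f \<longlongrightarrow> l) (at z)"
  shows "l = c"
  using tendsto_unique[OF trivial_limit_at assms(2) tendsto_eventually[OF assms(1)]] .

lemma is_pole_shift_iff: "is_pole f (z + c) \<longleftrightarrow> is_pole (\<lambda>w. f (w + c)) (z :: complex)"
proof -
  have "at (z + c) = filtermap (\<lambda>w. w + c) (at z)"
    using filtermap_at_shift[of "-c" z] by simp
  then show ?thesis
    by (simp only: is_pole_def filterlim_filtermap)
qed

lemma is_pole_minus_iff: "is_pole f (- z) \<longleftrightarrow> is_pole (\<lambda>w. f (- w)) (z :: complex)"
  by (simp add: is_pole_def filterlim_filtermap flip: filtermap_at_minus)

lemma is_pole_cong_at: "eventually (\<lambda>w. f w = g w) (at z) \<Longrightarrow> is_pole f z \<longleftrightarrow> is_pole g (z :: complex)"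
  by (simp add: is_pole_cong)

lemma eventually_diff_not_gauss_ints: "eventually (\<lambda>w. w - a \<notin> gauss_ints) (at z)"
  using eventually_at_shift[of "\<lambda>w. w - a \<notin> gauss_ints" "z - a" a] eventually_not_gauss_ints[of "z - a"] by simp

lemma tendsto_wzeta_0: "((\<lambda>z. z * wzeta z) \<longlongrightarrow> 1) (at 0)"
proof -
  have "isCont zeta_sum 0"
    using zeta_sum_analytic by (rule analytic_at_imp_isCont)
  then have "((\<lambda>z. 1 + z * zeta_sum z) \<longlongrightarrow> 1 + 0 * zeta_sum 0) (at 0)"
    by (intro tendsto_intros) (simp add: isCont_def)
  moreover have "eventually (\<lambda>z. 1 + z * zeta_sum z = z * wzeta z) (at (0::complex))"
    using eventually_neq_at_within[of "0::complex"]
    by eventually_elim (simp add: wzeta_def field_simps)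
  ultimately show ?thesis
    by (simp add: Lim_transform_eventually)
qed

lemma deriv_wp_minus:
  assumes "z \<notin> gauss_ints"
  shows "deriv wp (- z) = - deriv wp z"
proof -
  have "((\<lambda>w. wp (- w)) has_field_derivative - deriv wp (- z)) (at z)"
    using DERIV_chain2[OF wp_has_field_derivative DERIV_minus[OF DERIV_ident], of z UNIV] assms by simp
  then have "(wp has_field_derivative - deriv wp (- z)) (at z)"
    by simp
  then show ?thesis
    using DERIV_imp_deriv by fastforce
qed

text \<open>By the identity theorem on the connected complement of the lattice, \<open>wp\<close>
  would be constant there, against its pole at 0.\<close>

lemma wp_nonconstant:
  assumes "u \<notin> gauss_ints" "eventually (\<lambda>z. wp z = c) (at u)"
  shows False
proof -
  have const: "wp z = c" if "z \<notin> gauss_ints" for z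
  proof -
    have "wp z - c = 0"
    proof (rule analytic_continuation[where f = "\<lambda>z. wp z - c" and S = "-gauss_ints" and U = "{z. z \<notin> gauss_ints \<and> wp z = c}" and \<xi> = u])
      show "(\<lambda>z. wp z - c) holomorphic_on - gauss_ints"
        by (intro holomorphic_intros wp_holomorphic)
      have "frequently (\<lambda>z. z \<in> {z. z \<notin> gauss_ints \<and> wp z = c}) (at u)"
        using assms(2) eventually_not_gauss_ints[of u]
        by (intro eventually_frequently) (auto elim: eventually_elim2)
      then show "u islimpt {z. z \<notin> gauss_ints \<and> wp z = c}"
        by (simp add: islimpt_conv_frequently_at)
    qed (use assms that open_gauss_ints_compl connected_gauss_ints_compl in auto)
    then show ?thesis
      by simp
  qed
  have "eventually (\<lambda>z. c = wp z) (at 0)"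
    using eventually_not_gauss_ints[of 0] by eventually_elim (use const in auto)
  then have "(wp \<longlongrightarrow> c) (at 0)"
    by (rule Lim_transform_eventually[OF tendsto_const])
  then show False
    using tendsto_imp_not_is_pole is_pole_wp_0 by blast
qed

text \<open>The left-hand side is elliptic in \<open>s\<close>: the poles of the first factor at \<open>\<plusminus>u\<close> are cancelled by
  the second factor, and the pole of the second factor at \<open>0\<close> by the double zero of the first.\<close>

lemma wzeta_wp_identity:
  assumes u: "2 * u \<notin> gauss_ints"
    and s: "s \<notin> gauss_ints" "s - u \<notin> gauss_ints" "s + u \<notin> gauss_ints"
  shows "(wzeta (s - u) - wzeta (s + u) + 2 * wzeta u) * (wp s - wp u) = deriv wp u"
proof -
  have u': "u \<notin> gauss_ints"
    using u gauss_ints_add[of u u] by (auto simp flip: mult_2)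
  define B where "B s = wzeta (s - u) - wzeta (s + u) + 2 * wzeta u" for s
  define D where "D s = B s * (wp s - wp u)" for s
  have B_analytic: "B analytic_on {s}" if "s - u \<notin> gauss_ints" "s + u \<notin> gauss_ints" for s
  proof -
    have "(wzeta \<circ> (\<lambda>s. s - u)) analytic_on {s}" "(wzeta \<circ> (\<lambda>s. s + u)) analytic_on {s}"
      using that wzeta_analytic by (intro analytic_on_compose analytic_intros; simp)+
    then have "(\<lambda>s. wzeta (s - u)) analytic_on {s}" "(\<lambda>s. wzeta (s + u)) analytic_on {s}"
      by (simp_all add: o_def)
    then show ?thesis
      unfolding B_def[abs_def] by (intro analytic_intros)
  qed
  have D_analytic: "D analytic_on {s}" if "s \<notin> gauss_ints" "s - u \<notin> gauss_ints" "s + u \<notin> gauss_ints" for s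
    unfolding D_def[abs_def] using that by (intro analytic_intros B_analytic wp_analytic) auto
  \<comment> \<open>The two shifted arguments pick up the same quasi-period, which cancels in the
    difference.\<close>
  have D_periodic: "D (s + l) = D s"
    if "s \<notin> gauss_ints" "s - u \<notin> gauss_ints" "s + u \<notin> gauss_ints" "l \<in> gauss_ints" for s l
    using that wzeta_periodic[of "s - u" l] wzeta_periodic[of "s + u" l] wp_periodic[of s l]
    by (simp add: D_def B_def algebra_simps)
  have D_even: "D (- s) = D s" for s
    using wzeta_minus[of "s + u"] wzeta_minus[of "s - u"] by (simp add: D_def B_def algebra_simps del: wzeta_minus)
  have ev_regular: "eventually (\<lambda>s. s \<notin> gauss_ints \<and> s - u \<notin> gauss_ints \<and> s + u \<notin> gauss_ints) (at z)" for z
    using eventually_not_gauss_ints[of z] eventually_diff_not_gauss_ints[of u z] eventually_diff_not_gauss_ints[of "-u" z]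
    by eventually_elim auto
  have pole_shift: "is_pole D (z + l) \<longleftrightarrow> is_pole D z" if "l \<in> gauss_ints" for z l
    unfolding is_pole_shift_iff
    by (rule is_pole_cong_at, rule eventually_mono[OF ev_regular[of z]]) (use D_periodic that in auto)
  \<comment> \<open>\<open>B\<close> vanishes at 0 since \<open>wzeta\<close> is odd, and its
    derivative there is - wp u + wp u = 0 since \<open>wp\<close> is even. Both zeros are split off
    to compensate the double pole of \<open>wp\<close>.\<close>
  have lim_0: "\<exists>c. (D \<longlongrightarrow> c) (at 0)"
  proof -
    have Ban: "B analytic_on {0}"
      using u' by (intro B_analytic) auto
    obtain b where b: "b analytic_on {0}" "b 0 = deriv B 0" "\<And>z. B z = (z - 0) * b z"
      by (rule analytic_factor_zero[OF Ban]) (auto simp: B_def)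
    have "((\<lambda>s. wzeta (s - u)) has_field_derivative - wp u) (at 0)"
      "((\<lambda>s. wzeta (s + u)) has_field_derivative - wp u) (at 0)"
      using DERIV_shift[of wzeta "- wp u" 0 "- u"] wzeta_has_field_derivative[of "- u"]
        DERIV_shift[of wzeta "- wp u" 0 u] wzeta_has_field_derivative[of u] u' by simp_all
    then have "(B has_field_derivative - wp u - (- wp u) + 0) (at 0)"
      unfolding B_def[abs_def] by (intro DERIV_add DERIV_diff DERIV_const)
    then have "deriv B 0 = 0"
      using DERIV_imp_deriv[of B _ 0] by simp
    with b obtain c where c: "c analytic_on {0}" "\<And>z. b z = (z - 0) * c z"
      using analytic_factor_zero[of b 0] by metis
    have "(c \<longlongrightarrow> c 0) (at 0)" "(B \<longlongrightarrow> B 0) (at 0)"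
      using c(1) Ban analytic_at_imp_isCont by (auto simp: isCont_def)
    then have "((\<lambda>s. c s * (s ^ 2 * wp s) - B s * wp u) \<longlongrightarrow> c 0 * 1 - B 0 * wp u) (at 0)"
      by (intro tendsto_intros tendsto_wp_0)
    also have "(\<lambda>s. c s * (s ^ 2 * wp s) - B s * wp u) = D"
      by (auto simp: D_def b(3) c(2) power2_eq_square algebra_simps)
    finally show ?thesis ..
  qed
  \<comment> \<open>This limit determines the constant: \<open>wzeta (s - u)\<close> has a simple
    pole of residue 1, and \<open>wp s - wp u\<close> vanishes with slope \<open>deriv wp u\<close>.
    The term \<open>wzeta (s + u)\<close> is regular because 2 u is not a lattice point.\<close>
  have lim_u: "(D \<longlongrightarrow> deriv wp u) (at u)"
  proof -
    have "(\<lambda>s. wp s - wp u) analytic_on {u}"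
      by (intro analytic_intros wp_analytic u')
    then obtain h where h: "h analytic_on {u}" "h u = deriv (\<lambda>s. wp s - wp u) u" "\<And>z. wp z - wp u = (z - u) * h z"
      using analytic_factor_zero[of "\<lambda>s. wp s - wp u" u] by auto
    have "((\<lambda>s. wp s - wp u) has_field_derivative deriv wp u - 0) (at u)"
      by (intro DERIV_diff wp_has_field_derivative u' DERIV_const)
    then have hu: "h u = deriv wp u"
      using h(2) DERIV_imp_deriv by fastforce
    have "(h \<longlongrightarrow> h u) (at u)"
      using h(1) analytic_at_imp_isCont by (auto simp: isCont_def)
    moreover have "((\<lambda>s. (s - u) * wzeta (s - u)) \<longlongrightarrow> 1) (at u)"
      using tendsto_wzeta_0 by (subst at_to_0) (simp add: filterlim_filtermap)
    moreover have "isCont (\<lambda>s. wzeta (s + u)) u"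
      by (rule isCont_o2[of _ _ wzeta]) (use u wzeta_analytic analytic_at_imp_isCont in \<open>auto simp flip: mult_2\<close>)
    then have "((\<lambda>s. wzeta (s + u)) \<longlongrightarrow> wzeta (u + u)) (at u)"
      by (simp add: isCont_def)
    ultimately have "((\<lambda>s. (s - u) * wzeta (s - u) * h s + (2 * wzeta u - wzeta (s + u)) * ((s - u) * h s))
        \<longlongrightarrow> 1 * h u + (2 * wzeta u - wzeta (u + u)) * ((u - u) * h u)) (at u)"
      by (intro tendsto_intros)
    also have "(\<lambda>s. (s - u) * wzeta (s - u) * h s + (2 * wzeta u - wzeta (s + u)) * ((s - u) * h s)) = D"
      by (rule ext) (simp only: D_def B_def h(3), simp add: algebra_simps)
    finally show ?thesis
      by (simp add: hu)
  qed
  have no_pole: "\<not> is_pole D z" for z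
  proof -
    consider "z \<in> gauss_ints" | "z - u \<in> gauss_ints" | "z + u \<in> gauss_ints"
      | "z \<notin> gauss_ints" "z - u \<notin> gauss_ints" "z + u \<notin> gauss_ints"
      by blast
    then show ?thesis
    proof cases
      case 1
      then show ?thesis
        using pole_shift[of z 0] lim_0 tendsto_imp_not_is_pole by auto
    next
      case 2
      then show ?thesis
        using pole_shift[of "z - u" u] lim_u tendsto_imp_not_is_pole by auto
    next
      \<comment> \<open>\<open>D\<close> is even, so its behaviour at u is repeated at - u.\<close>
      case 3
      then show ?thesis
        using pole_shift[of "z + u" "- u"] lim_u tendsto_imp_not_is_pole is_pole_minus_iff[of D u]
        by (auto simp: D_even)
    next
      case 4
      then have "(D \<longlongrightarrow> D z) (at z)"
        using D_analytic analytic_at_imp_isCont by (auto simp: isCont_def)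
      then show ?thesis
        by (rule tendsto_imp_not_is_pole)
    qed
  qed
  have mero: "D meromorphic_on UNIV"
  proof -
    have "(\<lambda>s. wzeta (s - u)) meromorphic_on UNIV" "(\<lambda>s. wzeta (s + u)) meromorphic_on UNIV"
      by (auto intro!: meromorphic_on_compose[OF wzeta_meromorphic] analytic_intros)
    then show ?thesis
      unfolding D_def[abs_def] B_def[abs_def] by (intro meromorphic_intros wp_meromorphic)
  qed
  obtain c where c: "\<And>z. eventually (\<lambda>s. D s = c) (at z)"
    by (rule elliptic_constant[OF mero _ _ no_pole])
       (auto intro: eventually_mono[OF ev_regular] D_periodic)
  have D_eq: "D z = c" if "(D \<longlongrightarrow> D z) (at z)" for z
    using eventually_const_tendsto_eq[OF c that] .
  have "c = deriv wp u"
    using eventually_const_tendsto_eq[OF c lim_u] by simp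
  moreover have "(D \<longlongrightarrow> D s) (at s)"
    using D_analytic[OF s] analytic_at_imp_isCont by (auto simp: isCont_def)
  ultimately show ?thesis
    using D_eq[of s] by (simp add: D_def B_def)
qed

text \<open>If the derivative vanished, the product in \<open>wzeta_wp_identity\<close> would be 0
  for all s near u. Its zeta factor has a pole at s = u and hence is nonzero nearby, which would
  leave \<open>wp\<close> constant near u.\<close>

lemma deriv_wp_nonzero:
  assumes u: "2 * u \<notin> gauss_ints"
  shows "deriv wp u \<noteq> 0"
proof
  assume 0: "deriv wp u = 0"
  have u': "u \<notin> gauss_ints"
    using u gauss_ints_add[of u u] by (auto simp flip: mult_2)
  have "isCont (\<lambda>s. wzeta (s + u)) u"
    by (rule isCont_o2[of _ _ wzeta]) (use u wzeta_analytic analytic_at_imp_isCont in \<open>auto simp flip: mult_2\<close>)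
  then have "((\<lambda>s. wzeta (s + u)) \<longlongrightarrow> wzeta (u + u)) (at u)"
    by (simp add: isCont_def)
  moreover have "((\<lambda>s. (s - u) * wzeta (s - u)) \<longlongrightarrow> 1) (at u)"
    using tendsto_wzeta_0 by (subst at_to_0) (simp add: filterlim_filtermap)
  ultimately have "((\<lambda>s. (s - u) * wzeta (s - u) + (s - u) * (2 * wzeta u - wzeta (s + u)))
      \<longlongrightarrow> 1 + (u - u) * (2 * wzeta u - wzeta (u + u))) (at u)"
    by (intro tendsto_intros)
  then have "eventually (\<lambda>s. (s - u) * wzeta (s - u) + (s - u) * (2 * wzeta u - wzeta (s + u)) \<noteq> 0) (at u)"
    by (rule tendsto_imp_eventually_ne) auto
  moreover have "eventually (\<lambda>s. s + u \<notin> gauss_ints) (at u)"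
    using eventually_diff_not_gauss_ints[of "-u" u] by simp
  ultimately have "eventually (\<lambda>s. wp s = wp u) (at u)"
    using eventually_not_gauss_ints[of u] eventually_diff_not_gauss_ints[of u u]
  proof eventually_elim
    case (elim s)
    have "(s - u) * (wzeta (s - u) - wzeta (s + u) + 2 * wzeta u) \<noteq> 0"
      using elim(1) by (simp add: algebra_simps)
    then show ?case
      using wzeta_wp_identity[OF u, of s] elim 0 by auto
  qed
  then show False
    using wp_nonconstant u' by blast
qed

text \<open>Off the two exceptional cases, \<open>wzeta_wp_identity\<close> would have left-hand
  side 0 and a nonzero right-hand side. This replaces the count of preimages of an elliptic function
  of order 2.\<close>

lemma wp_eqD:
  assumes "2 * u \<notin> gauss_ints" "s \<notin> gauss_ints" "wp s = wp u"
  shows "s - u \<in> gauss_ints \<or> s + u \<in> gauss_ints"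
  using wzeta_wp_identity[OF assms(1,2)] deriv_wp_nonzero[OF assms(1)] assms(3) by auto

section \<open>Half-periods and the differential equation\<close>

lemma deriv_wp_half_period:
  assumes "2 * h \<in> gauss_ints" "h \<notin> gauss_ints"
  shows "deriv wp h = 0"
  using deriv_wp_periodic[of "- h" "2 * h"] deriv_wp_minus[of h] assms by (simp add: algebra_simps)

text \<open>The classical value e_1 of the lattice; the values at the other two half-periods turn
  out to be 0 and - e_1.\<close>

definition we :: real
  where "we = Re (wp (1 / 2))"

lemma gauss_ints_Complex: "Complex x y \<in> gauss_ints \<longleftrightarrow> x \<in> \<int> \<and> y \<in> \<int>"
  by (simp add: gauss_ints_def)

lemma half_not_Ints: "0 < x \<Longrightarrow> x < 1 \<Longrightarrow> (x :: real) \<notin> \<int>"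
  by (auto elim!: Ints_cases)

lemma wp_half: "wp (1 / 2) = of_real we"
  using wp_cnj[of "1 / 2"] by (simp add: we_def complex_eq_iff)

lemma wp_i_half: "wp (\<i> / 2) = - of_real we"
  using wp_mult_i[of "1 / 2"] by (simp add: wp_half)

text \<open>The rotation by i fixes the centre modulo the lattice, but reverses the sign of
  \<open>wp\<close>.\<close>

lemma wp_center: "wp (Complex (1/2) (1/2)) = 0"
proof -
  have "\<i> * Complex (1/2) (1/2) + 1 = Complex (1/2) (1/2)"
    by (simp add: complex_eq_iff)
  moreover have "wp (\<i> * Complex (1/2) (1/2) + 1) = wp (\<i> * Complex (1/2) (1/2))"
    by (rule wp_periodic) (use half_not_Ints[of "1/2"] in \<open>auto simp: gauss_ints_Complex\<close>)
  ultimately show ?thesis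
    by (simp add: wp_mult_i)
qed

text \<open>On these lines the conjugate of z is congruent to - z or to z, and \<open>wp\<close> is
  even and commutes with conjugation.\<close>

lemma wp_real_axes:
  assumes "2 * Re z \<in> \<int> \<or> 2 * Im z \<in> \<int>" "z \<notin> gauss_ints"
  shows "Im (wp z) = 0"
proof -
  have "wp (cnj z) = wp z"
    using assms(1)
  proof
    assume *: "2 * Re z \<in> \<int>"
    have "cnj z = - z + of_real (2 * Re z)"
      by (simp add: complex_eq_iff)
    moreover have "of_real (2 * Re z) \<in> gauss_ints"
      using * by (simp add: gauss_ints_def)
    ultimately show ?thesis
      using wp_periodic[of "- z" "of_real (2 * Re z)"] assms(2) by simp
  next
    assume *: "2 * Im z \<in> \<int>"
    have "cnj z = z + Complex 0 (- 2 * Im z)"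
      by (simp add: complex_eq_iff)
    moreover have "Complex 0 (- 2 * Im z) \<in> gauss_ints"
      using * by (auto simp: gauss_ints_def dest: Ints_minus)
    ultimately show ?thesis
      using wp_periodic[of z "Complex 0 (- 2 * Im z)"] assms(2) by simp
  qed
  then show ?thesis
    by (simp add: wp_cnj complex_eq_iff)
qed

lemma double_gauss_int: "z \<in> gauss_ints \<Longrightarrow> 2 * z \<in> gauss_ints"
  using gauss_ints_add[of z z] by (simp flip: mult_2)

lemma edge_not_gauss_ints [simp]:
  "Complex (1/2) y \<notin> gauss_ints" "Complex x (1/2) \<notin> gauss_ints"
  "0 < t \<Longrightarrow> t < 1 \<Longrightarrow> Complex t y \<notin> gauss_ints"
  "0 < t \<Longrightarrow> t < 1 \<Longrightarrow> Complex y t \<notin> gauss_ints"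
  using half_not_Ints by (auto simp: gauss_ints_Complex)

lemma edge_not_half_period:
  "0 < t \<Longrightarrow> t < 1/2 \<Longrightarrow> 2 * Complex t y \<notin> gauss_ints"
  "0 < t \<Longrightarrow> t < 1/2 \<Longrightarrow> 2 * Complex y t \<notin> gauss_ints"
  using half_not_Ints[of "2 * t"] by (auto simp: gauss_ints_def)

lemma has_real_derivative_vertical:
  assumes "(F has_field_derivative F') (at (Complex x y))"
  shows "((\<lambda>y. Re (F (Complex x y))) has_real_derivative - Im F') (at y)"
    and "((\<lambda>y. Im (F (Complex x y))) has_real_derivative Re F') (at y)"
proof -
  have "((\<lambda>y. Complex x y) has_vector_derivative \<i>) (at y)"
    by (auto simp: Complex_eq intro!: derivative_eq_intros)
  then have *: "((\<lambda>y. F (Complex x y)) has_vector_derivative (\<i> * F')) (at y)"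
    using field_vector_diff_chain_at[of "\<lambda>y. Complex x y" \<i> y F F'] assms by (simp add: o_def)
  show "((\<lambda>y. Re (F (Complex x y))) has_real_derivative - Im F') (at y)"
    using bounded_linear.has_vector_derivative[OF bounded_linear_Re *] by (simp add: has_real_derivative_iff_has_vector_derivative)
  show "((\<lambda>y. Im (F (Complex x y))) has_real_derivative Re F') (at y)"
    using bounded_linear.has_vector_derivative[OF bounded_linear_Im *] by (simp add: has_real_derivative_iff_has_vector_derivative)
qed

lemma wp_edge_deriv:
  "((\<lambda>y. Re (wp (Complex (1/2) y))) has_real_derivative - Im (deriv wp (Complex (1/2) y))) (at y)"
  "Re (deriv wp (Complex (1/2) y)) = 0"
proof -
  note * = has_real_derivative_vertical[OF wp_has_field_derivative[of "Complex (1/2) y"]]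
  show "((\<lambda>y. Re (wp (Complex (1/2) y))) has_real_derivative - Im (deriv wp (Complex (1/2) y))) (at y)"
    by (rule *) simp
  have "((\<lambda>y. Im (wp (Complex (1/2) y))) has_real_derivative Re (deriv wp (Complex (1/2) y))) (at y)"
    by (rule *) simp
  also have "(\<lambda>y. Im (wp (Complex (1/2) y))) = (\<lambda>y. 0)"
    by (rule ext, rule wp_real_axes) auto
  finally show "Re (deriv wp (Complex (1/2) y)) = 0"
    by (rule DERIV_unique[OF _ DERIV_const])
qed

lemma Rolle_has_real_derivative:
  fixes f :: "real \<Rightarrow> real"
  assumes "a < b" "f a = f b" "\<And>x. (f has_real_derivative f' x) (at x)"
  obtains z where "a < z" "z < b" "f' z = 0"
proof -
  have "\<exists>z. a < z \<and> z < b \<and> DERIV f z :> 0"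
    using assms DERIV_isCont real_differentiable_def
    by (intro Rolle continuous_at_imp_continuous_on) blast+
  then show ?thesis
    using that DERIV_unique assms(3) by blast
qed

lemma Complex_half_0: "Complex (1/2) 0 = 1/2"
  by (simp add: complex_eq_iff)

text \<open>Otherwise \<open>wp\<close> has equal real values at both ends of the edge from 1/2 to
  the centre. By Rolle's theorem its derivative then vanishes inside of the edge, where there are no
  half-periods.\<close>

lemma we_nonzero: "we \<noteq> 0"
proof
  assume "we = 0"
  then have "Re (wp (Complex (1/2) 0)) = Re (wp (Complex (1/2) (1/2)))"
    by (simp add: Complex_half_0 wp_half wp_center)
  then obtain y where y: "0 < y" "y < 1/2" and 0: "- Im (deriv wp (Complex (1/2) y)) = 0"
    using Rolle_has_real_derivative[of 0 "1/2", OF _ _ wp_edge_deriv(1)] by auto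
  then have "deriv wp (Complex (1/2) y) = 0"
    using wp_edge_deriv(2)[of y] by (simp add: complex_eq_iff)
  then show False
    using deriv_wp_nonzero edge_not_half_period(2)[OF y] by blast
qed

text \<open>\<open>wp_eqD\<close> is used with \<open>s\<close> in the role of its regular point: if
  2 s is not a lattice point, then h - s or h + s is one, and doubling contradicts this.\<close>

lemma wp_eq_half_period:
  assumes "wp s = wp h" "s \<notin> gauss_ints" "h \<notin> gauss_ints" "2 * h \<in> gauss_ints"
  shows "2 * s \<in> gauss_ints"
proof (rule ccontr)
  assume *: "2 * s \<notin> gauss_ints"
  have "h - s \<in> gauss_ints \<or> h + s \<in> gauss_ints"
    by (rule wp_eqD[OF * assms(3)]) (use assms in simp)
  then have "2 * (h - s) \<in> gauss_ints \<or> 2 * (h + s) \<in> gauss_ints"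
    using double_gauss_int by blast
  then show False
    using * assms(4) by (auto simp: algebra_simps)
qed

lemma half_period_cases:
  assumes "2 * h \<in> gauss_ints" "h \<notin> gauss_ints"
  obtains l where "l \<in> gauss_ints" "h = 1/2 + l" | l where "l \<in> gauss_ints" "h = \<i>/2 + l"
    | l where "l \<in> gauss_ints" "h = Complex (1/2) (1/2) + l"
proof -
  have half: "x \<in> \<int> \<or> x - 1/2 \<in> \<int>" if 2: "2 * x \<in> \<int>" for x :: real
  proof -
    obtain m where m: "2 * x = of_int m"
      using 2 by (rule Ints_cases)
    show ?thesis
    proof (cases "even m")
      case True
      then obtain k where "m = 2 * k" by (elim evenE)
      then have "x = of_int k" using m by simp
      then show ?thesis by simp
    next
      case False
      then obtain k where "m = 2 * k + 1" by (elim oddE)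
      then have "x - 1/2 = of_int k" using m by simp
      then show ?thesis by (metis Ints_of_int)
    qed
  qed
  have "Re h \<in> \<int> \<or> Re h - 1/2 \<in> \<int>" "Im h \<in> \<int> \<or> Im h - 1/2 \<in> \<int>"
    using assms(1) half by (auto simp: gauss_ints_def)
  then consider "h - 1/2 \<in> gauss_ints" | "h - \<i>/2 \<in> gauss_ints" | "h - Complex (1/2) (1/2) \<in> gauss_ints"
    using assms(2) by (auto simp: gauss_ints_def)
  then show ?thesis
    using that by (metis add.commute diff_add_cancel)
qed

lemma wp_half_period_values:
  assumes "2 * h \<in> gauss_ints" "h \<notin> gauss_ints"
  shows "wp h \<in> {0, of_real we, - of_real we}"
proof -
  have "1 / 2 \<notin> gauss_ints" "\<i> / 2 \<notin> gauss_ints"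
    using half_not_Ints[of "1/2"] by (auto simp: gauss_ints_def)
  then show ?thesis
    using wp_periodic wp_half wp_i_half wp_center by (cases rule: half_period_cases[OF assms]) auto
qed

text \<open>If \<phi> has a zero of order n \<ge> 2, then the quotient has order 2 (n - 1) - n = n -
  2 \<ge> 0. The argument is uniform in n, so the exact order of the zero may remain open.\<close>

lemma tendsto_deriv_squared_over:
  assumes an: "\<phi> analytic_on {h}" and 0: "\<phi> h = 0" "deriv \<phi> h = 0"
    and nz: "eventually (\<lambda>z. \<phi> z \<noteq> 0) (at h)"
  shows "\<exists>c. ((\<lambda>z. deriv \<phi> z ^ 2 / \<phi> z) \<longlongrightarrow> c) (at h)"
proof -
  obtain d where d: "d > 0" "\<phi> holomorphic_on ball h d"
    using an by (auto simp: analytic_on_def)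
  obtain d' where d': "d' > 0" "\<And>z. z \<noteq> h \<Longrightarrow> dist z h < d' \<Longrightarrow> \<phi> z \<noteq> 0"
    using nz by (auto simp: eventually_at)
  have "h + of_real (min d d' / 2) \<in> ball h d" "\<phi> (h + of_real (min d d' / 2)) \<noteq> 0"
    using d d'(1) d'(2)[of "h + of_real (min d d' / 2)"] by (auto simp: dist_norm)
  then have ex: "\<exists>w\<in>ball h d. \<phi> w \<noteq> 0"
    by blast
  obtain n g r where n: "n > (0::nat)" and r: "r > 0" "g holomorphic_on ball h r"
      and g: "\<And>w. w \<in> ball h r \<Longrightarrow> \<phi> w = g w * (w - h) ^ n \<and> g w \<noteq> 0"
  proof -
    have "h \<in> ball h d"
      using d(1) by simp
    from zorder_exist_zero[OF d(2) open_ball connected_ball this ex] 0(1)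
    obtain r where "zorder \<phi> h > 0" "r > 0" "zor_poly \<phi> h holomorphic_on cball h r"
      "\<forall>w\<in>cball h r. \<phi> w = zor_poly \<phi> h w * (w - h) ^ nat (zorder \<phi> h) \<and> zor_poly \<phi> h w \<noteq> 0"
      by auto
    then show ?thesis
      by (intro that[of "nat (zorder \<phi> h)" r "zor_poly \<phi> h"]) (auto intro: holomorphic_on_subset)
  qed
  have g_deriv: "(g has_field_derivative deriv g w) (at w)" if "w \<in> ball h r" for w
    using r(2) that by (simp add: holomorphic_derivI)
  have \<phi>_deriv: "deriv \<phi> w = deriv g w * (w - h) ^ n + of_nat n * (w - h) ^ (n - 1) * g w"
    if "w \<in> ball h r" for w
  proof -
    have "((\<lambda>w. g w * (w - h) ^ n) has_field_derivative
        deriv g w * (w - h) ^ n + of_nat n * (w - h) ^ (n - 1) * g w) (at w)"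
      using g_deriv[OF that] by (auto intro!: derivative_eq_intros)
    then have "(\<phi> has_field_derivative
        deriv g w * (w - h) ^ n + of_nat n * (w - h) ^ (n - 1) * g w) (at w)"
      by (rule has_field_derivative_transform_within_open[OF _ open_ball that]) (use g in auto)
    then show ?thesis
      by (rule DERIV_imp_deriv)
  qed
  have "n \<noteq> 1"
    using \<phi>_deriv[of h] g[of h] r(1) 0(2) by auto
  with n obtain m where m: "n = m + 2"
    by (intro that[of "n - 2"]) simp
  have "deriv g holomorphic_on ball h r"
    using r(2) by (simp add: holomorphic_deriv)
  then have "isCont g h" "isCont (deriv g) h"
    using r by (metis centre_in_ball continuous_on_eq_continuous_at holomorphic_on_imp_continuous_on open_ball)+
  then have "((\<lambda>z. (z - h) ^ m * (deriv g z * (z - h) + of_nat n * g z) ^ 2 / g z)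
      \<longlongrightarrow> (h - h) ^ m * (deriv g h * (h - h) + of_nat n * g h) ^ 2 / g h) (at h)"
    using g[of h] r(1) by (intro tendsto_intros) (auto simp: isCont_def)
  moreover have "eventually (\<lambda>z. (z - h) ^ m * (deriv g z * (z - h) + of_nat n * g z) ^ 2 / g z = deriv \<phi> z ^ 2 / \<phi> z) (at h)"
  proof -
    have "eventually (\<lambda>z. z \<in> ball h r - {h}) (at h)"
      using r(1) by (intro eventually_at_in_open) auto
    then show ?thesis
    proof eventually_elim
      case (elim z)
      define u where "u = z - h"
      have u: "u \<noteq> 0" and gz: "g z \<noteq> 0" "\<phi> z = g z * u ^ n"
        using elim g[of z] by (auto simp: u_def)
      have "deriv \<phi> z = u ^ (m + 1) * (deriv g z * u + of_nat n * g z)"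
        using \<phi>_deriv[of z] elim by (simp add: u_def m algebra_simps)
      then have "deriv \<phi> z ^ 2 = u ^ m * u ^ (m + 2) * (deriv g z * u + of_nat n * g z) ^ 2"
        by (simp add: power2_eq_square power_add algebra_simps)
      then show ?case
        using gz u by (simp add: m flip: u_def)
    qed
  qed
  ultimately show ?thesis
    by (intro exI) (rule Lim_transform_eventually)
qed

text \<open>The quotient of both sides is elliptic. It has no poles at the half-periods, since \<open>deriv wp\<close> vanishes
  there.\<close>

lemma wp_ode:
  assumes z: "z \<notin> gauss_ints"
  shows "deriv wp z ^ 2 = 4 * wp z * (wp z ^ 2 - of_real we ^ 2)"
proof -
  define K where "K s = wp s * (wp s ^ 2 - of_real we ^ 2)" for s
  define f where "f s = deriv wp s ^ 2 / K s" for s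
  have K_nz: "K s \<noteq> 0" if "2 * s \<notin> gauss_ints" for s
  proof
    assume "K s = 0"
    then have "wp s = 0 \<or> wp s = of_real we \<or> wp s = - of_real we"
      by (auto simp: K_def power2_eq_iff)
    then have "wp s = wp (Complex (1/2) (1/2)) \<or> wp s = wp (1/2) \<or> wp s = wp (\<i>/2)"
      by (simp add: wp_center wp_half wp_i_half)
    moreover have "s \<notin> gauss_ints"
      using that double_gauss_int by blast
    moreover have "1 / 2 \<notin> gauss_ints" "\<i> / 2 \<notin> gauss_ints" "2 * Complex (1/2) (1/2) \<in> gauss_ints"
      using half_not_Ints[of "1/2"] by (auto simp: gauss_ints_def)
    ultimately show False
      using that wp_eq_half_period[of s "1/2"] wp_eq_half_period[of s "\<i>/2"]
        wp_eq_half_period[of s "Complex (1/2) (1/2)"] edge_not_gauss_ints(1) by auto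
  qed
  have f_analytic: "f analytic_on {s}" if "2 * s \<notin> gauss_ints" for s
  proof -
    have "s \<notin> gauss_ints"
      using that double_gauss_int by blast
    then show ?thesis
      unfolding f_def[abs_def] using K_nz[OF that]
      unfolding K_def[abs_def] by (intro analytic_intros wp_analytic deriv_wp_analytic) auto
  qed
  have f_periodic: "f (s + l) = f s" if "s \<notin> gauss_ints" "l \<in> gauss_ints" for s l
    using that by (simp add: f_def K_def wp_periodic deriv_wp_periodic)
  have pole_shift: "is_pole f (s + l) \<longleftrightarrow> is_pole f s" if "l \<in> gauss_ints" for s l
    unfolding is_pole_shift_iff
    by (rule is_pole_cong_at, rule eventually_mono[OF eventually_not_gauss_ints[of s]]) (use f_periodic that in auto)
  \<comment> \<open>Numerator and denominator are multiplied by s^6, so that only the leading terms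
    remain; they give (- 2)^2 / 1, which determines the constant.\<close>
  have lim_0: "(f \<longlongrightarrow> 4) (at 0)"
  proof -
    have "((\<lambda>s. (s ^ 3 * deriv wp s) ^ 2 / ((s ^ 2 * wp s) * ((s ^ 2 * wp s) ^ 2 - (s ^ 2 * of_real we) ^ 2)))
        \<longlongrightarrow> (- 2) ^ 2 / (1 * (1 ^ 2 - (0 ^ 2 * of_real we) ^ 2))) (at 0)"
      by (intro tendsto_intros tendsto_wp_0 tendsto_deriv_wp_0) auto
    moreover have "eventually (\<lambda>s. (s ^ 3 * deriv wp s) ^ 2 / ((s ^ 2 * wp s) * ((s ^ 2 * wp s) ^ 2 - (s ^ 2 * of_real we) ^ 2)) = f s) (at 0)"
      using eventually_neq_at_within[of "0::complex"]
    proof eventually_elim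
      case (elim s)
      have "(s ^ 3 * deriv wp s) ^ 2 = s ^ 6 * deriv wp s ^ 2"
        by (simp add: power_mult_distrib flip: power_mult)
      moreover have "(s ^ 2 * wp s) * ((s ^ 2 * wp s) ^ 2 - (s ^ 2 * of_real we) ^ 2) = s ^ 6 * K s"
        by (simp add: K_def power2_eq_square eval_nat_numeral algebra_simps)
      ultimately show ?case
        using elim by (simp add: f_def)
    qed
    ultimately show ?thesis
      by (simp add: Lim_transform_eventually)
  qed
  have lim_half: "\<exists>c. (f \<longlongrightarrow> c) (at h)" if h: "2 * h \<in> gauss_ints" "h \<notin> gauss_ints" for h
  proof -
    define e where "e = wp h"
    have e: "e = 0 \<or> e = of_real we \<or> e = - of_real we"
      using wp_half_period_values[OF h] by (auto simp: e_def)
    define \<phi> where "\<phi> s = wp s - e" for s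
    \<comment> \<open>The cofactor of x - e in x (x^2 - we^2), valid as \<open>e\<close> is one of
      the three roots. At \<open>h\<close> its value is 3 e^2 - we^2, that is - we^2 or 2 we^2,
      which is nonzero.\<close>
    define k where "k s = wp s ^ 2 + e * wp s + (e ^ 2 - of_real we ^ 2)" for s
    have K: "K s = \<phi> s * k s" for s
      using e by (auto simp: K_def \<phi>_def k_def power2_eq_square algebra_simps)
    have kh: "k h \<noteq> 0"
      using e we_nonzero by (auto simp: k_def power2_eq_square simp flip: e_def)
    have an: "\<phi> analytic_on {h}" "k analytic_on {h}"
      unfolding \<phi>_def[abs_def] k_def[abs_def] by (intro analytic_intros wp_analytic h)+
    have deriv: "deriv \<phi> s = deriv wp s" if "s \<notin> gauss_ints" for s
    proof -
      have "(\<phi> has_field_derivative deriv wp s - 0) (at s)"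
        unfolding \<phi>_def[abs_def] by (intro DERIV_diff DERIV_const wp_has_field_derivative that)
      then show ?thesis
        using DERIV_imp_deriv by fastforce
    qed
    have "eventually (\<lambda>s. \<phi> s \<noteq> 0) (at h)"
    proof -
      have "eventually (\<lambda>s. 2 * s \<notin> gauss_ints) (at h)"
      proof -
        have "eventually (\<lambda>w. w \<notin> gauss_ints) (at (2 * h))"
          by (rule eventually_not_gauss_ints)
        moreover have "filterlim (\<lambda>s. 2 * s) (at (2 * h)) (at h)"
          by (auto simp: filterlim_at eventually_at_filter intro!: tendsto_intros)
        ultimately show ?thesis
          by (rule eventually_compose_filterlim)
      qed
      then show ?thesis
        by eventually_elim (use K_nz K in auto)
    qed
    then obtain c where "((\<lambda>z. deriv \<phi> z ^ 2 / \<phi> z) \<longlongrightarrow> c) (at h)"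
      using tendsto_deriv_squared_over[OF an(1)] deriv[OF h(2)] deriv_wp_half_period[OF h]
      by (auto simp: \<phi>_def e_def)
    moreover have "(k \<longlongrightarrow> k h) (at h)"
      using an(2) analytic_at_imp_isCont by (auto simp: isCont_def)
    ultimately have "((\<lambda>z. (deriv \<phi> z ^ 2 / \<phi> z) / k z) \<longlongrightarrow> c / k h) (at h)"
      using kh by (intro tendsto_intros)
    moreover have "eventually (\<lambda>z. (deriv \<phi> z ^ 2 / \<phi> z) / k z = f z) (at h)"
      using eventually_not_gauss_ints[of h] by eventually_elim (simp add: f_def K deriv)
    ultimately show ?thesis
      by (intro exI) (rule Lim_transform_eventually)
  qed
  have no_pole: "\<not> is_pole f s" for s
  proof -
    consider "s \<in> gauss_ints" | "2 * s \<in> gauss_ints" "s \<notin> gauss_ints" | "2 * s \<notin> gauss_ints"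
      by blast
    then show ?thesis
    proof cases
      case 1
      then show ?thesis
        using pole_shift[of s 0] lim_0 tendsto_imp_not_is_pole by auto
    next
      case 2
      then show ?thesis
        using lim_half tendsto_imp_not_is_pole by blast
    next
      case 3
      then have "(f \<longlongrightarrow> f s) (at s)"
        using f_analytic analytic_at_imp_isCont by (auto simp: isCont_def)
      then show ?thesis
        by (rule tendsto_imp_not_is_pole)
    qed
  qed
  have mero: "f meromorphic_on UNIV"
    unfolding f_def[abs_def] K_def[abs_def]
    by (intro meromorphic_intros wp_meromorphic deriv_wp_meromorphic)
  obtain c where c: "\<And>z. eventually (\<lambda>s. f s = c) (at z)"
    by (rule elliptic_constant[OF mero _ _ no_pole])
       (auto intro: eventually_mono[OF eventually_not_gauss_ints] f_periodic)
  have c4: "c = 4"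
    using eventually_const_tendsto_eq[OF c lim_0] by simp
  show ?thesis
  \<comment> \<open>At a half-period \<open>f\<close> has the default value 0 of a division by 0 and
    carries no information; there both sides of the equation vanish.\<close>
  proof (cases "2 * z \<in> gauss_ints")
    case True
    then show ?thesis
      using wp_half_period_values[OF True z] deriv_wp_half_period[OF True z] by auto
  next
    case False
    then have "(f \<longlongrightarrow> f z) (at z)"
      using f_analytic analytic_at_imp_isCont by (auto simp: isCont_def)
    then have "f z = 4"
      using eventually_const_tendsto_eq[OF c] c4 by blast
    then show ?thesis
      using K_nz[OF False] by (simp add: f_def K_def field_simps)
  qed
qed

section \<open>Real values of wp on the edges, and the bounds for wkappa\<close>

lemma wp_large_near_0: "\<exists>t>0. t < b \<and> Re (wp (Complex t 0)) > B" if "b > 0"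
proof -
  have 1: "filterlim (\<lambda>t. Complex t 0) (at 0) (at_right 0)"
    unfolding filterlim_at
    by (auto simp: complex_eq_iff eventually_at_filter Complex_eq intro!: tendsto_eq_intros)
  have "eventually (\<lambda>z. dist (z ^ 2 * wp z) 1 < 1/2) (at 0)"
    using tendsto_wp_0 by (rule tendstoD) simp
  then have "eventually (\<lambda>t. dist (Complex t 0 ^ 2 * wp (Complex t 0)) 1 < 1/2) (at_right 0)"
    using 1 by (rule eventually_compose_filterlim)
  moreover have "eventually (\<lambda>t. t < b) (at_right (0::real))"
    using that by (rule eventually_at_right_real[THEN eventually_mono]) auto
  moreover have "eventually (\<lambda>t. t > 0) (at_right (0::real))"
    by (rule eventually_at_right_less)
  moreover have "eventually (\<lambda>t. t ^ 2 * (\<bar>B\<bar> + 1) < 1/2) (at_right (0::real))"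
  proof -
    have "((\<lambda>t. t ^ 2 * (\<bar>B\<bar> + 1)) \<longlongrightarrow> 0 ^ 2 * (\<bar>B\<bar> + 1)) (at_right (0::real))"
      by (intro tendsto_intros)
    then show ?thesis
      by (rule order_tendstoD) auto
  qed
  ultimately have "eventually (\<lambda>t. t > 0 \<and> t < b \<and> Re (wp (Complex t 0)) > B) (at_right (0::real))"
  proof eventually_elim
    case (elim t)
    have "Re (Complex t 0 ^ 2 * wp (Complex t 0)) = t ^ 2 * Re (wp (Complex t 0))"
      by (simp add: power2_eq_square)
    then have "\<bar>t ^ 2 * Re (wp (Complex t 0)) - 1\<bar> < 1/2"
      using elim(1) abs_Re_le_cmod[of "Complex t 0 ^ 2 * wp (Complex t 0) - 1"] by (simp add: dist_norm)
    then have "t ^ 2 * Re (wp (Complex t 0)) > t ^ 2 * (\<bar>B\<bar> + 1)"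
      using elim(4) by linarith
    then have "Re (wp (Complex t 0)) > \<bar>B\<bar> + 1"
      using elim(3) by simp
    then show ?case
      using elim by auto
  qed
  then show ?thesis
    by (rule eventually_happens'[OF trivial_limit_at_right_real])
qed

lemma isCont_wp_horizontal:
  assumes "0 < t" "t < 1"
  shows "isCont (\<lambda>t. Re (wp (Complex t 0))) t"
proof -
  have "isCont wp (Complex t 0)"
    using wp_analytic[of "Complex t 0"] assms by (intro analytic_at_imp_isCont) auto
  moreover have "isCont (\<lambda>t. Complex t 0) t"
    unfolding Complex_eq by (intro continuous_intros)
  ultimately have "isCont (\<lambda>t. wp (Complex t 0)) t"
    by (rule isCont_o2[rotated])
  then show ?thesis
    by (rule isCont_Re)
qed

lemma wp_horizontal_IVT:
  assumes "0 < t" "t \<le> 1/2" "Re (wp (Complex t 0)) \<le> y"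
  obtains x where "0 < x" "x \<le> t" "wp (Complex x 0) = of_real y"
proof -
  obtain t1 where t1: "t1 > 0" "t1 < t" "Re (wp (Complex t1 0)) > y"
    using wp_large_near_0[of t y] assms by blast
  obtain x where "x \<ge> t1" "x \<le> t" "Re (wp (Complex x 0)) = y"
    using IVT2[of "\<lambda>t. Re (wp (Complex t 0))" t y t1] t1 assms isCont_wp_horizontal by auto
  moreover from this t1 assms have "Im (wp (Complex x 0)) = 0"
    by (intro wp_real_axes) auto
  ultimately show ?thesis
    using that[of x] t1 by (simp add: complex_eq_iff)
qed

text \<open>On the real axis \<open>wp\<close> comes down from + infinity at 0. If it were not
  positive at 1/2, it would take the value 0 on the bottom edge, but this value belongs to the
  centre and forces a half-period.\<close>

lemma we_pos: "we > 0"
proof (rule ccontr)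
  assume "\<not> we > 0"
  then have "Re (wp (Complex (1/2) 0)) \<le> 0"
    by (simp add: Complex_half_0 wp_half)
  then obtain x where x: "0 < x" "x \<le> 1/2" "wp (Complex x 0) = 0"
    using wp_horizontal_IVT[of "1/2" 0] by auto
  have "x \<noteq> 1/2"
  proof
    assume "x = 1/2"
    then have "wp (Complex x 0) = we"
      by (simp only: Complex_half_0 wp_half)
    then show False
      using x(3) we_nonzero by simp
  qed
  then have "x < 1/2"
    using x by auto
  then show False
    using wp_eq_half_period[of "Complex x 0" "Complex (1/2) (1/2)"] x edge_not_half_period(1)[of x 0]
      half_not_Ints[of x] half_not_Ints[of "1/2"]
    by (auto simp: wp_center gauss_ints_def)
qed

text \<open>Otherwise the intermediate value theorem yields a point of the open edge with value
  \<open>we\<close>, which would have to be a half-period.\<close>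

lemma wp_bottom_edge:
  assumes "0 < t" "t < 1/2"
  shows "Re (wp (Complex t 0)) > we"
proof (rule ccontr)
  assume "\<not> Re (wp (Complex t 0)) > we"
  then obtain x where x: "0 < x" "x \<le> t" "wp (Complex x 0) = of_real we"
    using wp_horizontal_IVT[of t we] assms by auto
  have "1 / 2 \<notin> gauss_ints"
    using half_not_Ints[of "1/2"] by (auto simp: gauss_ints_def)
  then have "2 * Complex x 0 \<in> gauss_ints"
    using x assms by (intro wp_eq_half_period[of "Complex x 0" "1/2"]) (auto simp: wp_half)
  then show False
    using x assms edge_not_half_period(1)[of x 0] by auto
qed

lemma wp_right_edge_ends:
  "Re (wp (Complex (1/2) 0)) = we" "Re (wp (Complex (1/2) (1/2))) = 0"
  by (simp_all only: Complex_half_0 wp_half wp_center) simp_all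

text \<open>\<open>wp_eqD\<close> demands that one of the two points is not a half-period, hence
  interior to the edge. The remaining pair of endpoints is separated by the values \<open>we\<close>
  and 0.\<close>

lemma wp_right_edge_inj: "inj_on (\<lambda>y. Re (wp (Complex (1/2) y))) {0..1/2}"
proof (rule inj_onI)
  have *: "y = y'" if y: "0 < y" "y < 1/2" and y': "0 \<le> y'" "y' \<le> 1/2"
    and eq: "Re (wp (Complex (1/2) y)) = Re (wp (Complex (1/2) y'))" for y y'
  proof -
    have "wp (Complex (1/2) y') = wp (Complex (1/2) y)"
      using eq wp_real_axes[of "Complex (1/2) _"] by (simp add: complex_eq_iff)
    then have "Complex (1/2) y' - Complex (1/2) y \<in> gauss_ints \<or> Complex (1/2) y' + Complex (1/2) y \<in> gauss_ints"
      by (rule wp_eqD[rotated -1]) (use edge_not_half_period(2)[OF y] in auto)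
    then have "y' - y \<in> \<int> \<or> y' + y \<in> \<int>"
      by (auto simp: gauss_ints_def)
    moreover have "\<bar>y' - y\<bar> < 1" "0 < y' + y" "y' + y < 1"
      using y y' by linarith+
    ultimately show ?thesis
      using Ints_nonzero_abs_less1[of "y' - y"] half_not_Ints[of "y' + y"] by auto
  qed
  fix y y' assume yy': "y \<in> {0..1/2}" "y' \<in> {0..1/2}" "Re (wp (Complex (1/2) y)) = Re (wp (Complex (1/2) y'))"
  consider "0 < y" "y < 1/2" | "0 < y'" "y' < 1/2" | "y \<in> {0, 1/2}" "y' \<in> {0, 1/2}"
    using yy' by force
  then show "y = y'"
  proof cases
    case 3
    then show ?thesis
      using yy'(3) we_nonzero wp_right_edge_ends by (metis insertE singletonD)
  next
    case 1
    then show ?thesis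
      using *[of y y'] yy' by simp
  next
    case 2
    then show ?thesis
      using *[of y' y] yy' by simp
  qed
qed

text \<open>A continuous injective function on an interval is monotone; the direction is read off
  from the end values, since \<open>we\<close> is positive.\<close>

lemma wp_right_edge_mono:
  assumes "0 \<le> y" "y < y'" "y' \<le> 1/2"
  shows "Re (wp (Complex (1/2) y)) > Re (wp (Complex (1/2) y'))"
proof -
  define v where "v y = Re (wp (Complex (1/2) y))" for y
  have v: "v 0 = we" "v (1/2) = 0"
    by (simp_all only: v_def wp_right_edge_ends)
  have cont: "continuous_on S v" for S
    unfolding v_def using wp_edge_deriv(1) DERIV_isCont
    by (intro continuous_at_imp_continuous_on) blast
  have inj: "inj_on v {a..b}" if "0 \<le> a" "b \<le> 1/2" for a b
    unfolding v_def by (rule inj_on_subset[OF wp_right_edge_inj]) (use that in auto)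
  have 1: "v y < we" if "0 < y" "y \<le> 1/2" for y
  proof (cases "y = 1/2")
    case False
    then show ?thesis
      using continuous_inj_imp_mono[of 0 y "1/2" v] that cont inj[of 0 "1/2"] v we_pos by auto
  next
    case True
    show ?thesis
      unfolding True v by (rule we_pos)
  qed
  show ?thesis
  proof (cases "y = 0")
    case True
    then show ?thesis
      using 1[of y'] assms v(1) by (simp add: v_def)
  next
    case False
    then show ?thesis
      using continuous_inj_imp_mono[of 0 y y' v] cont inj[of 0 y'] 1[of y'] v(1) assms
      by (auto simp: v_def)
  qed
qed

lemma wkappa_bounds: "0 < wkappa" "wkappa < we"
proof -
  \<comment> \<open>This is Im wG on the edge: wkappa * z and - wkappa * cnj z have the same
    imaginary part. It vanishes at both ends because these are half-periods, and the holomorphic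
    representative makes the derivative computable.\<close>
  define \<phi> where "\<phi> y = Im (wzeta (Complex (1/2) y) + wkappa * Complex (1/2) y)" for y
  have \<phi>: "(\<phi> has_real_derivative (wkappa - Re (wp (Complex (1/2) y)))) (at y)" for y
  proof -
    have "((\<lambda>z. wzeta z + wkappa * z) has_field_derivative (- wp (Complex (1/2) y) + of_real wkappa * 1)) (at (Complex (1/2) y))"
      by (intro DERIV_add wzeta_has_field_derivative DERIV_cmult DERIV_ident) simp
    from has_real_derivative_vertical(2)[OF this] show ?thesis
      unfolding \<phi>_def by simp
  qed
  have "\<phi> 0 = 0"
    using of_real_wkappa unfolding \<phi>_def by (simp add: Complex_half_0 complex_eq_iff)
  moreover have "\<phi> (1/2) = 0"
  proof -
    have "wG (Complex (1/2) (1/2)) = 0"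
      by (rule wG_half_period) (auto simp: gauss_ints_def intro: half_not_Ints)
    then show ?thesis
      by (simp add: \<phi>_def wG_def complex_eq_iff)
  qed
  ultimately obtain y where y: "0 < y" "y < 1/2" and 0: "wkappa - Re (wp (Complex (1/2) y)) = 0"
    using Rolle_has_real_derivative[of 0 "1/2", OF _ _ \<phi>] by auto
  then have "wkappa = Re (wp (Complex (1/2) y))"
    by simp
  then show "0 < wkappa" "wkappa < we"
    using wp_right_edge_mono[of 0 y] wp_right_edge_mono[of y "1/2"] y
    by (simp_all only: wp_right_edge_ends)
qed

text \<open>If \<open>Re ((k - w) / p) = 0\<close>, then \<open>w\<close> is a root of \<open>x (x\<^sup>2 - a\<^sup>2) + s (x - k)\<^sup>2\<close> for some real \<open>s > 0\<close>.
  This cubic has two real roots on both sides of \<open>k\<close>, hence only real ones.\<close>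

lemma Re_quotient_nonzero:
  fixes a k :: real and w p :: complex
  assumes k: "0 < k" "k < a" and p: "p ^ 2 = 4 * w * (w ^ 2 - of_real a ^ 2)" and w: "Im w \<noteq> 0"
  shows "Re ((k - w) / p) \<noteq> 0"
proof
  assume Re0: "Re ((k - w) / p) = 0"
  have ne: "w \<noteq> of_real x" for x
    using w by auto
  have "w ^ 2 - of_real a ^ 2 \<noteq> 0"
    using ne[of a] ne[of "-a"] by (auto simp: power2_eq_iff)
  then have p0: "p \<noteq> 0"
    using p ne[of 0] by auto
  define y where "y = Im ((k - w) / p)"
  have q: "(k - w) / p = \<i> * y"
    using Re0 by (simp add: y_def complex_eq_iff)
  have "y \<noteq> 0"
    using q p0 ne[of k] by auto
  \<comment> \<open>Squaring k - w = i y p gives (w - k)^2 = - 4 y^2 w (w^2 - a^2). This factor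
    normalises the resulting cubic to leading coefficient 1.\<close>
  define s where "s = 1 / (4 * y ^ 2)"
  have s: "s > 0"
    using \<open>y \<noteq> 0\<close> by (simp add: s_def)
  have "k - w = \<i> * y * p"
    using q p0 by (simp add: field_simps)
  then have "(k - w) ^ 2 = - (of_real y ^ 2 * (4 * w * (w ^ 2 - of_real a ^ 2)))"
    by (simp add: power_mult_distrib p)
  then have sq: "(w - k) ^ 2 = - (of_real y ^ 2 * (4 * w * (w ^ 2 - of_real a ^ 2)))"
    by (simp only: power2_commute)
  have "of_real s * (w - k) ^ 2 = - (of_real (s * 4 * y ^ 2) * (w * (w ^ 2 - of_real a ^ 2)))"
    unfolding sq by simp
  also have "s * 4 * y ^ 2 = 1"
    using \<open>y \<noteq> 0\<close> by (simp add: s_def)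
  finally have root: "w * (w ^ 2 - of_real a ^ 2) + of_real s * (w - k) ^ 2 = 0"
    by simp
  define P where "P x = x * (x ^ 2 - a ^ 2) + s * (x - k) ^ 2" for x
  have contP: "continuous_on S P" for S
    unfolding P_def by (intro continuous_intros)
  have "P k < 0"
    using k by (simp add: P_def mult_pos_neg power_strict_mono)
  moreover have "P 0 > 0" "P a > 0"
    using k s by (auto simp: P_def)
  ultimately obtain x1 x2 where x1: "0 \<le> x1" "x1 \<le> k" "P x1 = 0" and x2: "k \<le> x2" "x2 \<le> a" "P x2 = 0"
    using IVT2'[of P k 0 0] IVT'[of P k 0 a] k contP by (metis less_imp_le)
  have "x1 \<noteq> x2"
    using x1 x2 \<open>P k < 0\<close> by force
  \<comment> \<open>The divided difference of the cubic at the roots \<open>w\<close> and x. A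
    second division, of Q x1 - Q x2 by x1 - x2, leaves the linear relation w = - (x1 + x2 + s) of
    Vieta, which makes \<open>w\<close> real.\<close>
  define Q where "Q x = (w ^ 2 + w * of_real x + of_real x ^ 2) - of_real a ^ 2 + of_real s * (w + of_real x - 2 * k)" for x :: real
  have Q0: "Q x = 0" if "P x = 0" for x
  proof -
    have P: "of_real (P x) = of_real x * (of_real x ^ 2 - of_real a ^ 2) + of_real s * (of_real x - of_real k) ^ 2"
      by (simp add: P_def)
    have "(w - of_real x) * Q x = (w * (w ^ 2 - of_real a ^ 2) + of_real s * (w - k) ^ 2) - of_real (P x)"
      unfolding P Q_def by (simp add: algebra_simps power2_eq_square)
    also have "\<dots> = 0"
      using root that by simp
    finally show ?thesis
      using ne[of x] by simp
  qed
  have "(of_real x1 - of_real x2) * (w + of_real (x1 + x2 + s)) = Q x1 - Q x2"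
    by (simp add: Q_def algebra_simps power2_eq_square)
  also have "\<dots> = 0"
    using Q0 x1(3) x2(3) by simp
  finally have "w + of_real (x1 + x2 + s) = 0"
    using \<open>x1 \<noteq> x2\<close> by simp
  then have "Im (w + of_real (x1 + x2 + s)) = 0"
    by (metis zero_complex.simps(2))
  then show False
    using w by simp
qed

text \<open>Here \<open>v\<close> is a tangent vector in the kernel of the differential,
  \<open>w\<close> and \<open>p\<close> are the values of \<open>wp\<close> and its derivative. The
  first two equations combine to w v = - k cnj v, so |w| = k and p is nonzero. If \<open>w\<close>
  is not real, the third equation makes v an imaginary multiple of 1 / p, and the second contradicts
  \<open>Re_quotient_nonzero\<close>. If w = k, then v is imaginary and p^2 < 0; if w = - k, then v
  is real and p^2 > 0. In both cases p^2 v^2 > 0, although the third equation makes p v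
  imaginary.\<close>

lemma immersion_algebraic:
  fixes a k :: real and w p v :: complex
  assumes k: "0 < k" "k < a" and p: "p ^ 2 = 4 * w * (w ^ 2 - of_real a ^ 2)"
    and 1: "Re ((- w - k) * v) = 0" and 2: "Re (\<i> * (w - k) * v) = 0" and 3: "Re (p * v) = 0"
  shows "v = 0"
proof (rule ccontr)
  assume v: "v \<noteq> 0"
  have wv: "w * v = - k * cnj v"
    using 1 2 by (simp add: complex_eq_iff algebra_simps)
  have "norm w * norm v = norm (w * v)"
    by (rule norm_mult[symmetric])
  also have "\<dots> = k * norm v"
    unfolding wv using k by (simp add: norm_mult)
  finally have "norm w * norm v = k * norm v" .
  then have norm_w: "norm w = k"
    using v by simp
  define y where "y = Im (p * v)"
  have pv: "p * v = \<i> * y"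
    using 3 by (simp add: y_def complex_eq_iff)
  have "p ^ 2 * v ^ 2 = (p * v) ^ 2"
    by (simp add: power_mult_distrib)
  also have "\<dots> = - of_real (y ^ 2)"
    unfolding pv by (simp add: power_mult_distrib)
  finally have pv2: "p ^ 2 * v ^ 2 = - of_real (y ^ 2)" .
  have p0: "p \<noteq> 0"
  proof
    assume "p = 0"
    then have "w = 0 \<or> w ^ 2 = of_real a ^ 2"
      using p by auto
    then have "norm w = 0 \<or> norm w = a"
      using k by (auto simp: power2_eq_iff)
    then show False
      using norm_w k by auto
  qed
  have "y \<noteq> 0"
    using pv p0 v by auto
  have veq: "v = \<i> * y / p"
    using pv p0 by (simp add: field_simps)
  have "Im w = 0"
  proof (rule ccontr)
    assume "Im w \<noteq> 0"
    then have "Re ((k - w) / p) \<noteq> 0"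
      using Re_quotient_nonzero[OF k p] by blast
    moreover have "Re (\<i> * (w - k) * v) = y * Re ((k - w) / p)"
    proof -
      have "\<i> * (w - k) * v = of_real y * ((k - w) / p)"
        by (simp add: veq field_simps)
      moreover have "Re (of_real y * z) = y * Re z" for z
        by simp
      ultimately show ?thesis
        by metis
    qed
    ultimately show False
      using 2 \<open>y \<noteq> 0\<close> by simp
  qed
  then have "w = of_real (Re w)" "\<bar>Re w\<bar> = k"
    using norm_w by (auto simp: complex_eq_iff cmod_def)
  then consider "w = of_real k" | "w = - of_real k"
    by (metis abs_eq_iff' abs_of_nonneg of_real_minus abs_if)
  then show False
  proof cases
    case 1
    then have "of_real k * (v + cnj v) = 0"
      using wv by (simp add: algebra_simps)
    then have "Re v = 0"
      using k by (simp add: complex_add_cnj)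
    then have v2: "v ^ 2 = - of_real (Im v ^ 2)" and "Im v \<noteq> 0"
      using v by (auto simp: complex_eq_iff power2_eq_square)
    have "p ^ 2 = of_real (4 * k * (k ^ 2 - a ^ 2))"
      using p 1 by simp
    then have "of_real (4 * k * (k ^ 2 - a ^ 2) * Im v ^ 2) = (of_real (y ^ 2) :: complex)"
      using pv2 v2 by simp
    then have "4 * k * (k ^ 2 - a ^ 2) * Im v ^ 2 = y ^ 2"
      by (simp only: of_real_eq_iff)
    moreover have "4 * k * (k ^ 2 - a ^ 2) * Im v ^ 2 < 0"
      using k \<open>Im v \<noteq> 0\<close> by (intro mult_neg_pos mult_pos_neg) (auto simp: power_strict_mono)
    ultimately show False
      using zero_le_power2[of y] by linarith
  next
    case 2
    then have "v = cnj v"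
      using wv k by simp
    then have "Im v = 0"
      by (simp add: complex_eq_iff)
    then have v2: "v ^ 2 = of_real (Re v ^ 2)" and "Re v \<noteq> 0"
      using v by (auto simp: complex_eq_iff power2_eq_square)
    have "p ^ 2 = of_real (4 * k * (a ^ 2 - k ^ 2))"
      using p 2 by (simp add: algebra_simps)
    then have "of_real (4 * k * (a ^ 2 - k ^ 2) * Re v ^ 2) = (of_real (- (y ^ 2)) :: complex)"
      using pv2 v2 by simp
    then have "4 * k * (a ^ 2 - k ^ 2) * Re v ^ 2 = - (y ^ 2)"
      by (simp only: of_real_eq_iff)
    moreover have "4 * k * (a ^ 2 - k ^ 2) * Re v ^ 2 > 0"
      using k \<open>Re v \<noteq> 0\<close> by (intro mult_pos_pos) (auto simp: power_strict_mono)
    ultimately show False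
      using zero_le_power2[of y] by linarith
  qed
qed

section \<open>Injectivity on the fundamental square\<close>

lemma half_Ints:
  assumes "x \<in> {0, 1/2, - 1/2 :: real}"
  shows "2 * x \<in> \<int>"
proof -
  have "2 * x = 0 \<or> 2 * x = 1 \<or> 2 * x = - 1"
    using assms by auto
  then show ?thesis
    by (metis Ints_0 Ints_1 Ints_minus)
qed

section \<open>The conformal map from the quarter to the lower half plane\<close>

definition quarter :: "complex set"
  where "quarter = {z. 0 < Re z \<and> Re z < 1/2 \<and> 0 < Im z \<and> Im z < 1/2}"

lemma quarter_eq_box: "quarter = box 0 (Complex (1/2) (1/2))"
  by (auto simp: quarter_def in_box_complex_iff)

lemma open_quarter: "open quarter"
  and connected_quarter: "connected quarter"
  by (auto simp: quarter_eq_box open_box convex_connected)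

lemma quarter_not_gauss_ints:
  assumes "z \<in> quarter"
  shows "z \<notin> gauss_ints" "2 * z \<notin> gauss_ints"
  using assms half_not_Ints[of "Re z"] half_not_Ints[of "2 * Re z"]
  by (auto simp: quarter_def gauss_ints_def)

lemma wp_inj_on_quarter: "inj_on wp quarter"
proof (rule inj_onI)
  fix z w assume zw: "z \<in> quarter" "w \<in> quarter" "wp z = wp w"
  have "z - w \<in> gauss_ints \<or> z + w \<in> gauss_ints"
    using wp_eqD[of w z] zw quarter_not_gauss_ints by blast
  moreover have "z + w \<notin> gauss_ints"
    using zw half_not_Ints[of "Re z + Re w"] by (auto simp: quarter_def gauss_ints_def)
  ultimately have "Re z - Re w \<in> \<int>" "Im z - Im w \<in> \<int>"
    by (auto simp: gauss_ints_def)
  moreover have "\<bar>Re z - Re w\<bar> < 1" "\<bar>Im z - Im w\<bar> < 1"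
    using zw by (auto simp: quarter_def abs_less_iff)
  ultimately show "z = w"
    using Ints_nonzero_abs_less1[of "Re z - Re w"] Ints_nonzero_abs_less1[of "Im z - Im w"]
    by (auto simp: complex_eq_iff)
qed

text \<open>A real value would be shared by z and its conjugate, and \<open>wp_eqD\<close> would put
  z on one of the boundary lines.\<close>

lemma Im_wp_nonzero_quarter:
  assumes "z \<in> quarter"
  shows "Im (wp z) \<noteq> 0"
proof
  assume "Im (wp z) = 0"
  then have "wp (cnj z) = wp z"
    by (simp add: wp_cnj complex_eq_iff)
  then have "cnj z - z \<in> gauss_ints \<or> cnj z + z \<in> gauss_ints"
    using wp_eqD[of z "cnj z"] assms quarter_not_gauss_ints by auto
  then have "2 * Im z \<in> \<int> \<or> 2 * Re z \<in> \<int>"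
    by (auto simp: gauss_ints_def dest: Ints_minus)
  then show False
    using assms half_not_Ints[of "2 * Im z"] half_not_Ints[of "2 * Re z"] by (auto simp: quarter_def)
qed

lemma connected_same_sign:
  fixes f :: "'a::topological_space \<Rightarrow> real"
  assumes "connected S" "continuous_on S f" "\<And>x. x \<in> S \<Longrightarrow> f x \<noteq> 0" "x0 \<in> S" "f x0 > 0" "x \<in> S"
  shows "f x > 0"
proof (rule ccontr)
  assume "\<not> f x > 0"
  then have "0 \<in> {f x..f x0}"
    using assms by auto
  moreover have "{f x..f x0} \<subseteq> f ` S"
    by (intro connected_contains_Icc connected_continuous_image) (use assms in auto)
  ultimately show False
    using assms(3) by auto
qed

definition wq :: "complex \<Rightarrow> complex"
  where "wq z = (of_real wkappa - wp z) / deriv wp z"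

lemma Re_wq_nonzero:
  assumes "z \<in> quarter"
  shows "Re (wq z) \<noteq> 0"
  unfolding wq_def
  by (rule Re_quotient_nonzero[OF wkappa_bounds wp_ode Im_wp_nonzero_quarter])
     (use assms quarter_not_gauss_ints in auto)

text \<open>Asymptotically at \<open>0\<close>, \<open>wp z\<close> is \<open>1 / z\<^sup>2\<close> and \<open>wq z\<close> is \<open>z / 2\<close>, so the diagonal contains such a point.\<close>

lemma quarter_signs_exist: "\<exists>z\<in>quarter. Im (wp z) < 0 \<and> Re (wq z) > 0"
proof -
  have "((\<lambda>z. (of_real wkappa * z ^ 2 - z ^ 2 * wp z) / (z ^ 3 * deriv wp z)) \<longlongrightarrow>
      (of_real wkappa * 0 ^ 2 - 1) / (- 2)) (at 0)"
    by (intro tendsto_intros tendsto_wp_0 tendsto_deriv_wp_0) auto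
  then have "eventually (\<lambda>z. dist ((of_real wkappa * z ^ 2 - z ^ 2 * wp z) / (z ^ 3 * deriv wp z))
      ((of_real wkappa * 0 ^ 2 - 1) / (- 2)) < 1/4) (at 0)"
    by (rule tendstoD) simp
  moreover have "eventually (\<lambda>z. dist (z ^ 2 * wp z) 1 < 1/2) (at 0)"
    using tendsto_wp_0 by (rule tendstoD) simp
  ultimately have "eventually (\<lambda>z. dist ((of_real wkappa * z ^ 2 - z ^ 2 * wp z) / (z ^ 3 * deriv wp z))
      ((of_real wkappa * 0 ^ 2 - 1) / (- 2)) < 1/4 \<and> dist (z ^ 2 * wp z) 1 < 1/2) (at 0)"
    by eventually_elim simp
  then obtain d where d: "d > 0" "\<And>z. z \<noteq> 0 \<Longrightarrow> dist z 0 < d \<Longrightarrow>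
      dist ((of_real wkappa * z ^ 2 - z ^ 2 * wp z) / (z ^ 3 * deriv wp z)) ((of_real wkappa * 0 ^ 2 - 1) / (- 2)) < 1/4 \<and>
      dist (z ^ 2 * wp z) 1 < 1/2"
    unfolding eventually_at by blast
  define t where "t = min (d / 4) (1 / 4)"
  have t: "t > 0" "t < 1/2" "2 * t < d"
    using d(1) by (auto simp: t_def)
  define z where "z = Complex t t"
  have zQ: "z \<in> quarter"
    using t by (simp add: z_def quarter_def)
  have z0: "z \<noteq> 0"
    using t by (simp add: z_def complex_eq_iff)
  have "norm z \<le> \<bar>Re z\<bar> + \<bar>Im z\<bar>"
    by (rule cmod_le)
  then have "dist z 0 < d"
    using t by (simp add: z_def)
  note dz = d(2)[OF z0 this]
  \<comment> \<open>On the diagonal z^2 is 2 i t^2, so the real part of z^2 wp z, which is close to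
    1, equals - 2 t^2 Im (wp z).\<close>
  have "z ^ 2 = Complex 0 (2 * t ^ 2)"
    by (simp add: z_def complex_eq_iff power2_eq_square)
  then have "Re (z ^ 2 * wp z) = - (2 * t ^ 2) * Im (wp z)"
    by simp
  moreover have "\<bar>Re (z ^ 2 * wp z) - 1\<bar> < 1/2"
    using dz abs_Re_le_cmod[of "z ^ 2 * wp z - 1"] by (simp add: dist_norm)
  ultimately have "(2 * t ^ 2) * Im (wp z) < 0"
    by linarith
  then have 1: "Im (wp z) < 0"
    using t by (simp add: mult_less_0_iff)
  define e where "e = (of_real wkappa * z ^ 2 - z ^ 2 * wp z) / (z ^ 3 * deriv wp z) - 1/2"
  have e: "norm e < 1/4"
    using dz by (simp add: e_def dist_norm)
  have "wq z = z * ((of_real wkappa * z ^ 2 - z ^ 2 * wp z) / (z ^ 3 * deriv wp z))"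
    using z0 by (cases "deriv wp z = 0") (simp_all add: wq_def field_simps power2_eq_square power3_eq_cube)
  also have "\<dots> = z * (1/2 + e)"
    by (simp add: e_def)
  finally have "Re (wq z) = t * (1/2 + Re e - Im e)"
    by (simp add: z_def algebra_simps)
  moreover have "1/2 + Re e - Im e > 0"
    using e abs_Re_le_cmod[of e] abs_Im_le_cmod[of e] by linarith
  ultimately have "Re (wq z) > 0"
    using t by simp
  with 1 zQ show ?thesis
    by blast
qed

lemma wp_continuous_quarter: "continuous_on quarter wp"
  and wq_continuous_quarter: "continuous_on quarter wq"
proof -
  have sub: "quarter \<subseteq> - gauss_ints"
    using quarter_not_gauss_ints by auto
  then show 1: "continuous_on quarter wp"
    using wp_holomorphic holomorphic_on_subset holomorphic_on_imp_continuous_on by blast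
  have 2: "continuous_on quarter (deriv wp)"
    using sub deriv_wp_holomorphic holomorphic_on_subset holomorphic_on_imp_continuous_on by blast
  have "deriv wp z \<noteq> 0" if "z \<in> quarter" for z
    using deriv_wp_nonzero quarter_not_gauss_ints that by blast
  then show "continuous_on quarter wq"
    unfolding wq_def[abs_def]
    by (intro continuous_on_divide continuous_on_diff continuous_on_const 1 2) blast
qed

lemma Im_wp_quarter: "z \<in> quarter \<Longrightarrow> Im (wp z) < 0"
proof -
  assume z: "z \<in> quarter"
  obtain z0 where "z0 \<in> quarter" "Im (wp z0) < 0"
    using quarter_signs_exist by blast
  then have "- Im (wp z) > 0"
    using z wp_continuous_quarter Im_wp_nonzero_quarter
    by (intro connected_same_sign[OF connected_quarter, of "\<lambda>z. - Im (wp z)" z0 z] continuous_intros) auto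
  then show ?thesis
    by simp
qed

lemma Re_wq_quarter: "z \<in> quarter \<Longrightarrow> Re (wq z) > 0"
proof -
  assume z: "z \<in> quarter"
  obtain z0 where "z0 \<in> quarter" "Re (wq z0) > 0"
    using quarter_signs_exist by blast
  then show ?thesis
    using z wq_continuous_quarter Re_wq_nonzero
    by (intro connected_same_sign[OF connected_quarter, of "\<lambda>z. Re (wq z)" z0 z] continuous_intros) auto
qed

definition closed_quarter :: "complex set"
  where "closed_quarter = {z. 0 \<le> Re z \<and> Re z \<le> 1/2 \<and> 0 \<le> Im z \<and> Im z \<le> 1/2}"

lemma closed_quarter_not_gauss_ints: "z \<in> closed_quarter \<Longrightarrow> z \<noteq> 0 \<Longrightarrow> z \<notin> gauss_ints"
  using half_not_Ints[of "Re z"] half_not_Ints[of "Im z"]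
  by (force simp: closed_quarter_def gauss_ints_def complex_eq_iff)

lemma compact_closed_quarter: "compact closed_quarter"
proof -
  have "closed_quarter = cbox 0 (Complex (1/2) (1/2))"
    by (auto simp: closed_quarter_def in_cbox_complex_iff)
  then show ?thesis
    using compact_cbox by metis
qed

text \<open>Properness of \<open>wp\<close> on the quarter: a subsequence converges in the closed
  quarter by compactness, and not to 0, since the values would tend to infinity at the pole.\<close>

lemma wp_limit_quarter:
  assumes "\<And>n. z n \<in> quarter" "(\<lambda>n. wp (z n)) \<longlonglongrightarrow> w"
  obtains u r where "u \<in> closed_quarter" "u \<noteq> 0" "strict_mono (r :: nat \<Rightarrow> nat)" "(\<lambda>n. z (r n)) \<longlonglongrightarrow> u"
    "wp u = w"
proof -
  have "z n \<in> closed_quarter" for n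
    using assms(1)[of n] by (simp add: quarter_def closed_quarter_def)
  then obtain u r where ur: "u \<in> closed_quarter" "strict_mono r" "(z \<circ> r) \<longlonglongrightarrow> u"
    using compact_closed_quarter unfolding compact_eq_seq_compact_metric seq_compact_def by metis
  then have lim: "(\<lambda>n. z (r n)) \<longlonglongrightarrow> u"
    by (simp add: o_def)
  have lim_wp: "(\<lambda>n. wp (z (r n))) \<longlonglongrightarrow> w"
    using LIMSEQ_subseq_LIMSEQ[OF assms(2) ur(2)] by (simp add: o_def)
  have "u \<noteq> 0"
  proof
    assume "u = 0"
    have "z (r n) \<noteq> 0" for n
      using assms(1)[of "r n"] by (auto simp: quarter_def)
    then have "filterlim (\<lambda>n. z (r n)) (at 0) sequentially"
      using lim \<open>u = 0\<close> by (simp add: filterlim_at)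
    then have "filterlim (\<lambda>n. wp (z (r n))) at_infinity sequentially"
      using is_pole_wp_0 unfolding is_pole_def by (rule filterlim_compose[rotated])
    then show False
      using lim_wp not_tendsto_and_filterlim_at_infinity[OF trivial_limit_sequentially] by blast
  qed
  moreover from this ur have "isCont wp u"
    using closed_quarter_not_gauss_ints wp_analytic analytic_at_imp_isCont by blast
  then have "(\<lambda>n. wp (z (r n))) \<longlonglongrightarrow> wp u"
    using lim by (rule isCont_tendsto_compose)
  then have "wp u = w"
    using lim_wp LIMSEQ_unique by blast
  ultimately show ?thesis
    using that ur lim by blast
qed

lemma closed_quarter_Im_wp: "z \<in> closed_quarter \<Longrightarrow> z \<noteq> 0 \<Longrightarrow> z \<notin> quarter \<Longrightarrow> Im (wp z) = 0"
proof (rule wp_real_axes)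
  assume z: "z \<in> closed_quarter" "z \<noteq> 0" "z \<notin> quarter"
  then show "z \<notin> gauss_ints"
    using closed_quarter_not_gauss_ints by blast
  have "Re z \<in> {0, 1/2, - 1/2} \<or> Im z \<in> {0, 1/2, - 1/2}"
    using z by (auto simp: closed_quarter_def quarter_def)
  then show "2 * Re z \<in> \<int> \<or> 2 * Im z \<in> \<int>"
    using half_Ints by blast
qed

text \<open>The image is open by the open mapping theorem. It is relatively closed in the half plane
  by properness: a limit point of preimages on the boundary of the quarter would have a real value.
  A nonempty open and closed subset of the connected half plane is everything.\<close>

lemma wp_image_quarter: "wp ` quarter = {w. Im w < 0}"
proof -
  let ?L = "{w. Im w < 0}"
  have conn: "connected ?L"
    by (simp add: convex_halfspace_Im_lt convex_connected)
  have "openin (top_of_set ?L) (wp ` quarter)"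
  proof (rule open_subset)
    show "wp ` quarter \<subseteq> ?L"
      using Im_wp_quarter by auto
    show "open (wp ` quarter)"
      by (rule open_mapping_thm3[OF holomorphic_on_subset[OF wp_holomorphic] open_quarter wp_inj_on_quarter])
         (use quarter_not_gauss_ints in auto)
  qed
  moreover have "closedin (top_of_set ?L) (wp ` quarter)"
  proof -
    have "w \<in> wp ` quarter" if w: "w \<in> closure (wp ` quarter)" "w \<in> ?L" for w
    proof -
      obtain f where f: "\<And>n. f n \<in> wp ` quarter" "f \<longlonglongrightarrow> w"
        using w(1) by (auto simp: closure_sequential)
      define z where "z n = inv_into quarter wp (f n)" for n
      have z: "z n \<in> quarter" "wp (z n) = f n" for n
        unfolding z_def using inv_into_into[OF f(1)] f_inv_into_f[OF f(1)] by blast+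
      have "(\<lambda>n. wp (z n)) \<longlonglongrightarrow> w"
        using f(2) by (simp add: z(2))
      then obtain u r where ur: "u \<in> closed_quarter" "u \<noteq> 0" "strict_mono (r :: nat \<Rightarrow> nat)"
        "(\<lambda>n. z (r n)) \<longlonglongrightarrow> u" "wp u = w"
        by (rule wp_limit_quarter[OF z(1)])
      then have "u \<in> quarter"
        using closed_quarter_Im_wp[of u] w(2) by fastforce
      then show ?thesis
        using ur(5) by blast
    qed
    then have "wp ` quarter = ?L \<inter> closure (wp ` quarter)"
      using Im_wp_quarter closure_subset[of "wp ` quarter"] by auto
    then show ?thesis
      by (metis closedin_closed_Int closed_closure)
  qed
  moreover have "wp ` quarter \<noteq> {}"
    using quarter_signs_exist by auto
  ultimately show ?thesis
    using conn unfolding connected_clopen by blast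
qed

text \<open>\<open>Im wG\<close> is the imaginary part of \<open>wzeta z + wkappa z\<close>, whose derivative with respect to the new coordinate
  \<open>wp z\<close> is \<open>wq z\<close>.\<close>

lemma wG_monotone_quarter:
  assumes z: "z1 \<in> quarter" "z2 \<in> quarter" "Re (wp z1) = Re (wp z2)" "Im (wp z1) < Im (wp z2)"
  shows "Im (wG z1) < Im (wG z2)"
proof -
  have sub: "quarter \<subseteq> - gauss_ints"
    using quarter_not_gauss_ints by auto
  obtain g where g: "g holomorphic_on (wp ` quarter)"
    "\<And>z. z \<in> quarter \<Longrightarrow> deriv wp z * deriv g (wp z) = 1"
    "\<And>z. z \<in> quarter \<Longrightarrow> g (wp z) = z"
    using holomorphic_has_inverse[OF holomorphic_on_subset[OF wp_holomorphic sub] open_quarter wp_inj_on_quarter]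
    by metis
  define x where "x = Re (wp z1)"
  define F where "F w = wzeta (g w) + of_real wkappa * g w" for w
  have F: "(F has_field_derivative wq (g w)) (at w)" "g w \<in> quarter" if w: "Im w < 0" for w
  proof -
    obtain z where z: "z \<in> quarter" "w = wp z"
      using w wp_image_quarter by blast
    then have gw: "g w = z"
      using g(3) by simp
    have "open (wp ` quarter)"
      unfolding wp_image_quarter by (rule open_halfspace_Im_lt)
    then have "(g has_field_derivative deriv g w) (at w)"
      using g(1) z by (intro holomorphic_derivI[of g "wp ` quarter"]) auto
    moreover have "(wzeta has_field_derivative - wp z) (at (g w))"
      using wzeta_has_field_derivative[of z] z quarter_not_gauss_ints gw by simp
    ultimately have "(F has_field_derivative (- wp z * deriv g w + of_real wkappa * deriv g w)) (at w)"
      unfolding F_def[abs_def] by (intro DERIV_add DERIV_cmult DERIV_chain2[of wzeta])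
    moreover have "- wp z * deriv g w + of_real wkappa * deriv g w = wq (g w)"
    proof -
      have "deriv g w = 1 / deriv wp z"
        using g(2)[OF z(1)] deriv_wp_nonzero[of z] quarter_not_gauss_ints z by (simp add: field_simps)
      then show ?thesis
        by (simp add: wq_def gw diff_divide_distrib)
    qed
    ultimately show "(F has_field_derivative wq (g w)) (at w)"
      by simp
    show "g w \<in> quarter"
      using gw z by simp
  qed
  \<comment> \<open>wkappa * z and - wkappa * cnj z have equal imaginary parts, so the holomorphic
    \<open>F\<close> represents Im wG in the coordinate wp z.\<close>
  have Im_F: "Im (F (wp z)) = Im (wG z)" if "z \<in> quarter" for z
    using that g(3) by (simp add: F_def wG_def)
  have neg: "Im (wp z2) < 0"
    using z Im_wp_quarter by blast
  have "Im (F (Complex x (Im (wp z1)))) < Im (F (Complex x (Im (wp z2))))"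
  proof (rule DERIV_pos_imp_increasing[OF z(4)])
    fix y assume y: "Im (wp z1) \<le> y" "y \<le> Im (wp z2)"
    have "((\<lambda>y. Im (F (Complex x y))) has_real_derivative Re (wq (g (Complex x y)))) (at y)"
      by (rule has_real_derivative_vertical[OF F(1)]) (use y neg in auto)
    moreover have "Re (wq (g (Complex x y))) > 0"
      by (rule Re_wq_quarter[OF F(2)]) (use y neg in auto)
    ultimately show "\<exists>D. ((\<lambda>y. Im (F (Complex x y))) has_real_derivative D) (at y) \<and> D > 0"
      by blast
  qed
  moreover have "Complex x (Im (wp z1)) = wp z1" "Complex x (Im (wp z2)) = wp z2"
    using z(3) by (auto simp: x_def complex_eq_iff)
  ultimately show ?thesis
    using Im_F z by simp
qed

section \<open>Boundary values and signs of wG\<close>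

lemma wG_edge_derivative:
  assumes "Complex x y \<notin> gauss_ints"
  shows "((\<lambda>y. Im (wG (Complex x y))) has_real_derivative (wkappa - Re (wp (Complex x y)))) (at y)"
proof -
  have "((\<lambda>z. wzeta z + of_real wkappa * z) has_field_derivative (- wp (Complex x y) + of_real wkappa * 1)) (at (Complex x y))"
    by (intro DERIV_add wzeta_has_field_derivative DERIV_cmult DERIV_ident assms)
  from has_real_derivative_vertical(2)[OF this] show ?thesis
    by (simp add: wG_def)
qed

text \<open>Along the edge, Im wG vanishes at both ends and has the strictly increasing derivative
  wkappa - wp. It is thus strictly convex, hence negative inside; the two mean values in the proof
  express this.\<close>

lemma wG_right_edge:
  assumes y: "0 < y" "y < 1/2"
  shows "Im (wG (Complex (1/2) y)) < 0"
proof (rule ccontr)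
  define \<phi> where "\<phi> y = Im (wG (Complex (1/2) y))" for y
  have \<phi>: "(\<phi> has_real_derivative (wkappa - Re (wp (Complex (1/2) y)))) (at y)" for y
    unfolding \<phi>_def by (rule wG_edge_derivative) simp
  have 0: "\<phi> 0 = 0" "\<phi> (1/2) = 0"
    unfolding \<phi>_def by (subst wG_half_period; simp add: gauss_ints_def)+
  assume "\<not> Im (wG (Complex (1/2) y)) < 0"
  then have ge: "\<phi> y \<ge> 0"
    by (simp add: \<phi>_def)
  obtain x1 where x1: "0 < x1" "x1 < y" "\<phi> y - \<phi> 0 = (y - 0) * (wkappa - Re (wp (Complex (1/2) x1)))"
    using MVT2[OF y(1), of \<phi> "\<lambda>x. wkappa - Re (wp (Complex (1/2) x))"] \<phi> by blast
  obtain x2 where x2: "y < x2" "x2 < 1/2" "\<phi> (1/2) - \<phi> y = (1/2 - y) * (wkappa - Re (wp (Complex (1/2) x2)))"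
    using MVT2[OF y(2), of \<phi> "\<lambda>x. wkappa - Re (wp (Complex (1/2) x))"] \<phi> by blast
  have "wkappa - Re (wp (Complex (1/2) x1)) \<ge> 0"
    using x1 ge 0 y by (simp add: zero_le_mult_iff)
  moreover have "wkappa - Re (wp (Complex (1/2) x2)) \<le> 0"
    using x2(3) ge 0 y by (metis diff_0 diff_gt_0_iff_gt mult_pos_pos neg_le_0_iff_le not_le)
  moreover have "Re (wp (Complex (1/2) x1)) > Re (wp (Complex (1/2) x2))"
    using x1 x2 by (intro wp_right_edge_mono) auto
  ultimately show False
    by linarith
qed

text \<open>The quarter turn of the bottom edge gives wp \<le> - we < 0 < wkappa here, so Im wG
  increases. The lower end is the pole; the comparison is with the value 0 at the upper end, a
  half-period.\<close>

lemma wG_left_edge: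
  assumes y: "0 < y" "y < 1/2"
  shows "Im (wG (Complex 0 y)) < 0"
proof -
  have "Im (wG (Complex 0 y)) < Im (wG (Complex 0 (1/2)))"
  proof (rule DERIV_pos_imp_increasing[OF y(2)])
    fix t assume t: "y \<le> t" "t \<le> 1/2"
    have "Re (wp (Complex t 0)) \<ge> we"
    proof (cases "t < 1/2")
      case True
      then show ?thesis
        using wp_bottom_edge[of t] t y by simp
    next
      case False
      then have "t = 1/2"
        using t by simp
      show ?thesis
        unfolding \<open>t = 1/2\<close> wp_right_edge_ends by simp
    qed
    moreover have "Complex 0 t = \<i> * Complex t 0"
      by (simp add: complex_eq_iff)
    then have "wp (Complex 0 t) = - wp (Complex t 0)"
      by (simp only: wp_mult_i)
    ultimately have "wkappa - Re (wp (Complex 0 t)) > 0"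
      using wkappa_bounds by simp
    moreover have "((\<lambda>y. Im (wG (Complex 0 y))) has_real_derivative (wkappa - Re (wp (Complex 0 t)))) (at t)"
      by (rule wG_edge_derivative) (use t y in simp)
    ultimately show "\<exists>D. ((\<lambda>y. Im (wG (Complex 0 y))) has_real_derivative D) (at t) \<and> D > 0"
      by blast
  qed
  also have "wG (Complex 0 (1/2)) = 0"
    by (rule wG_half_period) (simp_all add: gauss_ints_def)
  finally show ?thesis
    by simp
qed

lemma wG_real_axes:
  assumes "2 * Im z \<in> \<int>" "z \<notin> gauss_ints"
  shows "Im (wG z) = 0"
proof -
  have "cnj z = z + Complex 0 (- 2 * Im z)"
    by (simp add: complex_eq_iff)
  moreover have "Complex 0 (- 2 * Im z) \<in> gauss_ints"
    using assms(1) by (auto simp: gauss_ints_def dest: Ints_minus)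
  ultimately have "wG (cnj z) = wG z"
    using wG_periodic[of z "Complex 0 (- 2 * Im z)"] assms(2) by simp
  then show ?thesis
    by (simp add: wG_cnj complex_eq_iff)
qed

lemma wG_boundary_nonpos:
  assumes "z \<in> closed_quarter" "z \<noteq> 0" "z \<notin> quarter"
  shows "Im (wG z) \<le> 0"
proof -
  have z: "z \<notin> gauss_ints"
    using assms closed_quarter_not_gauss_ints by blast
  obtain x y where xy: "z = Complex x y"
    by (cases z)
  consider "y = 0 \<or> y = 1/2" | "0 < y" "y < 1/2" "x = 0 \<or> x = 1/2"
    using assms by (force simp: closed_quarter_def quarter_def xy)
  then show ?thesis
  proof cases
    case 1
    then have "2 * Im z \<in> \<int>"
      unfolding xy by (intro half_Ints) auto
    then show ?thesis
      using wG_real_axes z by simp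
  next
    case 2
    then show ?thesis
      using wG_left_edge[of y] wG_right_edge[of y] unfolding xy by (elim disjE) (simp_all only: less_imp_le)
  qed
qed

text \<open>Move \<open>wp z\<close> vertically to the real line, which increases \<open>Im wG\<close>, and use the boundary values.\<close>

lemma wG_quarter_Im:
  assumes z: "z \<in> quarter"
  shows "Im (wG z) < 0"
proof -
  define v where "v = Im (wp z)"
  \<comment> \<open>The denominator starts at 2, so that already \<open>w 0\<close> lies strictly
    above \<open>wp z\<close>. The limit preserves only weak inequalities, and the strict sign comes
    from this first move.\<close>
  define w where "w n = Complex (Re (wp z)) (v / real (n + 2))" for n
  have v: "v < 0"
    unfolding v_def using z by (rule Im_wp_quarter)
  have w_image: "w n \<in> wp ` quarter" for n
    unfolding wp_image_quarter w_def using v by (simp add: divide_neg_pos)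
  define f where "f n = inv_into quarter wp (w n)" for n
  have f: "f n \<in> quarter" "wp (f n) = w n" for n
    unfolding f_def using inv_into_into[OF w_image] f_inv_into_f[OF w_image] by blast+
  have "(\<lambda>n. v / real (n + 2)) \<longlonglongrightarrow> 0"
    using LIMSEQ_ignore_initial_segment[OF lim_const_over_n, of v 2] by simp
  then have "w \<longlonglongrightarrow> Complex (Re (wp z)) 0"
    unfolding w_def by (intro tendsto_Complex tendsto_const)
  then obtain u r where ur: "u \<in> closed_quarter" "u \<noteq> 0" "strict_mono (r :: nat \<Rightarrow> nat)"
      "(\<lambda>n. f (r n)) \<longlonglongrightarrow> u" "wp u = Complex (Re (wp z)) 0"
    using wp_limit_quarter[of f "Complex (Re (wp z)) 0"] f by auto
  have "u \<notin> quarter"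
    using Im_wp_quarter[of u] ur(5) by auto
  then have "Im (wG u) \<le> 0"
    using wG_boundary_nonpos ur by blast
  moreover have "Im (wG z) < Im (wG (f 0))"
    using wG_monotone_quarter[OF z f(1)[of 0]] f(2)[of 0] v by (simp add: w_def flip: v_def)
  moreover have "Im (wG (f 0)) \<le> Im (wG u)"
  proof (rule tendsto_lowerbound)
    have "isCont wG u"
      unfolding wG_def[abs_def] using closed_quarter_not_gauss_ints[OF ur(1,2)]
      by (intro continuous_intros analytic_at_imp_isCont wzeta_analytic)
    then have "isCont (\<lambda>z. Im (wG z)) u"
      by (rule isCont_Im)
    then show "(\<lambda>n. Im (wG (f (r n)))) \<longlonglongrightarrow> Im (wG u)"
      using ur(4) by (rule isCont_tendsto_compose)
    have "Im (wG (f 0)) \<le> Im (wG (f n))" for n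
    proof (cases "n = 0")
      case False
      have "v / 2 < v / real (n + 2)"
        using v False by (intro divide_strict_left_mono_neg) auto
      then show ?thesis
        using wG_monotone_quarter[OF f(1)[of 0] f(1)[of n]] f(2) by (simp add: w_def)
    qed auto
    then show "eventually (\<lambda>n. Im (wG (f 0)) \<le> Im (wG (f (r n)))) sequentially"
      by simp
  qed simp
  ultimately show ?thesis
    by linarith
qed

text \<open>Reflection in the diagonal is conjugation followed by the rotation by i. Every statement
  about Im wG thereby yields one about Re wG.\<close>

lemma wG_reflect: "Re (wG z) = - Im (wG (Complex (Im z) (Re z)))"
proof -
  have "Complex (Im z) (Re z) = \<i> * cnj z"
    by (simp add: complex_eq_iff)
  then have "wG (Complex (Im z) (Re z)) = - \<i> * cnj (wG z)"
    by (simp only: wG_mult_i wG_cnj)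
  then show ?thesis
    by simp
qed

lemma wG_Re_pos:
  assumes x: "0 < x" "x < 1/2" and y: "\<bar>y\<bar> \<le> 1/2"
  shows "Re (wG (Complex x y)) > 0"
proof -
  have *: "Re (wG (Complex x y)) > 0" if yy: "0 \<le> y" "y \<le> 1/2" for y
  proof -
    consider "0 < y" "y < 1/2" | "y = 0" | "y = 1/2"
      using yy by force
    then have "Im (wG (Complex y x)) < 0"
    proof cases
      case 1
      then show ?thesis
        using x by (intro wG_quarter_Im) (simp add: quarter_def)
    qed (use wG_left_edge[OF x] wG_right_edge[OF x] in \<open>simp_all only:\<close>)
    then show ?thesis
      by (simp add: wG_reflect)
  qed
  show ?thesis
  proof (cases "y \<ge> 0")
    case True
    then show ?thesis
      using * y by simp
  next
    case False
    have "Complex x y = cnj (Complex x (- y))"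
      by (simp add: complex_eq_iff)
    then have "wG (Complex x y) = cnj (wG (Complex x (- y)))"
      by (simp only: wG_cnj)
    then show ?thesis
      using *[of "- y"] False y by simp
  qed
qed

definition unit_square :: "complex set"
  where "unit_square = {z. \<bar>Re z\<bar> \<le> 1/2 \<and> \<bar>Im z\<bar> \<le> 1/2}"

lemma unit_square_not_gauss_ints: "z \<in> unit_square \<Longrightarrow> z \<noteq> 0 \<Longrightarrow> z \<notin> gauss_ints"
  using Ints_nonzero_abs_less1[of "Re z"] Ints_nonzero_abs_less1[of "Im z"]
  by (auto simp: unit_square_def gauss_ints_def complex_eq_iff)

text \<open>The three conditions on Re z exhaust the square and the three signs exclude each other,
  so one direction of each equivalence suffices: \<open>wG_Re_pos\<close>, its image under z -> - z,
  and the vanishing on the lines.\<close>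

lemma wG_Re_sign:
  assumes z: "z \<in> unit_square" "z \<noteq> 0"
  shows "Re (wG z) > 0 \<longleftrightarrow> 0 < Re z \<and> Re z < 1/2"
    and "Re (wG z) < 0 \<longleftrightarrow> - 1/2 < Re z \<and> Re z < 0"
    and "Re (wG z) = 0 \<longleftrightarrow> Re z \<in> {0, 1/2, - 1/2}"
proof -
  have pos: "Re (wG z) > 0" if "0 < Re z" "Re z < 1/2"
    using wG_Re_pos[OF that, of "Im z"] z by (simp add: unit_square_def)
  have neg: "Re (wG z) < 0" if "- 1/2 < Re z" "Re z < 0"
  proof -
    have "Re (wG (Complex (- Re z) (- Im z))) > 0"
      using that z by (intro wG_Re_pos) (auto simp: unit_square_def)
    moreover have "Complex (- Re z) (- Im z) = - z"
      by (simp add: complex_eq_iff)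
    ultimately show ?thesis
      by simp
  qed
  have zero: "Re (wG z) = 0" if "Re z \<in> {0, 1/2, - 1/2}"
  proof -
    have "2 * Re z \<in> \<int>"
      using that by (rule half_Ints)
    then have "Im (wG (\<i> * z)) = 0"
      using unit_square_not_gauss_ints[OF z] by (intro wG_real_axes) auto
    then show ?thesis
      by (simp add: wG_mult_i)
  qed
  consider "0 < Re z" "Re z < 1/2" | "- 1/2 < Re z" "Re z < 0" | "Re z \<in> {0, 1/2, - 1/2}"
    using z(1) by (force simp: unit_square_def)
  then have "(Re (wG z) > 0 \<longleftrightarrow> 0 < Re z \<and> Re z < 1/2) \<and>
      (Re (wG z) < 0 \<longleftrightarrow> - 1/2 < Re z \<and> Re z < 0) \<and>
      (Re (wG z) = 0 \<longleftrightarrow> Re z \<in> {0, 1/2, - 1/2})"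
  proof cases
    case 1
    then show ?thesis using pos by simp
  next
    case 2
    then show ?thesis using neg by simp
  next
    case 3
    then show ?thesis using zero by auto
  qed
  then show "Re (wG z) > 0 \<longleftrightarrow> 0 < Re z \<and> Re z < 1/2"
    "Re (wG z) < 0 \<longleftrightarrow> - 1/2 < Re z \<and> Re z < 0"
    "Re (wG z) = 0 \<longleftrightarrow> Re z \<in> {0, 1/2, - 1/2}"
    by blast+
qed

lemma wG_Im_sign:
  assumes z: "z \<in> unit_square" "z \<noteq> 0"
  shows "Im (wG z) < 0 \<longleftrightarrow> 0 < Im z \<and> Im z < 1/2"
    and "Im (wG z) > 0 \<longleftrightarrow> - 1/2 < Im z \<and> Im z < 0"
    and "Im (wG z) = 0 \<longleftrightarrow> Im z \<in> {0, 1/2, - 1/2}"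
proof -
  define u where "u = Complex (Im z) (Re z)"
  have "u \<in> unit_square" "u \<noteq> 0"
    using z by (auto simp: u_def unit_square_def complex_eq_iff)
  note * = wG_Re_sign[OF this]
  have "Re (wG u) = - Im (wG z)" "Re u = Im z"
    by (simp_all add: u_def wG_reflect)
  with * show "Im (wG z) < 0 \<longleftrightarrow> 0 < Im z \<and> Im z < 1/2"
    "Im (wG z) > 0 \<longleftrightarrow> - 1/2 < Im z \<and> Im z < 0"
    "Im (wG z) = 0 \<longleftrightarrow> Im z \<in> {0, 1/2, - 1/2}"
    by simp_all
qed

section \<open>From the quarter to the whole torus\<close>

lemma quarter_injective:
  assumes "z \<in> quarter" "w \<in> quarter" "wG z = wG w" "Re (wp z) = Re (wp w)"
  shows "z = w"
proof -
  have "Im (wp z) = Im (wp w)"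
    using wG_monotone_quarter[of z w] wG_monotone_quarter[of w z] assms by force
  then have "wp z = wp w"
    using assms(4) by (simp add: complex_eq_iff)
  then show ?thesis
    using wp_inj_on_quarter assms(1,2) by (auto dest: inj_onD)
qed

lemma quarter_iff:
  assumes "z \<in> unit_square" "z \<noteq> 0"
  shows "z \<in> quarter \<longleftrightarrow> Re (wG z) > 0 \<and> Im (wG z) < 0"
  using wG_Re_sign(1)[OF assms] wG_Im_sign(1)[OF assms] by (auto simp: quarter_def)

text \<open>Off the axes, the quadrant of the common value of \<open>wG\<close> tells which of the
  symmetries z, - z, cnj z, - cnj z moves both points into \<open>quarter\<close>. On the axes
  \<open>wp\<close> is real, so the full values of \<open>wp\<close> agree, and only pairs with z +
  w in the lattice and half-periods need further care.\<close>

lemma unit_square_injective: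
  assumes z: "z \<in> unit_square" "z \<noteq> 0" and w: "w \<in> unit_square" "w \<noteq> 0"
    and eq: "wG z = wG w" "Re (wp z) = Re (wp w)"
  shows "z - w \<in> gauss_ints"
proof (cases "Re (wG z) = 0 \<or> Im (wG z) = 0")
  case False
  have "- z \<in> unit_square" "- w \<in> unit_square" "cnj z \<in> unit_square" "cnj w \<in> unit_square"
    "- cnj z \<in> unit_square" "- cnj w \<in> unit_square"
    using z w by (auto simp: unit_square_def)
  note iffs = quarter_iff[OF z] quarter_iff[OF w] quarter_iff[OF this(1)] quarter_iff[OF this(2)]
    quarter_iff[OF this(3)] quarter_iff[OF this(4)] quarter_iff[OF this(5)] quarter_iff[OF this(6)]
  consider "Re (wG z) > 0" "Im (wG z) < 0" | "Re (wG z) < 0" "Im (wG z) > 0"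
    | "Re (wG z) > 0" "Im (wG z) > 0" | "Re (wG z) < 0" "Im (wG z) < 0"
    using False by linarith
  then have "z = w"
  proof cases
    case 1
    then have "z \<in> quarter" "w \<in> quarter"
      using iffs(1,2) eq by simp_all
    then show ?thesis
      using quarter_injective eq by blast
  next
    case 2
    then have "- z \<in> quarter" "- w \<in> quarter"
      using iffs(3,4) eq z w by simp_all
    then have "- z = - w"
      by (rule quarter_injective) (use eq in simp_all)
    then show ?thesis
      by simp
  next
    case 3
    then have "cnj z \<in> quarter" "cnj w \<in> quarter"
      using iffs(5,6) eq z w by (simp_all add: wG_cnj)
    then have "cnj z = cnj w"
      by (rule quarter_injective) (use eq in \<open>simp_all add: wG_cnj wp_cnj\<close>)
    then show ?thesis
      by simp
  next
    case 4
    then have "- cnj z \<in> quarter" "- cnj w \<in> quarter"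
      using iffs(7,8) eq z w by (simp_all add: wG_cnj)
    then have "- cnj z = - cnj w"
      by (rule quarter_injective) (use eq in \<open>simp_all add: wG_cnj wp_cnj\<close>)
    then show ?thesis
      by simp
  qed
  then show ?thesis
    by simp
next
  case True
  have zw: "z \<notin> gauss_ints" "w \<notin> gauss_ints"
    using unit_square_not_gauss_ints z w by auto
  have "Im (wp z) = 0" "Im (wp w) = 0"
    using True eq wG_Re_sign(3)[OF z] wG_Im_sign(3)[OF z] wG_Re_sign(3)[OF w] wG_Im_sign(3)[OF w] zw half_Ints
    by (intro wp_real_axes; metis)+
  then have wp_eq: "wp z = wp w"
    using eq by (simp add: complex_eq_iff)
  show ?thesis
  proof (cases "2 * w \<in> gauss_ints")
    case False
    then have "z - w \<in> gauss_ints \<or> z + w \<in> gauss_ints"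
      using wp_eqD zw(1) wp_eq by blast
    \<comment> \<open>Here wG z = - wG w by oddness, hence wG z = 0, and both sign criteria together
      make z a half-period. Then z and - z, and so z and w, are congruent.\<close>
    moreover have "z - w \<in> gauss_ints" if *: "z + w \<in> gauss_ints"
    proof -
      have "wG (- w + (z + w)) = wG (- w)"
        using zw(2) * by (intro wG_periodic) auto
      then have "wG z = 0"
        using eq(1) by simp
      then have "2 * z \<in> gauss_ints"
        using wG_Re_sign(3)[OF z] wG_Im_sign(3)[OF z] half_Ints by (simp add: gauss_ints_def)
      then have "2 * z - (z + w) \<in> gauss_ints"
        using * by blast
      then show ?thesis
        by simp
    qed
    ultimately show ?thesis
      by blast
  next
    case True
    \<comment> \<open>Both points are half-periods now. The three classes have the distinct values
      \<open>we\<close>, - \<open>we\<close> and 0, so equal values leave only pairs from the same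
      class.\<close>
    then have z2: "2 * z \<in> gauss_ints"
      using wp_eq_half_period zw wp_eq by blast
    have nz: "1 / 2 \<notin> gauss_ints" "\<i> / 2 \<notin> gauss_ints"
      using half_not_Ints[of "1/2"] by (auto simp: gauss_ints_def)
    have vals: "wp (1/2 + l) = we" "wp (\<i>/2 + l) = - of_real we" "wp (Complex (1/2) (1/2) + l) = 0"
      if "l \<in> gauss_ints" for l
      using wp_periodic that nz wp_half wp_i_half wp_center by auto
    have we: "of_real we \<noteq> (0 :: complex)" "of_real we \<noteq> - (of_real we :: complex)"
      using we_nonzero by auto
    show ?thesis
      by (rule half_period_cases[OF z2 zw(1)]; rule half_period_cases[OF True zw(2)])
         (use wp_eq vals we in auto)
  qed
qed

lemma unit_square_representative:
  obtains l where "l \<in> gauss_ints" "z - l \<in> unit_square"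
proof
  show "Complex (of_int (round (Re z))) (of_int (round (Im z))) \<in> gauss_ints"
    by (simp add: gauss_ints_def)
  show "z - Complex (of_int (round (Re z))) (of_int (round (Im z))) \<in> unit_square"
    using of_int_round_abs_le[of "Re z"] of_int_round_abs_le[of "Im z"]
    by (simp add: unit_square_def abs_minus_commute)
qed

lemma torus_injective:
  assumes "z \<notin> gauss_ints" "w \<notin> gauss_ints" "wG z = wG w" "Re (wp z) = Re (wp w)"
  shows "z - w \<in> gauss_ints"
proof -
  obtain l where l: "l \<in> gauss_ints" "z - l \<in> unit_square"
    by (rule unit_square_representative)
  obtain m where m: "m \<in> gauss_ints" "w - m \<in> unit_square"
    by (rule unit_square_representative)
  have "(z - l) - (w - m) \<in> gauss_ints"
  proof (rule unit_square_injective)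
    show "wG (z - l) = wG (w - m)" "Re (wp (z - l)) = Re (wp (w - m))"
      using assms l m wG_periodic[of z "- l"] wG_periodic[of w "- m"] wp_periodic[of z "- l"] wp_periodic[of w "- m"]
      by simp_all
    show "z - l \<noteq> 0" "w - m \<noteq> 0"
      using assms l m by auto
  qed (use l m in auto)
  then have "(z - l) - (w - m) + (l - m) \<in> gauss_ints"
    using l m by blast
  then show ?thesis
    by (simp add: algebra_simps)
qed

text \<open>The conjugate term is bounded near 0, so \<open>wG\<close> behaves like 1 / z.\<close>

lemma filterlim_wG_0: "filterlim wG at_infinity (at 0)"
proof -
  have "((\<lambda>z. z * wzeta z - wkappa * cnj z * z) \<longlongrightarrow> 1 - wkappa * cnj 0 * 0) (at 0)"
    by (intro tendsto_intros tendsto_wzeta_0)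
  then have 1: "((\<lambda>z. z * wG z) \<longlongrightarrow> 1) (at 0)"
    by (simp add: wG_def algebra_simps)
  have "filterlim (\<lambda>z. 1 / z ^ 1) at_infinity (at (0 :: complex))"
    using is_pole_inverse_power[of 1 0] by (simp add: is_pole_def)
  from tendsto_mult_filterlim_at_infinity[OF 1 _ this]
  have "filterlim (\<lambda>z. z * wG z * (1 / z ^ 1)) at_infinity (at 0)"
    by simp
  also have "?this \<longleftrightarrow> filterlim wG at_infinity (at 0)"
    by (intro filterlim_cong refl eventually_mono[OF eventually_neq_at_within[of 0]]) simp
  finally show ?thesis .
qed

section \<open>The torus\<close>

definition tproj :: "complex \<Rightarrow> complex set"
  where "tproj z = {w. w - z \<in> gauss_ints}"

lemma tproj_eq_iff: "tproj z = tproj w \<longleftrightarrow> z - w \<in> gauss_ints"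
proof
  assume "tproj z = tproj w"
  moreover have "z \<in> tproj z"
    by (simp add: tproj_def)
  ultimately show "z - w \<in> gauss_ints"
    by (simp add: tproj_def)
next
  assume *: "z - w \<in> gauss_ints"
  have "u - z \<in> gauss_ints \<longleftrightarrow> u - w \<in> gauss_ints" for u
    using gauss_ints_add_iff(1)[OF *, of "u - z"] by simp
  then show "tproj z = tproj w"
    by (simp add: tproj_def)
qed

lemma tproj_add [simp]: "l \<in> gauss_ints \<Longrightarrow> tproj (z + l) = tproj z"
  by (simp add: tproj_eq_iff)

definition torus :: "complex set topology"
  where "torus = topology (\<lambda>U. U \<subseteq> range tproj \<and> open (tproj -` U))"

lemma openin_torus: "openin torus U \<longleftrightarrow> U \<subseteq> range tproj \<and> open (tproj -` U)"
proof -
  have "istopology (\<lambda>U. U \<subseteq> range tproj \<and> open (tproj -` U))"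
    unfolding istopology_def by (auto simp: vimage_Union)
  then show ?thesis
    by (simp add: torus_def)
qed

lemma topspace_torus: "topspace torus = range tproj"
proof -
  have "tproj -` range tproj = UNIV"
    by auto
  then have "openin torus (range tproj)"
    by (simp add: openin_torus)
  then show ?thesis
    unfolding topspace_def using openin_torus by blast
qed

lemma open_tproj_image:
  assumes "open U"
  shows "openin torus (tproj ` U)"
proof -
  have "tproj -` (tproj ` U) = (\<Union>l\<in>gauss_ints. (\<lambda>z. l + z) ` U)"
  proof (intro equalityI subsetI)
    fix z assume "z \<in> tproj -` (tproj ` U)"
    then obtain u where u: "u \<in> U" "z - u \<in> gauss_ints"
      by (auto simp: tproj_eq_iff)
    then show "z \<in> (\<Union>l\<in>gauss_ints. (\<lambda>z. l + z) ` U)"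
      by (intro UN_I[of "z - u"] image_eqI[of _ _ u]) auto
  next
    fix z assume "z \<in> (\<Union>l\<in>gauss_ints. (\<lambda>z. l + z) ` U)"
    then obtain l u where lu: "l \<in> gauss_ints" "u \<in> U" "z = u + l"
      by (auto simp: add.commute)
    then have "tproj z = tproj u"
      by simp
    then show "z \<in> tproj -` (tproj ` U)"
      using lu(2) by auto
  qed
  then show ?thesis
    using assms by (auto simp: openin_torus open_translation)
qed

lemma continuous_map_tproj: "continuous_map euclidean torus tproj"
  by (auto simp: continuous_map_def topspace_torus openin_torus vimage_def)

lemma compact_unit_square: "compact unit_square"
proof -
  have "unit_square = cbox (Complex (- 1/2) (- 1/2)) (Complex (1/2) (1/2))"
    by (auto simp: unit_square_def in_cbox_complex_iff abs_le_iff)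
  then show ?thesis
    using compact_cbox by metis
qed

lemma tproj_unit_square: "tproj ` unit_square = range tproj"
proof safe
  fix z
  obtain l where "l \<in> gauss_ints" "z - l \<in> unit_square"
    by (rule unit_square_representative)
  then show "tproj z \<in> tproj ` unit_square"
    by (intro image_eqI[of _ _ "z - l"]) (auto simp: tproj_eq_iff)
qed auto

lemma compact_space_torus: "compact_space torus"
  unfolding compact_space_def topspace_torus tproj_unit_square[symmetric]
  by (rule image_compactin[OF _ continuous_map_tproj]) (simp add: compact_unit_square)

lemma connected_space_torus: "connected_space torus"
  unfolding connectedin_topspace[symmetric] topspace_torus
  by (rule connectedin_continuous_map_image[OF continuous_map_tproj]) (simp add: convex_connected)

lemma Hausdorff_space_torus: "Hausdorff_space torus"
  unfolding Hausdorff_space_def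
proof (intro allI impI)
  fix x y assume xy: "x \<in> topspace torus \<and> y \<in> topspace torus \<and> x \<noteq> y"
  then obtain z w where zw: "x = tproj z" "y = tproj w"
    unfolding topspace_torus by blast
  then have "z - w \<in> - gauss_ints"
    using xy by (simp add: tproj_eq_iff)
  then obtain d where d: "d > 0" "ball (z - w) d \<subseteq> - gauss_ints"
    using open_gauss_ints_compl by (meson open_contains_ball)
  have "disjnt (tproj ` ball z (d / 2)) (tproj ` ball w (d / 2))"
  proof -
    have False if a: "dist z a < d / 2" "dist w b < d / 2" "a - b \<in> gauss_ints" for a b
    proof -
      have "dist (z - w) (a - b) \<le> dist z a + dist w b"
        using norm_triangle_ineq4[of "z - a" "w - b"] by (simp add: dist_norm algebra_simps)
      then have "a - b \<in> ball (z - w) d"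
        using a by simp
      then show False
        using d(2) a(3) by blast
    qed
    then show ?thesis
      by (auto simp: disjnt_iff tproj_eq_iff)
  qed
  then show "\<exists>U V. openin torus U \<and> openin torus V \<and> x \<in> U \<and> y \<in> V \<and> disjnt U V"
    using d(1) zw
    by (intro exI[of _ "tproj ` ball z (d / 2)"] exI[of _ "tproj ` ball w (d / 2)"])
       (auto intro!: open_tproj_image)
qed

text \<open>Two points of an open ball of radius 1/2 have distance less than 1, the smallest length
  of a nonzero lattice vector; thus \<open>tproj\<close> is injective there and the inverse is a
  coordinate.\<close>

definition tchart :: "complex \<Rightarrow> complex set chart"
  where "tchart a = (tproj ` ball a (1/2), inv_into (ball a (1/2)) tproj)"

definition tatlas :: "complex set chart set"
  where "tatlas = range tchart"

lemma inj_on_tproj_ball: "inj_on tproj (ball a (1/2))"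
proof (rule inj_onI)
  fix z w assume *: "z \<in> ball a (1/2)" "w \<in> ball a (1/2)" "tproj z = tproj w"
  have "dist z w < 1"
    using * dist_triangle_half_l[of z a 1 w] by (simp add: dist_commute)
  then show "z = w"
    using *(3) norm_gauss_int_ge_1[of "z - w"] by (auto simp: tproj_eq_iff dist_norm)
qed

lemma fst_tchart: "fst (tchart a) = tproj ` ball a (1/2)"
  by (simp add: tchart_def)

lemma snd_tchart_tproj: "z \<in> ball a (1/2) \<Longrightarrow> snd (tchart a) (tproj z) = z"
  unfolding tchart_def by (simp only: snd_conv inv_into_f_f[OF inj_on_tproj_ball])

lemma snd_tchart:
  assumes "x \<in> fst (tchart a)"
  shows "snd (tchart a) x \<in> ball a (1/2)" "tproj (snd (tchart a) x) = x"
  using assms snd_tchart_tproj by (auto simp: fst_tchart simp del: mem_ball)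

lemma snd_tchart_image: "snd (tchart a) ` fst (tchart a) = ball a (1/2)"
  unfolding fst_tchart image_image using snd_tchart_tproj by auto

lemma chart_inv_tchart: "z \<in> ball a (1/2) \<Longrightarrow> chart_inv (tchart a) z = tproj z"
proof -
  assume z: "z \<in> ball a (1/2)"
  have "inj_on (snd (tchart a)) (fst (tchart a))"
    by (rule inj_onI) (metis snd_tchart(2))
  moreover have "tproj z \<in> fst (tchart a)"
    using z by (auto simp: fst_tchart)
  ultimately show ?thesis
    unfolding chart_inv_def using inv_into_f_f[of "snd (tchart a)" "fst (tchart a)" "tproj z"]
    by (simp add: snd_tchart_tproj[OF z])
qed

text \<open>Near every point, a chart after the projection is the translation by one lattice vector.
  Chart transitions, continuity and velocities of paths are reduced to the plane in this
  way.\<close>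

lemma tchart_tproj_local:
  assumes "tproj z0 \<in> fst (tchart a)"
  obtains l where "l \<in> gauss_ints" "z0 + l \<in> ball a (1/2)"
    "eventually (\<lambda>z. tproj z \<in> fst (tchart a) \<and> snd (tchart a) (tproj z) = z + l) (nhds z0)"
proof -
  obtain u where u: "u \<in> ball a (1/2)" "tproj u = tproj z0"
    using assms by (auto simp: fst_tchart)
  define l where "l = u - z0"
  have l: "l \<in> gauss_ints"
    using u(2) by (simp add: l_def tproj_eq_iff)
  have "open ((\<lambda>z. z - l) ` ball a (1/2))"
    by (simp add: open_translation_subtract)
  moreover have "z0 \<in> (\<lambda>z. z - l) ` ball a (1/2)"
    using u by (intro image_eqI[of _ _ u]) (simp_all add: l_def)
  ultimately have "eventually (\<lambda>z. z \<in> (\<lambda>z. z - l) ` ball a (1/2)) (nhds z0)"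
    by (rule eventually_nhds_in_open)
  then have "eventually (\<lambda>z. tproj z \<in> fst (tchart a) \<and> snd (tchart a) (tproj z) = z + l) (nhds z0)"
  proof eventually_elim
    case (elim z)
    then have z: "z + l \<in> ball a (1/2)"
      by auto
    have "tproj z = tproj (z + l)"
      using l by simp
    then show ?case
      using snd_tchart_tproj[OF z] z by (auto simp: fst_tchart)
  qed
  then show ?thesis
    using that[of l] l u by (simp add: l_def)
qed

lemma is_chart_tchart: "is_chart torus (tchart a)"
  unfolding is_chart_def
proof (intro conjI)
  let ?B = "ball a (1/2)" and ?U = "fst (tchart a)"
  have U: "openin torus ?U"
    unfolding fst_tchart by (rule open_tproj_image) simp
  then show "openin torus ?U" .
  show "open (snd (tchart a) ` ?U)"
    by (simp add: snd_tchart_image)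
  have "homeomorphic_maps (subtopology torus ?U) (top_of_set ?B) (snd (tchart a)) tproj"
    unfolding homeomorphic_maps_def
  proof (intro conjI ballI)
    show "continuous_map (top_of_set ?B) (subtopology torus ?U) tproj"
      by (auto simp: continuous_map_in_subtopology fst_tchart
          intro!: continuous_map_from_subtopology[OF continuous_map_tproj])
    show "continuous_map (subtopology torus ?U) (top_of_set ?B) (snd (tchart a))"
      unfolding continuous_map_in_subtopology
    proof (intro conjI)
      show "snd (tchart a) \<in> topspace (subtopology torus ?U) \<rightarrow> ?B"
        using snd_tchart by (auto simp: topspace_subtopology)
      show "continuous_map (subtopology torus ?U) euclidean (snd (tchart a))"
        unfolding continuous_map
      proof (intro conjI allI impI)
        fix V :: "complex set" assume "openin euclidean V"
        have "{x \<in> topspace (subtopology torus ?U). snd (tchart a) x \<in> V} = tproj ` (V \<inter> ?B)"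
          using snd_tchart snd_tchart_tproj U[THEN openin_subset]
          by (fastforce simp: fst_tchart topspace_subtopology simp del: mem_ball)
        moreover have "tproj ` (V \<inter> ?B) \<subseteq> ?U"
          by (auto simp: fst_tchart)
        ultimately show "openin (subtopology torus ?U) {x \<in> topspace (subtopology torus ?U). snd (tchart a) x \<in> V}"
          using \<open>openin euclidean V\<close> U
          by (simp add: openin_open_subtopology open_tproj_image open_Int)
      qed auto
    qed
  qed (use snd_tchart snd_tchart_tproj in \<open>auto simp: topspace_subtopology simp del: mem_ball\<close>)
  then show "homeomorphic_map (subtopology torus ?U) (top_of_set (snd (tchart a) ` ?U)) (snd (tchart a))"
    unfolding snd_tchart_image homeomorphic_map_maps by blast
qed

lemma tchart_transition:
  assumes z: "z \<in> ball a (1/2)" "tproj z \<in> fst (tchart b)"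
  shows "((snd (tchart b) \<circ> chart_inv (tchart a)) has_field_derivative 1) (at z)"
proof -
  obtain l where l: "eventually (\<lambda>z. tproj z \<in> fst (tchart b) \<and> snd (tchart b) (tproj z) = z + l) (nhds z)"
    using tchart_tproj_local[OF z(2)] by blast
  have "eventually (\<lambda>w. w \<in> ball a (1/2)) (nhds z)"
    using z(1) by (intro eventually_nhds_in_open) auto
  with l have "eventually (\<lambda>w. w + l = (snd (tchart b) \<circ> chart_inv (tchart a)) w) (nhds z)"
    by eventually_elim (simp add: chart_inv_tchart del: mem_ball)
  moreover have "((\<lambda>w. w + l) has_field_derivative 1) (at z)"
    by (auto intro!: derivative_eq_intros)
  ultimately show ?thesis
    using DERIV_cong_ev[of z z "\<lambda>w. w + l" _ 1 1] by (simp add: o_def)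
qed

lemma riemann_surface_torus: "riemann_surface torus tatlas"
  unfolding riemann_surface_def
proof (intro conjI ballI)
  show "topspace torus \<noteq> {}"
    by (simp add: topspace_torus)
  show "connected_space torus" "Hausdorff_space torus"
    by (rule connected_space_torus Hausdorff_space_torus)+
  show "is_chart torus c" if "c \<in> tatlas" for c
    using that is_chart_tchart by (auto simp: tatlas_def)
  show "(\<Union>c\<in>tatlas. fst c) = topspace torus"
    by (force simp: tatlas_def topspace_torus fst_tchart)
  fix c d assume "c \<in> tatlas" "d \<in> tatlas"
  then obtain a b where cd: "c = tchart a" "d = tchart b"
    by (auto simp: tatlas_def)
  have "(snd d \<circ> chart_inv c) field_differentiable at z within S"
    if z: "z \<in> snd c ` (fst c \<inter> fst d)" for z S
  proof -
    obtain x where x: "z = snd c x" "x \<in> fst c" "x \<in> fst d"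
      using z by blast
    have "((snd d \<circ> chart_inv c) has_field_derivative 1) (at z)"
      using tchart_transition[of z a b] snd_tchart[of x a] x by (simp add: cd del: mem_ball)
    then show ?thesis
      using field_differentiable_def has_field_derivative_at_within by blast
  qed
  then show "(snd d \<circ> chart_inv c) holomorphic_on (snd c ` (fst c \<inter> fst d))"
    by (simp add: holomorphic_on_def)
qed

section \<open>The forms and the map on the torus\<close>

definition trep :: "complex set \<Rightarrow> complex"
  where "trep x = (SOME z. tproj z = x)"

lemma tproj_trep: "x \<in> range tproj \<Longrightarrow> tproj (trep x) = x"
  unfolding trep_def by (rule someI_ex) auto

lemma periodic_trep:
  assumes "\<And>z l. z \<notin> gauss_ints \<Longrightarrow> l \<in> gauss_ints \<Longrightarrow> h (z + l) = h z" "z \<notin> gauss_ints"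
  shows "h (trep (tproj z)) = h z"
proof -
  have "trep (tproj z) - z \<in> gauss_ints"
    using tproj_trep[OF rangeI] by (simp add: tproj_eq_iff)
  then show ?thesis
    using assms(1)[of z "trep (tproj z) - z"] assms(2) by simp
qed

definition torigin :: "complex set"
  where "torigin = tproj 0"

lemma tproj_eq_torigin_iff: "tproj z = torigin \<longleftrightarrow> z \<in> gauss_ints"
  by (simp add: torigin_def tproj_eq_iff)

lemma punctured_torus: "topspace torus - {torigin} = tproj ` (- gauss_ints)"
  unfolding topspace_torus using tproj_eq_torigin_iff by blast

definition wform_coeff :: "3 \<Rightarrow> complex \<Rightarrow> complex"
  where "wform_coeff k z = (if k = 1 then - wp z - of_real wkappa
     else if k = 2 then \<i> * (wp z - of_real wkappa) else deriv wp z)"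

text \<open>Along the periods 1 and i the first primitive increases by 0 and - 2 i wkappa, the
  second by - 2 i wkappa and 0, and the third is elliptic. All periods are imaginary, as a harmonic
  surface demands.\<close>

definition wprim :: "3 \<Rightarrow> complex \<Rightarrow> complex"
  where "wprim k z = (if k = 1 then wzeta z - of_real wkappa * z
     else if k = 2 then - \<i> * (wzeta z + of_real wkappa * z) else wp z)"

lemma wprim_has_field_derivative:
  assumes "z \<notin> gauss_ints"
  shows "(wprim k has_field_derivative wform_coeff k z) (at z)"
proof -
  have "((\<lambda>z. wzeta z - of_real wkappa * z) has_field_derivative (- wp z - of_real wkappa * 1)) (at z)"
    "((\<lambda>z. - \<i> * (wzeta z + of_real wkappa * z)) has_field_derivative (- \<i> * (- wp z + of_real wkappa * 1))) (at z)"
    by (intro DERIV_add DERIV_diff DERIV_cmult DERIV_ident wzeta_has_field_derivative assms)+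
  moreover note wp_has_field_derivative[OF assms]
  ultimately show ?thesis
    unfolding wprim_def[abs_def] wform_coeff_def
    by (cases "k = 1"; cases "k = 2") (simp_all add: algebra_simps)
qed

lemma wform_coeff_periodic:
  "z \<notin> gauss_ints \<Longrightarrow> l \<in> gauss_ints \<Longrightarrow> wform_coeff k (z + l) = wform_coeff k z"
  by (simp add: wform_coeff_def wp_periodic deriv_wp_periodic)

definition wF :: "complex \<Rightarrow> real^3"
  where "wF z = (\<chi> k. Re (wprim k z))"

lemma wF_component:
  "wF z $ 1 = Re (wG z)" "wF z $ 2 = Im (wG z)" "wF z $ 3 = Re (wp z)"
  by (simp_all add: wF_def wprim_def wG_def)

lemma wF_eq_iff: "wF z = wF w \<longleftrightarrow> wG z = wG w \<and> Re (wp z) = Re (wp w)"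
  by (auto simp: vec_eq_iff forall_3 wF_component complex_eq_iff)

lemma wF_periodic: "z \<notin> gauss_ints \<Longrightarrow> l \<in> gauss_ints \<Longrightarrow> wF (z + l) = wF z"
  by (simp add: wF_eq_iff wG_periodic wp_periodic)

text \<open>The coefficient does not depend on the chart, because all transition maps are local
  translations and have derivative 1.\<close>

definition tform :: "3 \<Rightarrow> complex set form"
  where "tform k c x = wform_coeff k (trep x)"

definition tmap :: "complex set \<Rightarrow> real^3"
  where "tmap x = wF (trep x)"

lemma tform_tproj: "z \<notin> gauss_ints \<Longrightarrow> tform k c (tproj z) = wform_coeff k z"
  unfolding tform_def by (rule periodic_trep[OF wform_coeff_periodic])

lemma tmap_tproj: "z \<notin> gauss_ints \<Longrightarrow> tmap (tproj z) = wF z"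
  unfolding tmap_def by (rule periodic_trep[OF wF_periodic])

lemma coeff_in_tchart:
  "z \<in> ball a (1/2) \<Longrightarrow> z \<notin> gauss_ints \<Longrightarrow> coeff_in (tchart a) (tform k) z = wform_coeff k z"
  by (simp add: coeff_in_def chart_inv_tchart tform_tproj del: mem_ball)

lemma wform_coeff_meromorphic: "wform_coeff k meromorphic_on UNIV"
  unfolding wform_coeff_def[abs_def]
  by (cases "k = 1"; cases "k = 2")
     (auto intro!: meromorphic_intros wp_meromorphic deriv_wp_meromorphic)

lemma wform_coeff_holomorphic: "wform_coeff k holomorphic_on - gauss_ints"
  unfolding wform_coeff_def[abs_def]
  by (cases "k = 1"; cases "k = 2")
     (auto intro!: holomorphic_on_minus holomorphic_on_diff holomorphic_on_mult holomorphic_on_const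
       wp_holomorphic deriv_wp_holomorphic)

lemma meromorphic_form_tform: "meromorphic_form torus tatlas {torigin} (tform k)"
  unfolding meromorphic_form_def holomorphic_form_on_def
proof (intro conjI ballI)
  fix c assume "c \<in> tatlas"
  then obtain a where c: "c = tchart a"
    by (auto simp: tatlas_def)
  have img: "snd c ` (fst c \<inter> (topspace torus - {torigin})) \<subseteq> ball a (1/2) - gauss_ints"
    using snd_tchart[of _ a] by (auto simp: c tproj_eq_torigin_iff[symmetric] simp del: mem_ball)
  have "wform_coeff k holomorphic_on (snd c ` (fst c \<inter> (topspace torus - {torigin})))"
    by (rule holomorphic_on_subset[OF wform_coeff_holomorphic]) (use img in auto)
  then show "coeff_in c (tform k) holomorphic_on (snd c ` (fst c \<inter> (topspace torus - {torigin})))"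
    by (rule holomorphic_transform) (use img coeff_in_tchart[of _ a] in \<open>auto simp: c simp del: mem_ball\<close>)
  have "wform_coeff k meromorphic_on ball a (1/2)"
    by (rule meromorphic_on_subset[OF wform_coeff_meromorphic]) auto
  also have "wform_coeff k meromorphic_on ball a (1/2) \<longleftrightarrow> coeff_in c (tform k) meromorphic_on ball a (1/2)"
  proof (rule meromorphic_on_cong[OF _ refl])
    fix z assume z: "z \<in> ball a (1/2)"
    then have "eventually (\<lambda>w. w \<in> ball a (1/2)) (at z)"
      by (intro eventually_at_in_open') auto
    then show "eventually (\<lambda>w. wform_coeff k w = coeff_in c (tform k) w) (at z)"
      using eventually_not_gauss_ints[of z] by eventually_elim (simp add: c coeff_in_tchart del: mem_ball)
  qed
  finally show "coeff_in c (tform k) meromorphic_on (snd c ` fst c)"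
    by (simp add: c snd_tchart_image)
next
  fix c d x assume "c \<in> tatlas" "d \<in> tatlas" and x: "x \<in> fst c \<inter> fst d \<inter> (topspace torus - {torigin})"
  then obtain a b where cd: "c = tchart a" "d = tchart b"
    by (auto simp: tatlas_def)
  have "((snd d \<circ> chart_inv c) has_field_derivative 1) (at (snd c x))"
    unfolding cd by (rule tchart_transition) (use x snd_tchart[of x a] in \<open>auto simp: cd simp del: mem_ball\<close>)
  then have "deriv (snd d \<circ> chart_inv c) (snd c x) = 1"
    by (rule DERIV_imp_deriv)
  then show "tform k c x = tform k d x * deriv (snd d \<circ> chart_inv c) (snd c x)"
    by (simp add: tform_def)
qed

section \<open>Lifting of paths\<close>

text \<open>The derivatives are two-sided, while the functions agree only on the closed interval.
  The endpoints are therefore added to the exceptional set.\<close>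

lemma piecewise_C1_differentiable_on_cong:
  fixes f g :: "real \<Rightarrow> 'a::real_normed_vector"
  assumes "f piecewise_C1_differentiable_on {a..b}" "\<And>x. x \<in> {a..b} \<Longrightarrow> g x = f x"
  shows "g piecewise_C1_differentiable_on {a..b}"
proof -
  obtain S where S: "finite S" "f C1_differentiable_on ({a..b} - S)" and cont: "continuous_on {a..b} f"
    using assms(1) by (auto simp: piecewise_C1_differentiable_on_def)
  obtain D where D: "\<And>x. x \<in> {a..b} - S \<Longrightarrow> (f has_vector_derivative D x) (at x)"
    "continuous_on ({a..b} - S) D"
    using S(2) unfolding C1_differentiable_on_def by blast
  have "(g has_vector_derivative D x) (at x)" if x: "x \<in> {a..b} - (S \<union> {a, b})" for x
  proof (rule has_vector_derivative_transform_within_open)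
    show "(f has_vector_derivative D x) (at x)"
      using D x by auto
    show "open {a<..<b}" "x \<in> {a<..<b}"
      using x by auto
  qed (use assms(2) in auto)
  moreover have "continuous_on ({a..b} - (S \<union> {a, b})) D"
    by (rule continuous_on_subset[OF D(2)]) auto
  ultimately have "g C1_differentiable_on ({a..b} - (S \<union> {a, b}))"
    unfolding C1_differentiable_on_def by blast
  moreover have "continuous_on {a..b} g"
    using cont by (rule continuous_on_eq) (use assms(2) in auto)
  ultimately show ?thesis
    using S(1) unfolding piecewise_C1_differentiable_on_def by (meson finite.emptyI finite.insertI finite_UnI)
qed

definition tpath :: "(real \<Rightarrow> complex) \<Rightarrow> bool"
  where "tpath g \<longleftrightarrow> valid_path g \<and> path_image g \<subseteq> - gauss_ints"

abbreviation "ptorus \<equiv> punctured torus {torigin}"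

lemma topspace_ptorus: "topspace ptorus = tproj ` (- gauss_ints)"
  unfolding topspace_subtopology punctured_torus[symmetric] by blast

text \<open>On a short interval the path stays in one chart, whose coordinate is a lift. Bisection
  assembles these: two lifts on adjacent intervals differ by a lattice vector at the common point,
  and the second one is translated by it.\<close>

lemma torus_path_lift:
  assumes "piecewise_C1_path ptorus tatlas \<gamma>"
  obtains g where "tpath g" "\<And>t. t \<in> {0..1} \<Longrightarrow> \<gamma> t = tproj (g t)"
proof -
  have path: "pathin ptorus \<gamma>"
    and pw: "\<And>a s t. 0 \<le> s \<Longrightarrow> s \<le> t \<Longrightarrow> t \<le> 1 \<Longrightarrow> \<gamma> ` {s..t} \<subseteq> fst (tchart a) \<Longrightarrow>
      (snd (tchart a) \<circ> \<gamma>) piecewise_C1_differentiable_on {s..t}"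
    using assms by (auto simp: piecewise_C1_path_def tatlas_def)
  have cont: "continuous_map (top_of_set {0..1}) ptorus \<gamma>"
    using path by (simp add: pathin_def)
  \<comment> \<open>The local hypothesis of the bisection principle also concerns intervals that
    leave the unit interval; for these the implication holds vacuously.\<close>
  define P where "P a b \<longleftrightarrow> (0 \<le> a \<and> a \<le> b \<and> b \<le> 1 \<longrightarrow>
    (\<exists>g. g piecewise_C1_differentiable_on {a..b} \<and> (\<forall>t\<in>{a..b}. \<gamma> t = tproj (g t))))" for a b
  have "P 0 1"
  proof (rule Bolzano)
    fix a b c assume trans: "P a b" "P b c" "a \<le> b" "b \<le> c"
    show "P a c"
      unfolding P_def
    proof
      assume abc: "0 \<le> a \<and> a \<le> c \<and> c \<le> 1"
      obtain g1 where g1: "g1 piecewise_C1_differentiable_on {a..b}" "\<forall>t\<in>{a..b}. \<gamma> t = tproj (g1 t)"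
        using trans(1,3,4) abc by (auto simp: P_def)
      obtain g2 where g2: "g2 piecewise_C1_differentiable_on {b..c}" "\<forall>t\<in>{b..c}. \<gamma> t = tproj (g2 t)"
        using trans(2,3,4) abc by (auto simp: P_def)
      define l where "l = g1 b - g2 b"
      have "tproj (g1 b) = \<gamma> b" "\<gamma> b = tproj (g2 b)"
        using bspec[OF g1(2), of b] bspec[OF g2(2), of b] trans(3,4) by simp_all
      then have l: "l \<in> gauss_ints"
        unfolding l_def tproj_eq_iff[symmetric] by simp
      define g where "g t = (if t \<le> b then g1 t else g2 t + l)" for t
      have "(\<lambda>t. g2 t + l) piecewise_C1_differentiable_on {b..c}"
        by (rule piecewise_C1_differentiable_add[OF g2(1) C1_differentiable_imp_piecewise]) simp
      then have "g piecewise_C1_differentiable_on {a..c}"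
        unfolding g_def[abs_def] using trans(3,4)
        by (intro piecewise_C1_differentiable_cases g1) (auto simp: l_def)
      moreover have "\<forall>t\<in>{a..c}. \<gamma> t = tproj (g t)"
        using g1(2) g2(2) l by (auto simp: g_def)
      ultimately show "\<exists>g. g piecewise_C1_differentiable_on {a..c} \<and> (\<forall>t\<in>{a..c}. \<gamma> t = tproj (g t))"
        by blast
    qed
  next
    fix x :: real assume local: "0 \<le> x" "x \<le> 1"
    have "\<gamma> x \<in> topspace torus"
      using continuous_map_image_subset_topspace[OF cont] local by auto
    then obtain z where z: "\<gamma> x = tproj z"
      by (auto simp: topspace_torus)
    define U where "U = {t \<in> {0..1}. \<gamma> t \<in> fst (tchart z)}"
    have "openin ptorus (topspace ptorus \<inter> fst (tchart z))"
      using is_chart_tchart[of z] unfolding openin_subtopology topspace_subtopology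
      by (intro exI[of _ "fst (tchart z)"]) (auto simp: is_chart_def)
    from openin_continuous_map_preimage[OF cont this]
    have "openin (top_of_set {0..1}) {t \<in> topspace (top_of_set {0..1}). \<gamma> t \<in> topspace ptorus \<inter> fst (tchart z)}" .
    also have "{t \<in> topspace (top_of_set {0..1}). \<gamma> t \<in> topspace ptorus \<inter> fst (tchart z)} = U"
      using continuous_map_image_subset_topspace[OF cont] by (auto simp: U_def image_subset_iff)
    finally have "openin (top_of_set {0..1}) U" .
    moreover have "x \<in> U"
      using local z by (auto simp: U_def fst_tchart)
    ultimately obtain d where d: "d > 0" "ball x d \<inter> {0..1} \<subseteq> U"
      unfolding openin_contains_ball by blast
    have "P a b" if ab: "a \<le> x \<and> x \<le> b \<and> b - a < d" for a b
      unfolding P_def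
    proof
      assume *: "0 \<le> a \<and> a \<le> b \<and> b \<le> 1"
      have "{a..b} \<subseteq> ball x d \<inter> {0..1}"
        using * ab by (auto simp: dist_real_def abs_less_iff)
      then have sub: "\<gamma> ` {a..b} \<subseteq> fst (tchart z)"
        using d(2) by (auto simp: U_def)
      then have "(snd (tchart z) \<circ> \<gamma>) piecewise_C1_differentiable_on {a..b}"
        using pw * by blast
      moreover have "\<forall>t\<in>{a..b}. \<gamma> t = tproj ((snd (tchart z) \<circ> \<gamma>) t)"
        using snd_tchart(2) sub by (auto simp: image_subset_iff)
      ultimately show "\<exists>g. g piecewise_C1_differentiable_on {a..b} \<and> (\<forall>t\<in>{a..b}. \<gamma> t = tproj (g t))"
        by blast
    qed
    then show "\<exists>d>0. \<forall>a b. a \<le> x \<and> x \<le> b \<and> b - a < d \<longrightarrow> P a b"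
      using d(1) by blast
  qed simp
  then obtain g where g: "g piecewise_C1_differentiable_on {0..1}" "\<forall>t\<in>{0..1}. \<gamma> t = tproj (g t)"
    by (auto simp: P_def)
  have "g t \<notin> gauss_ints" if "t \<in> {0..1}" for t
  proof -
    have "\<gamma> t \<in> topspace ptorus"
      using continuous_map_image_subset_topspace[OF cont] that by (auto simp: image_subset_iff)
    then have "\<gamma> t \<noteq> torigin"
      by (simp add: topspace_subtopology)
    then show ?thesis
      using g(2) that tproj_eq_torigin_iff[of "g t"] by auto
  qed
  then have "tpath g"
    using g(1) by (auto simp: tpath_def valid_path_def path_image_def)
  with g(2) show ?thesis
    by (intro that[of g]) auto
qed

text \<open>Inside of a chart, the difference \<open>h\<close> between the coordinate and the lift
  is continuous with values in the discrete lattice, hence constant. The coordinate of the path is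
  thus a translate of the smooth lift.\<close>

lemma torus_path_tproj:
  assumes g: "tpath g"
  shows "piecewise_C1_path ptorus tatlas (tproj \<circ> g)"
  unfolding piecewise_C1_path_def
proof (intro conjI ballI allI impI)
  have contg: "continuous_on {0..1} g"
    using g by (auto simp: tpath_def valid_path_def piecewise_C1_differentiable_on_def)
  have "continuous_map (top_of_set {0..1}) torus (tproj \<circ> g)"
    using contg by (intro continuous_map_compose[OF _ continuous_map_tproj]) simp
  then show "pathin ptorus (tproj \<circ> g)"
    using g unfolding pathin_def continuous_map_in_subtopology punctured_torus
    by (auto simp: tpath_def path_image_def)
  fix c s t assume "c \<in> tatlas" and *: "0 \<le> s \<and> s \<le> t \<and> t \<le> 1 \<and> (tproj \<circ> g) ` {s..t} \<subseteq> fst c"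
  then obtain a where c: "c = tchart a"
    by (auto simp: tatlas_def)
  define h where "h u = snd c (tproj (g u)) - g u" for u
  have h_int: "h u \<in> gauss_ints" if "u \<in> {s..t}" for u
  proof -
    have "tproj (g u) \<in> fst c"
      using * that by (auto simp: image_subset_iff)
    then show ?thesis
      unfolding h_def using snd_tchart(2) by (simp add: c flip: tproj_eq_iff)
  qed
  have "continuous_on {s..t} h"
  proof -
    have "isCont (\<lambda>z. snd c (tproj z)) z" if "tproj z \<in> fst c" for z
    proof -
      obtain l where l: "eventually (\<lambda>z. tproj z \<in> fst c \<and> snd c (tproj z) = z + l) (nhds z)"
        using tchart_tproj_local[of z a] \<open>tproj z \<in> fst c\<close> unfolding c by metis
      then have "eventually (\<lambda>z. snd c (tproj z) = z + l) (nhds z)"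
        by eventually_elim simp
      then have "isCont (\<lambda>z. snd c (tproj z)) z \<longleftrightarrow> isCont (\<lambda>z. z + l) z"
        by (rule isCont_cong)
      then show ?thesis
        by simp
    qed
    then have "continuous_on (g ` {s..t}) (\<lambda>z. snd c (tproj z))"
      using * by (intro continuous_at_imp_continuous_on) auto
    moreover have "continuous_on {s..t} g"
      by (rule continuous_on_subset[OF contg]) (use * in auto)
    ultimately show ?thesis
      unfolding h_def by (intro continuous_on_diff) (auto intro: continuous_on_compose2)
  qed
  moreover have "\<exists>e>0. \<forall>y. y \<in> {s..t} \<and> h y \<noteq> h x \<longrightarrow> e \<le> norm (h y - h x)" if "x \<in> {s..t}" for x
    using h_int that by (intro exI[of _ 1]) (auto intro!: norm_gauss_int_ge_1)
  ultimately have "h constant_on {s..t}"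
    by (intro continuous_discrete_range_constant) auto
  then obtain l where l: "\<And>u. u \<in> {s..t} \<Longrightarrow> h u = l"
    by (auto simp: constant_on_def)
  have gst: "g piecewise_C1_differentiable_on {s..t}"
    using g * by (auto simp: tpath_def valid_path_def intro: piecewise_C1_differentiable_on_subset)
  have "(\<lambda>u. g u + l) piecewise_C1_differentiable_on {s..t}"
    by (rule piecewise_C1_differentiable_add[OF gst C1_differentiable_imp_piecewise]) simp
  then show "(snd c \<circ> (tproj \<circ> g)) piecewise_C1_differentiable_on {s..t}"
    by (rule piecewise_C1_differentiable_on_cong) (use l in \<open>force simp: h_def algebra_simps\<close>)
qed

section \<open>Integration along lifted paths\<close>

lemma tpath_differentiable:
  assumes "tpath g"
  obtains S where "finite S" "\<And>t. t \<in> {0..1} - S \<Longrightarrow> (g has_vector_derivative vector_derivative g (at t)) (at t)"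
    "continuous_on ({0..1} - S) (\<lambda>t. vector_derivative g (at t))" "0 \<in> S" "1 \<in> S"
proof -
  obtain S where S: "finite S" "g C1_differentiable_on ({0..1} - S)"
    using assms by (auto simp: tpath_def valid_path_def piecewise_C1_differentiable_on_def)
  \<comment> \<open>With the endpoints in the exceptional set, the derivatives within {0..1} of the
    definitions are two-sided at all remaining points.\<close>
  then have "g C1_differentiable_on ({0..1} - (S \<union> {0, 1}))"
    by (auto intro: C1_differentiable_on_subset)
  then show ?thesis
    using S(1) by (intro that[of "S \<union> {0, 1}"]) (auto simp: C1_differentiable_on_eq vector_derivative_works)
qed

lemma tpath_not_gauss_ints: "tpath g \<Longrightarrow> t \<in> {0..1} \<Longrightarrow> g t \<notin> gauss_ints"
  by (auto simp: tpath_def path_image_def image_subset_iff)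

text \<open>Whichever chart the choice operator returns, its coordinate along the path is locally
  the lift plus a constant, so the velocity is that of the lift.\<close>

lemma form_velocity_lift:
  assumes g: "tpath g" "\<And>t. t \<in> {0..1} \<Longrightarrow> \<gamma> t = tproj (g t)"
    and t: "0 < t" "t < 1" "(g has_vector_derivative D) (at t)"
  shows "form_velocity tatlas (tform k) \<gamma> t = wform_coeff k (g t) * D"
proof -
  define c where "c = (SOME c. c \<in> tatlas \<and> \<gamma> t \<in> fst c)"
  have "tchart (g t) \<in> tatlas \<and> \<gamma> t \<in> fst (tchart (g t))"
    using g(2)[of t] t by (auto simp: tatlas_def fst_tchart)
  then have "c \<in> tatlas \<and> \<gamma> t \<in> fst c"
    unfolding c_def by (rule someI)
  then obtain a where a: "c = tchart a" "tproj (g t) \<in> fst (tchart a)"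
    using g(2)[of t] t by (auto simp: tatlas_def)
  obtain l where l: "eventually (\<lambda>z. tproj z \<in> fst c \<and> snd c (tproj z) = z + l) (nhds (g t))"
    using tchart_tproj_local[OF a(2)] unfolding a(1) by blast
  have "isCont g t"
    using t(3) has_vector_derivative_continuous by blast
  then have "filterlim g (nhds (g t)) (nhds t)"
    by (simp add: isCont_def tendsto_at_iff_tendsto_nhds)
  from eventually_compose_filterlim[OF l this]
  have "eventually (\<lambda>s. tproj (g s) \<in> fst c \<and> snd c (tproj (g s)) = g s + l) (nhds t)" .
  moreover have "eventually (\<lambda>s. s \<in> {0<..<1}) (nhds t)"
    using t by (intro eventually_nhds_in_open) auto
  ultimately have ev: "eventually (\<lambda>s. s \<in> UNIV \<longrightarrow> (snd c \<circ> \<gamma>) s = g s + l) (nhds t)"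
    by eventually_elim (use g(2) in auto)
  have "((\<lambda>s. g s + l) has_vector_derivative D) (at t)"
    using has_vector_derivative_add[OF t(3) has_vector_derivative_const[of l]] by simp
  then have D: "((snd c \<circ> \<gamma>) has_vector_derivative D) (at t)"
    using has_vector_derivative_cong_ev[OF ev eventually_nhds_x_imp_x[OF ev, THEN mp, OF UNIV_I]] by (simp add: o_def)
  have "at t within {0..1} = at t"
    using t by (intro at_within_interior) auto
  then have "vector_derivative (snd c \<circ> \<gamma>) (at t within {0..1}) = D"
    using D by (simp add: vector_derivative_at)
  moreover have "tform k c (\<gamma> t) = wform_coeff k (g t)"
    using g t tform_tproj[OF tpath_not_gauss_ints[OF g(1), of t], of k c] by simp
  ultimately show ?thesis
    unfolding form_velocity_def Let_def c_def[symmetric] by simp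
qed

text \<open>Upstairs the integrand has the primitive \<open>wprim k\<close> on the whole complement
  of the lattice, so the contour integral depends on the endpoints alone. The two integrands differ
  at finitely many times only.\<close>

lemma form_integral_lift:
  assumes g: "tpath g" "\<And>t. t \<in> {0..1} \<Longrightarrow> \<gamma> t = tproj (g t)"
  shows "form_integral tatlas (tform k) \<gamma> = wprim k (g 1) - wprim k (g 0)"
proof -
  have "(wform_coeff k has_contour_integral (wprim k (pathfinish g) - wprim k (pathstart g))) g"
    by (rule contour_integral_primitive[of "- gauss_ints"])
       (use g wprim_has_field_derivative in \<open>auto simp: tpath_def intro: has_field_derivative_at_within\<close>)
  then have 1: "((\<lambda>t. wform_coeff k (g t) * vector_derivative g (at t)) has_integral (wprim k (g 1) - wprim k (g 0))) {0..1}"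
    by (simp add: has_contour_integral pathstart_def pathfinish_def)
  obtain S where S: "finite S" "0 \<in> S" "1 \<in> S"
    "\<And>t. t \<in> {0..1} - S \<Longrightarrow> (g has_vector_derivative vector_derivative g (at t)) (at t)"
    using tpath_differentiable[OF g(1)] by metis
  have "(form_velocity tatlas (tform k) \<gamma> has_integral (wprim k (g 1) - wprim k (g 0))) {0..1}"
  proof (rule has_integral_spike_finite[OF S(1) _ 1])
    fix t assume t: "t \<in> {0..1} - S"
    then have "0 < t" "t < 1"
      using S(2,3) by (auto simp: less_le)
    then show "form_velocity tatlas (tform k) \<gamma> t = wform_coeff k (g t) * vector_derivative g (at t)"
      using form_velocity_lift[OF g] S(4)[OF t] by blast
  qed
  then show ?thesis
    unfolding form_integral_def by (rule integral_unique)
qed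

lemma tmap_lift:
  assumes "tpath g" "\<gamma> t = tproj (g t)" "t \<in> {0..1}"
  shows "tmap (\<gamma> t) = wF (g t)"
  using tmap_tproj tpath_not_gauss_ints[OF assms(1,3)] assms(2) by simp

lemma harmonic_surface_torus: "harmonic_surface torus tatlas {torigin} tform tmap"
  unfolding harmonic_surface_def
proof (intro conjI allI impI)
  fix \<gamma> assume \<gamma>: "piecewise_C1_path ptorus tatlas \<gamma>"
  then obtain g where g: "tpath g" "\<And>t. t \<in> {0..1} \<Longrightarrow> \<gamma> t = tproj (g t)"
    by (rule torus_path_lift) blast
  have "tmap (\<gamma> 1) = wF (g 1)" "tmap (\<gamma> 0) = wF (g 0)"
    by (rule tmap_lift[OF g(1)]; simp add: g(2))+
  then show "tmap (\<gamma> 1) - tmap (\<gamma> 0) = (\<chi> k. Re (form_integral tatlas (tform k) \<gamma>))"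
    using form_integral_lift[OF g] by (simp add: vec_eq_iff wF_def)
next
  fix \<gamma> k assume \<gamma>: "piecewise_C1_path ptorus tatlas \<gamma> \<and> \<gamma> 0 = \<gamma> 1"
  then obtain g where g: "tpath g" "\<And>t. t \<in> {0..1} \<Longrightarrow> \<gamma> t = tproj (g t)"
    using torus_path_lift by metis
  have "tmap (\<gamma> 1) = wF (g 1)" "tmap (\<gamma> 0) = wF (g 0)"
    by (rule tmap_lift[OF g(1)]; simp add: g(2))+
  \<comment> \<open>The lift of a closed path need not be closed; its real periods vanish because
    \<open>tmap\<close> is single-valued on the torus.\<close>
  then have "wF (g 1) $ k = wF (g 0) $ k"
    using \<gamma> by simp
  then show "Re (form_integral tatlas (tform k) \<gamma>) = 0"
    using form_integral_lift[OF g] by (simp add: wF_def)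
next
  show "{torigin} \<subseteq> topspace torus"
    by (simp add: topspace_torus torigin_def)
qed (simp_all add: riemann_surface_torus compact_space_torus meromorphic_form_tform)

lemma wF_has_derivative:
  assumes "z \<notin> gauss_ints"
  shows "(wF has_derivative (\<lambda>v. \<chi> k. Re (wform_coeff k z * v))) (at z)"
proof -
  have vec: "(\<chi> k. h k) = (\<Sum>k\<in>UNIV. h k *\<^sub>R axis k 1)" for h :: "3 \<Rightarrow> real"
    by (simp add: vec_eq_iff axis_def if_distrib cong: if_cong)
  have "((\<lambda>z. Re (wprim k z)) has_derivative (\<lambda>v. Re (wform_coeff k z * v))) (at z)" for k
    using bounded_linear.has_derivative[OF bounded_linear_Re wprim_has_field_derivative[OF assms, unfolded has_field_derivative_def]] .
  then have "((\<lambda>z. \<Sum>k\<in>UNIV. Re (wprim k z) *\<^sub>R axis k 1 :: real^3) has_derivative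
      (\<lambda>v. \<Sum>k\<in>UNIV. Re (wform_coeff k z * v) *\<^sub>R axis k 1)) (at z)"
    by (intro has_derivative_sum has_derivative_scaleR_left)
  then show ?thesis
    unfolding wF_def[abs_def] vec .
qed

lemma immersion_torus: "immersion_on tatlas (topspace torus - {torigin}) tmap"
  unfolding immersion_on_def
proof (intro ballI)
  fix c x assume "c \<in> tatlas" and x: "x \<in> fst c \<inter> (topspace torus - {torigin})"
  then obtain a where c: "c = tchart a"
    by (auto simp: tatlas_def)
  define z where "z = snd c x"
  have z: "z \<in> ball a (1/2)" "tproj z = x"
    using snd_tchart[of x a] x by (auto simp: z_def c simp del: mem_ball)
  then have nz: "z \<notin> gauss_ints"
    using x tproj_eq_torigin_iff by auto
  define D where "D = (\<lambda>v. \<chi> k. Re (wform_coeff k z * v))"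
  have "(wF has_derivative D) (at z)"
    unfolding D_def by (rule wF_has_derivative[OF nz])
  then have "((tmap \<circ> chart_inv c) has_derivative D) (at z)"
  proof (rule has_derivative_transform_within_open)
    show "open (ball a (1/2) - gauss_ints)"
      using closed_gauss_ints by (simp add: open_Diff)
    show "wF w = (tmap \<circ> chart_inv c) w" if "w \<in> ball a (1/2) - gauss_ints" for w
      using that by (simp add: c chart_inv_tchart tmap_tproj del: mem_ball)
  qed (use z nz in simp)
  moreover have "inj D"
  proof -
    have lin: "linear D"
      using \<open>(wF has_derivative D) (at z)\<close> by (rule has_derivative_linear)
    have "v = 0" if "D v = 0" for v
    proof (rule immersion_algebraic[OF wkappa_bounds wp_ode[OF nz]])
      have "\<And>k. Re (wform_coeff k z * v) = 0"
        using that by (simp add: D_def vec_eq_iff)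
      from this[of 1] this[of 2] this[of 3]
      show "Re ((- wp z - of_real wkappa) * v) = 0" "Re (\<i> * (wp z - of_real wkappa) * v) = 0"
        "Re (deriv wp z * v) = 0"
        by (simp_all add: wform_coeff_def)
    qed
    then show ?thesis
      using linear_injective_0[OF lin] by blast
  qed
  ultimately show "\<exists>D. ((tmap \<circ> chart_inv c) has_derivative D) (at (snd c x)) \<and> inj D"
    unfolding z_def by blast
qed

section \<open>The induced metric\<close>

text \<open>The velocity of \<open>wF \<circ> g\<close> by the chain rule, written through the
  coefficients so that its continuity can be read off from that of \<open>g\<close> and its
  derivative.\<close>

definition wvel :: "(real \<Rightarrow> complex) \<Rightarrow> real \<Rightarrow> real^3"
  where "wvel g t = (\<chi> k. Re (wform_coeff k (g t) * vector_derivative g (at t)))"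

definition wlen :: "(real \<Rightarrow> complex) \<Rightarrow> ennreal"
  where "wlen g = (\<integral>\<^sup>+ t\<in>{0..1}. ennreal (norm (wvel g t)) \<partial>lborel)"

lemma wF_comp_has_vector_derivative:
  assumes "(g has_vector_derivative D) (at t)" "g t \<notin> gauss_ints"
  shows "((wF \<circ> g) has_vector_derivative (\<chi> k. Re (wform_coeff k (g t) * D))) (at t)"
proof -
  have lin: "bounded_linear (\<lambda>v. (\<chi> k. Re (wform_coeff k (g t) * v)) :: real^3)"
    using wF_has_derivative[OF assms(2)] by (rule has_derivative_bounded_linear)
  have "((wF \<circ> g) has_derivative (\<lambda>v. \<chi> k. Re (wform_coeff k (g t) * v)) \<circ> (\<lambda>h. h *\<^sub>R D)) (at t)"
    by (rule diff_chain_at) (use assms wF_has_derivative in \<open>auto simp: has_vector_derivative_def\<close>)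
  then show ?thesis
    unfolding has_vector_derivative_def o_def using linear_scale[OF bounded_linear.linear[OF lin]] by simp
qed

lemma AE_lborel_not_finite: "finite S \<Longrightarrow> AE t in lborel. (t :: real) \<notin> S"
  by (rule AE_I'[of S]) (auto intro: finite_imp_null_set_lborel)

lemma induced_length_lift:
  assumes g: "tpath g" "\<And>t. t \<in> {0..1} \<Longrightarrow> \<gamma> t = tproj (g t)"
  shows "induced_length tmap \<gamma> = wlen g"
proof -
  obtain S where S: "finite S" "0 \<in> S" "1 \<in> S"
    "\<And>t. t \<in> {0..1} - S \<Longrightarrow> (g has_vector_derivative vector_derivative g (at t)) (at t)"
    using tpath_differentiable[OF g(1)] by metis
  have "AE t in lborel. ennreal (norm (vector_derivative (tmap \<circ> \<gamma>) (at t within {0..1}))) * indicator {0..1} t =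
      ennreal (norm (wvel g t)) * indicator {0..1} t"
    using AE_lborel_not_finite[OF S(1)]
  proof eventually_elim
    case (elim t)
    show ?case
    proof (cases "t \<in> {0..1}")
      case True
      then have t: "0 < t" "t < 1"
        using elim S by (auto simp: less_le)
      have "((wF \<circ> g) has_vector_derivative wvel g t) (at t)"
        unfolding wvel_def
        by (rule wF_comp_has_vector_derivative) (use S True elim tpath_not_gauss_ints[OF g(1)] in auto)
      then have "((tmap \<circ> \<gamma>) has_vector_derivative wvel g t) (at t)"
        by (rule has_vector_derivative_transform_within_open[of _ _ _ "{0<..<1}"])
           (use t g tmap_tproj tpath_not_gauss_ints[OF g(1)] in auto)
      moreover have "at t within {0..1} = at t"
        using t by (intro at_within_interior) auto
      ultimately show ?thesis
        by (simp add: vector_derivative_at)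
    qed simp
  qed
  then show ?thesis
    unfolding induced_length_def wlen_def by (rule nn_integral_cong_AE)
qed

lemma wvel_continuous:
  assumes "tpath g" "continuous_on T (\<lambda>t. vector_derivative g (at t))" "T \<subseteq> {0..1}"
  shows "continuous_on T (wvel g)"
proof -
  have "continuous_on {0..1} g"
    using assms(1) by (auto simp: tpath_def valid_path_def piecewise_C1_differentiable_on_def)
  then have contT: "continuous_on T g"
    using assms(3) continuous_on_subset by blast
  have "continuous_on (- gauss_ints) (wform_coeff k)" for k
    using wform_coeff_holomorphic by (rule holomorphic_on_imp_continuous_on)
  then have "continuous_on T (\<lambda>t. wform_coeff k (g t))" for k
    by (rule continuous_on_compose2[OF _ contT]) (use assms tpath_not_gauss_ints in auto)
  then show ?thesis
    unfolding wvel_def[abs_def] using assms(2) by (intro continuous_intros)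
qed

text \<open>The speed is continuous only off a finite set. Cutting it off there gives a Borel
  function with the same integral, as required for substitution and additivity.\<close>

lemma wlen_measurable:
  assumes "tpath g"
  obtains S where "finite S" "0 \<in> S" "1 \<in> S"
    "\<And>t. t \<in> {0..1} - S \<Longrightarrow> (g has_vector_derivative vector_derivative g (at t)) (at t)"
    "(\<lambda>t. indicator ({0..1} - S) t * norm (wvel g t)) \<in> borel_measurable borel"
    "wlen g = (\<integral>\<^sup>+ t. ennreal (indicator ({0..1} - S) t * norm (wvel g t)) \<partial>lborel)"
proof -
  obtain S where S: "finite S" "0 \<in> S" "1 \<in> S"
    "\<And>t. t \<in> {0..1} - S \<Longrightarrow> (g has_vector_derivative vector_derivative g (at t)) (at t)"
    "continuous_on ({0..1} - S) (\<lambda>t. vector_derivative g (at t))"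
    using tpath_differentiable[OF assms] by metis
  have "continuous_on ({0..1} - S) (\<lambda>t. norm (wvel g t))"
    using wvel_continuous[OF assms S(5)] by (intro continuous_intros) auto
  moreover have "{0..1} - S \<in> sets borel"
    using S(1) by (auto intro: borel_closed finite_imp_closed)
  ultimately have "(\<lambda>t. indicator ({0..1} - S) t *\<^sub>R norm (wvel g t)) \<in> borel_measurable borel"
    by (intro borel_measurable_continuous_on_indicator)
  moreover have "AE t in lborel. ennreal (norm (wvel g t)) * indicator {0..1} t =
      ennreal (indicator ({0..1} - S) t * norm (wvel g t))"
    using AE_lborel_not_finite[OF S(1)] by eventually_elim (auto simp: indicator_def)
  then have "wlen g = (\<integral>\<^sup>+ t. ennreal (indicator ({0..1} - S) t * norm (wvel g t)) \<partial>lborel)"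
    unfolding wlen_def by (rule nn_integral_cong_AE)
  ultimately show ?thesis
    using that[of S] S by simp
qed

text \<open>A chord is no longer than its arc: the increment of \<open>wF\<close> is the integral of
  the velocity by the fundamental theorem of calculus, and a finite length is the integral of the
  speed.\<close>

lemma wlen_lower_bound:
  assumes g: "tpath g"
  shows "ennreal (norm (wF (g 1) - wF (g 0))) \<le> wlen g"
proof (cases "wlen g = \<infinity>")
  case False
  obtain S where S: "finite S" "0 \<in> S" "1 \<in> S"
    "\<And>t. t \<in> {0..1} - S \<Longrightarrow> (g has_vector_derivative vector_derivative g (at t)) (at t)"
    "(\<lambda>t. indicator ({0..1} - S) t * norm (wvel g t)) \<in> borel_measurable borel"
    "wlen g = (\<integral>\<^sup>+ t. ennreal (indicator ({0..1} - S) t * norm (wvel g t)) \<partial>lborel)"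
    by (rule wlen_measurable[OF g]) (rule that)
  obtain r where r: "wlen g = ennreal r" "r \<ge> 0"
    using False by (metis ennreal_cases infinity_ennreal_def)
  have 1: "((\<lambda>t. indicator ({0..1} - S) t * norm (wvel g t)) has_integral r) UNIV"
    by (rule nn_integral_has_integral[OF S(5) _ _ r(2)]) (simp_all flip: S(6) add: r(1))
  have contg: "continuous_on {0..1} g"
    using g by (simp add: tpath_def valid_path_def piecewise_C1_differentiable_on_def)
  have "isCont wF z" if "z \<notin> gauss_ints" for z
    using wF_has_derivative[OF that] by (rule has_derivative_continuous)
  then have "continuous_on (- gauss_ints) wF"
    by (intro continuous_at_imp_continuous_on) simp
  then have cont: "continuous_on {0..1} (\<lambda>t. wF (g t))"
    by (rule continuous_on_compose2[OF _ contg]) (use tpath_not_gauss_ints[OF g] in auto)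
  have deriv: "((\<lambda>t. wF (g t)) has_vector_derivative wvel g t) (at t)" if "t \<in> {0<..<1} - S" for t
  proof -
    have "((wF \<circ> g) has_vector_derivative wvel g t) (at t)"
      unfolding wvel_def using S(4)[of t] tpath_not_gauss_ints[OF g, of t] that
      by (intro wF_comp_has_vector_derivative) simp_all
    then show ?thesis
      by (simp add: o_def)
  qed
  have "(wvel g has_integral (wF (g 1) - wF (g 0))) {0..1}"
    using fundamental_theorem_of_calculus_interior_strong[of S 0 1 "\<lambda>t. wF (g t)" "wvel g"] S(1) deriv cont
    by simp
  then have "((\<lambda>t. if t \<in> {0..1} - S then wvel g t else 0) has_integral (wF (g 1) - wF (g 0))) {0..1}"
    by (rule has_integral_spike_finite[OF S(1), rotated]) simp
  then have "((\<lambda>t. if t \<in> {0..1} then (if t \<in> {0..1} - S then wvel g t else 0) else 0)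
      has_integral (wF (g 1) - wF (g 0))) UNIV"
    by (simp only: has_integral_restrict_UNIV)
  then have "norm (wF (g 1) - wF (g 0)) \<le> r"
    using has_integral_norm_bound_integral_component[OF _ 1, of _ _ 1]
    by (force simp: indicator_def)
  then show ?thesis
    using r by (simp add: ennreal_leI)
qed simp

text \<open>The chain rule for an affine change of time. Agreement on an open set \<open>S\<close>
  is enough, as each half of a concatenation coincides with a rescaled path only there.\<close>

lemma wvel_affine:
  assumes g: "(g has_vector_derivative vector_derivative g (at (c * t + d))) (at (c * t + d))"
    and S: "open S" "t \<in> S" and eq: "\<And>s. s \<in> S \<Longrightarrow> k s = g (c * s + d)"
  shows "wvel k t = c *\<^sub>R wvel g (c * t + d)"
proof -
  have "((\<lambda>s. c * s + d) has_vector_derivative c) (at t)"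
    by (auto intro!: derivative_eq_intros)
  from vector_diff_chain_at[OF this g]
  have "((\<lambda>s. g (c * s + d)) has_vector_derivative c *\<^sub>R vector_derivative g (at (c * t + d))) (at t)"
    by (simp add: o_def)
  then have "(k has_vector_derivative c *\<^sub>R vector_derivative g (at (c * t + d))) (at t)"
    by (rule has_vector_derivative_transform_within_open[OF _ S]) (simp add: eq)
  then have "vector_derivative k (at t) = c *\<^sub>R vector_derivative g (at (c * t + d))"
    by (rule vector_derivative_at)
  then show ?thesis
    using eq[OF S(2)] by (simp add: wvel_def vec_eq_iff)
qed

lemma wlen_reversepath:
  assumes g: "tpath g"
  shows "tpath (reversepath g)" "wlen (reversepath g) = wlen g"
proof -
  show "tpath (reversepath g)"
    using g by (simp add: tpath_def)
  obtain S where S: "finite S" "0 \<in> S" "1 \<in> S"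
    "\<And>t. t \<in> {0..1} - S \<Longrightarrow> (g has_vector_derivative vector_derivative g (at t)) (at t)"
    "(\<lambda>t. indicator ({0..1} - S) t * norm (wvel g t)) \<in> borel_measurable borel"
    "wlen g = (\<integral>\<^sup>+ t. ennreal (indicator ({0..1} - S) t * norm (wvel g t)) \<partial>lborel)"
    by (rule wlen_measurable[OF g]) (rule that)
  let ?u = "\<lambda>t. ennreal (indicator ({0..1} - S) t * norm (wvel g t))"
  have fin: "finite ((\<lambda>t. 1 - t) ` S)"
    using S(1) by simp
  have "AE t in lborel. ennreal (norm (wvel (reversepath g) t)) * indicator {0..1} t = ?u (1 + (- 1) * t)"
    using AE_lborel_not_finite[OF fin]
  proof eventually_elim
    case (elim t)
    then have t: "1 - t \<notin> S"
      by force
    show ?case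
    proof (cases "t \<in> {0..1}")
      case True
      then have "wvel (reversepath g) t = - 1 *\<^sub>R wvel g (- 1 * t + 1)"
        using S(4)[of "1 - t"] t by (intro wvel_affine[of _ _ _ _ UNIV]) (simp_all add: reversepath_def)
      then show ?thesis
        using t True by (simp add: indicator_def)
    qed (auto simp: indicator_def)
  qed
  then have "wlen (reversepath g) = (\<integral>\<^sup>+ t. ?u (1 + (- 1) * t) \<partial>lborel)"
    unfolding wlen_def by (rule nn_integral_cong_AE)
  also have "\<dots> = wlen g"
    unfolding S(6) using nn_integral_real_affine[of ?u "- 1" 1] S(5) by simp
  finally show "wlen (reversepath g) = wlen g" .
qed

lemma wlen_joinpaths:
  assumes g: "tpath g" "tpath h" "pathfinish g = pathstart h"
  shows "tpath (g +++ h)" "wlen (g +++ h) = wlen g + wlen h"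
proof -
  show "tpath (g +++ h)"
    using g by (auto simp: tpath_def path_image_join)
  obtain S where S: "finite S" "0 \<in> S" "1 \<in> S"
    "\<And>t. t \<in> {0..1} - S \<Longrightarrow> (g has_vector_derivative vector_derivative g (at t)) (at t)"
    "(\<lambda>t. indicator ({0..1} - S) t * norm (wvel g t)) \<in> borel_measurable borel"
    "wlen g = (\<integral>\<^sup>+ t. ennreal (indicator ({0..1} - S) t * norm (wvel g t)) \<partial>lborel)"
    by (rule wlen_measurable[OF g(1)]) (rule that)
  obtain T where T: "finite T" "0 \<in> T" "1 \<in> T"
    "\<And>t. t \<in> {0..1} - T \<Longrightarrow> (h has_vector_derivative vector_derivative h (at t)) (at t)"
    "(\<lambda>t. indicator ({0..1} - T) t * norm (wvel h t)) \<in> borel_measurable borel"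
    "wlen h = (\<integral>\<^sup>+ t. ennreal (indicator ({0..1} - T) t * norm (wvel h t)) \<partial>lborel)"
    by (rule wlen_measurable[OF g(2)]) (rule that)
  define a where "a t = indicator ({0..1} - S) t * norm (wvel g t)" for t
  define b where "b t = indicator ({0..1} - T) t * norm (wvel h t)" for t
  have [measurable]: "a \<in> borel_measurable borel" "b \<in> borel_measurable borel"
    unfolding a_def[abs_def] b_def[abs_def] by (rule S T)+
  let ?u = "\<lambda>t. ennreal (a t)"
  let ?v = "\<lambda>t. ennreal (b t)"
  \<comment> \<open>The exceptional times of both paths after rescaling; they include 0, 1/2 and
    1.\<close>
  have fin: "finite ((\<lambda>t. t / 2) ` S \<union> (\<lambda>t. (t + 1) / 2) ` T)"
    using S(1) T(1) by simp
  \<comment> \<open>\<open>a\<close> and \<open>b\<close> vanish outside of the unit interval, so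
    each summand lives on its own half. The factors 2 are the doubled speed, which the substitutions
    t -> 2 t and t -> 2 t - 1 absorb.\<close>
  have "AE t in lborel. ennreal (norm (wvel (g +++ h) t)) * indicator {0..1} t =
      2 * ?u (0 + 2 * t) + 2 * ?v (- 1 + 2 * t)"
    using AE_lborel_not_finite[OF fin]
  proof eventually_elim
    case (elim t)
    have t: "2 * t \<notin> S" "2 * t - 1 \<notin> T"
    proof -
      show "2 * t \<notin> S"
        using elim image_eqI[of t "\<lambda>t. t / 2" "2 * t" S] by auto
      show "2 * t - 1 \<notin> T"
        using elim image_eqI[of t "\<lambda>t. (t + 1) / 2" "2 * t - 1" T] by auto
    qed
    have ne: "t \<noteq> 0" "t \<noteq> 1/2" "t \<noteq> 1"
    proof -
      have "2 * t \<noteq> 0" "2 * t \<noteq> 1" "2 * t - 1 \<noteq> 1"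
        using t S(2,3) T(3) by metis+
      then show "t \<noteq> 0" "t \<noteq> 1/2" "t \<noteq> 1"
        by auto
    qed
    then consider "t < 0 \<or> t > 1" | "0 < t" "t < 1/2" | "1/2 < t" "t < 1"
      by linarith
    then show ?case
    proof cases
      case 1
      then show ?thesis
        by (auto simp: indicator_def a_def b_def)
    next
      case 2
      then have "wvel (g +++ h) t = 2 *\<^sub>R wvel g (2 * t + 0)"
        using S(4)[of "2 * t"] t by (intro wvel_affine[of _ _ _ _ "{..<1/2}"]) (simp_all add: joinpaths_def)
      then have "ennreal (norm (wvel (g +++ h) t)) = 2 * ennreal (norm (wvel g (2 * t)))"
        by (simp add: ennreal_mult')
      then show ?thesis
        using t 2 by (simp add: indicator_def a_def b_def)
    next
      case 3
      then have "wvel (g +++ h) t = 2 *\<^sub>R wvel h (2 * t + - 1)"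
        using T(4)[of "2 * t - 1"] t by (intro wvel_affine[of _ _ _ _ "{1/2<..}"]) (simp_all add: joinpaths_def)
      then have "ennreal (norm (wvel (g +++ h) t)) = 2 * ennreal (norm (wvel h (2 * t - 1)))"
        by (simp add: ennreal_mult')
      then show ?thesis
        using t 3 by (simp add: indicator_def a_def b_def)
    qed
  qed
  then have "wlen (g +++ h) = (\<integral>\<^sup>+ t. 2 * ?u (0 + 2 * t) + 2 * ?v (- 1 + 2 * t) \<partial>lborel)"
    unfolding wlen_def by (rule nn_integral_cong_AE)
  also have "\<dots> = (\<integral>\<^sup>+ t. 2 * ?u (0 + 2 * t) \<partial>lborel) + (\<integral>\<^sup>+ t. 2 * ?v (- 1 + 2 * t) \<partial>lborel)"
    by (intro nn_integral_add) measurable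
  also have "(\<integral>\<^sup>+ t. 2 * ?u (0 + 2 * t) \<partial>lborel) = 2 * (\<integral>\<^sup>+ t. ?u (0 + 2 * t) \<partial>lborel)"
    by (intro nn_integral_cmult) measurable
  also have "\<dots> = wlen g"
    unfolding S(6) a_def[symmetric] using nn_integral_real_affine[of ?u 2 0] by simp
  also have "(\<integral>\<^sup>+ t. 2 * ?v (- 1 + 2 * t) \<partial>lborel) = 2 * (\<integral>\<^sup>+ t. ?v (- 1 + 2 * t) \<partial>lborel)"
    by (intro nn_integral_cmult) measurable
  also have "\<dots> = wlen h"
    unfolding T(6) b_def[symmetric] using nn_integral_real_affine[of ?v 2 "- 1"] by simp
  finally show "wlen (g +++ h) = wlen g + wlen h" .
qed

lemma wlen_translate:
  assumes g: "tpath g" and l: "l \<in> gauss_ints"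
  shows "tpath (\<lambda>t. g t + l)" "wlen (\<lambda>t. g t + l) = wlen g"
proof -
  have "valid_path g"
    using g by (simp add: tpath_def)
  then have "valid_path (\<lambda>t. g t + l)"
    unfolding valid_path_def by (rule piecewise_C1_differentiable_add[OF _ C1_differentiable_imp_piecewise]) simp
  then show "tpath (\<lambda>t. g t + l)"
    using g l by (auto simp: tpath_def path_image_def image_subset_iff)
  obtain S where S: "finite S"
    "\<And>t. t \<in> {0..1} - S \<Longrightarrow> (g has_vector_derivative vector_derivative g (at t)) (at t)"
    using tpath_differentiable[OF g] by metis
  have "AE t in lborel. ennreal (norm (wvel (\<lambda>t. g t + l) t)) * indicator {0..1} t =
      ennreal (norm (wvel g t)) * indicator {0..1} t"
    using AE_lborel_not_finite[OF S(1)]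
  proof eventually_elim
    case (elim t)
    show ?case
    proof (cases "t \<in> {0..1}")
      case True
      have "((\<lambda>t. g t + l) has_vector_derivative vector_derivative g (at t)) (at t)"
        using has_vector_derivative_add[OF S(2) has_vector_derivative_const[of l]] True elim by simp
      then have "vector_derivative (\<lambda>t. g t + l) (at t) = vector_derivative g (at t)"
        by (rule vector_derivative_at)
      then show ?thesis
        using wform_coeff_periodic[OF tpath_not_gauss_ints[OF g True] l] by (simp add: wvel_def)
    qed simp
  qed
  then show "wlen (\<lambda>t. g t + l) = wlen g"
    unfolding wlen_def by (rule nn_integral_cong_AE)
qed

section \<open>The induced distance on the torus, measured by lifted paths\<close>

definition tlens :: "complex set \<Rightarrow> complex set \<Rightarrow> ennreal set"
  where "tlens x y = {wlen g |g. tpath g \<and> tproj (g 0) = x \<and> tproj (g 1) = y}"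

definition tdist :: "complex set \<Rightarrow> complex set \<Rightarrow> real"
  where "tdist x y = enn2real (Inf (tlens x y))"

lemma induced_dist_torus: "induced_dist torus tatlas {torigin} tmap = tdist"
proof (intro ext)
  fix x y
  have "induced_length tmap ` {\<gamma>. piecewise_C1_path ptorus tatlas \<gamma> \<and> \<gamma> 0 = x \<and> \<gamma> 1 = y} = tlens x y"
  proof (intro equalityI subsetI)
    fix r assume "r \<in> induced_length tmap ` {\<gamma>. piecewise_C1_path ptorus tatlas \<gamma> \<and> \<gamma> 0 = x \<and> \<gamma> 1 = y}"
    then obtain \<gamma> where \<gamma>: "piecewise_C1_path ptorus tatlas \<gamma>" "\<gamma> 0 = x" "\<gamma> 1 = y" "r = induced_length tmap \<gamma>"
      by blast
    then obtain g where g: "tpath g" "\<And>t. t \<in> {0..1} \<Longrightarrow> \<gamma> t = tproj (g t)"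
      using torus_path_lift by metis
    then show "r \<in> tlens x y"
      using \<gamma> induced_length_lift[OF g] g(2)[of 0] g(2)[of 1] unfolding tlens_def by auto
  next
    fix r assume "r \<in> tlens x y"
    then obtain g where g: "tpath g" "tproj (g 0) = x" "tproj (g 1) = y" "r = wlen g"
      by (auto simp: tlens_def)
    then show "r \<in> induced_length tmap ` {\<gamma>. piecewise_C1_path ptorus tatlas \<gamma> \<and> \<gamma> 0 = x \<and> \<gamma> 1 = y}"
      using torus_path_tproj[OF g(1)] induced_length_lift[OF g(1), of "tproj \<circ> g"]
      by (intro image_eqI[of _ _ "tproj \<circ> g"]) auto
  qed
  then show "induced_dist torus tatlas {torigin} tmap x y = tdist x y"
    by (simp add: induced_dist_def tdist_def)
qed

lemma wlen_finite_continuous: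
  assumes g: "tpath g" and cont: "continuous_on {0..1} (\<lambda>t. vector_derivative g (at t))"
  shows "wlen g < \<infinity>"
proof -
  have "bounded (wvel g ` {0..1})"
    using wvel_continuous[OF g cont] by (intro compact_imp_bounded compact_continuous_image) auto
  then obtain B where B: "\<And>t. t \<in> {0..1} \<Longrightarrow> norm (wvel g t) \<le> B"
    unfolding bounded_iff by blast
  have "wlen g \<le> (\<integral>\<^sup>+ t. ennreal B * indicator {0..1::real} t \<partial>lborel)"
    unfolding wlen_def by (rule nn_integral_mono) (use B in \<open>auto simp: indicator_def intro: ennreal_leI\<close>)
  also have "\<dots> = ennreal B"
    by (simp add: nn_integral_cmult_indicator)
  also have "ennreal B < \<infinity>"
    by simp
  finally show ?thesis .
qed

text \<open>Finiteness matters because \<open>enn2real\<close> sends infinity to 0. A general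
  piecewise C1 path may have unbounded speed near its exceptional times, so a polynomial path with
  continuous derivative is taken.\<close>

lemma tlens_finite:
  assumes "x \<in> topspace ptorus" "y \<in> topspace ptorus"
  shows "Inf (tlens x y) < \<infinity>"
proof -
  obtain z w where zw: "x = tproj z" "z \<in> - gauss_ints" "y = tproj w" "w \<in> - gauss_ints"
    using assms unfolding topspace_ptorus by blast
  obtain g where g: "polynomial_function g" "path_image g \<subseteq> - gauss_ints" "pathstart g = z" "pathfinish g = w"
    using connected_open_polynomial_connected[OF open_gauss_ints_compl connected_gauss_ints_compl zw(2,4)] by blast
  have tp: "tpath g"
    using g by (simp add: tpath_def valid_path_polynomial_function)
  obtain g' where g': "polynomial_function g'" "\<And>t. (g has_vector_derivative g' t) (at t)"
    using has_vector_derivative_polynomial_function[OF g(1)] by blast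
  have "(\<lambda>t. vector_derivative g (at t)) = g'"
    using g'(2) by (auto simp: vector_derivative_at)
  then have "wlen g < \<infinity>"
    using g'(1) by (intro wlen_finite_continuous[OF tp]) (simp add: continuous_on_polymonial_function)
  moreover have "wlen g \<in> tlens x y"
    using tp g zw by (auto simp: tlens_def pathstart_def pathfinish_def)
  ultimately show ?thesis
    using Inf_lower le_less_trans by blast
qed

lemma tlens_commute: "tlens x y = tlens y x"
proof -
  have "tlens x y \<subseteq> tlens y x" for x y
  proof
    fix r assume "r \<in> tlens x y"
    then obtain g where g: "tpath g" "tproj (g 0) = x" "tproj (g 1) = y" "r = wlen g"
      by (auto simp: tlens_def)
    then show "r \<in> tlens y x"
      using wlen_reversepath[OF g(1)] unfolding tlens_def
      by (auto intro!: exI[of _ "reversepath g"] simp: reversepath_def)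
  qed
  then show ?thesis
    by blast
qed

lemma tlens_triangle: "Inf (tlens x z) \<le> Inf (tlens x y) + Inf (tlens y z)"
proof -
  have 1: "Inf (tlens x z) \<le> r + s" if rs: "r \<in> tlens x y" "s \<in> tlens y z" for r s
  proof -
    obtain g where g: "tpath g" "tproj (g 0) = x" "tproj (g 1) = y" "r = wlen g"
      using rs by (auto simp: tlens_def)
    obtain h where h: "tpath h" "tproj (h 0) = y" "tproj (h 1) = z" "s = wlen h"
      using rs by (auto simp: tlens_def)
    \<comment> \<open>The lifts meet only modulo the lattice; translating the second path by this
      vector keeps its length and lets the paths be joined.\<close>
    define l where "l = g 1 - h 0"
    have l: "l \<in> gauss_ints"
      unfolding l_def tproj_eq_iff[symmetric] using g h by simp
    define k where "k = (\<lambda>t. h t + l)"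
    have k: "tpath k" "wlen k = s"
      unfolding k_def using wlen_translate[OF h(1) l] h by auto
    have fin: "pathfinish g = pathstart k"
      by (simp add: pathfinish_def pathstart_def k_def l_def)
    have "r + s \<in> tlens x z"
      using wlen_joinpaths[OF g(1) k(1) fin] k g h l unfolding tlens_def
      by (auto intro!: exI[of _ "g +++ k"] simp: joinpaths_def k_def)
    then show ?thesis
      by (rule Inf_lower)
  qed
  show ?thesis
  proof (rule ennreal_le_epsilon)
    fix e :: real assume fin: "Inf (tlens x y) + Inf (tlens y z) < top" and e: "0 < e"
    have "a < a + ennreal (e / 2)" if "a < top" for a
      using that e by simp
    then have "Inf (tlens x y) < Inf (tlens x y) + ennreal (e / 2)" "Inf (tlens y z) < Inf (tlens y z) + ennreal (e / 2)"
      using fin by (simp_all only: ennreal_add_less_top)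
    then obtain r s where rs: "r \<in> tlens x y" "r < Inf (tlens x y) + ennreal (e / 2)"
      "s \<in> tlens y z" "s < Inf (tlens y z) + ennreal (e / 2)"
      unfolding Inf_less_iff by blast
    have "Inf (tlens x z) \<le> r + s"
      using 1 rs by blast
    also have "\<dots> \<le> (Inf (tlens x y) + ennreal (e / 2)) + (Inf (tlens y z) + ennreal (e / 2))"
      using rs by (intro add_mono) auto
    also have "\<dots> = Inf (tlens x y) + Inf (tlens y z) + (ennreal (e / 2) + ennreal (e / 2))"
      by (simp add: ac_simps)
    also have "ennreal (e / 2) + ennreal (e / 2) = ennreal e"
      using e by (simp flip: ennreal_plus)
    finally show "Inf (tlens x z) \<le> Inf (tlens x y) + Inf (tlens y z) + ennreal e" .
  qed
qed

text \<open>Together with injectivity this separates points, and it bounds the images of Cauchy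
  sequences. It passes from path lengths to their infimum, which is finite, so
  \<open>enn2real\<close> respects the inequality.\<close>

lemma tdist_lower_bound:
  assumes "z \<notin> gauss_ints" "w \<notin> gauss_ints"
  shows "norm (wF w - wF z) \<le> tdist (tproj z) (tproj w)"
proof -
  have "ennreal (norm (wF w - wF z)) \<le> Inf (tlens (tproj z) (tproj w))"
  proof (rule Inf_greatest)
    fix r assume "r \<in> tlens (tproj z) (tproj w)"
    then obtain g where g: "tpath g" "tproj (g 0) = tproj z" "tproj (g 1) = tproj w" "r = wlen g"
      by (auto simp: tlens_def)
    have "wF (g 0) = wF z" "wF (g 1) = wF w"
      using assms g(2,3) tmap_tproj tpath_not_gauss_ints[OF g(1)] by (metis atLeastAtMost_iff order_refl zero_le_one)+
    then show "ennreal (norm (wF w - wF z)) \<le> r"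
      using wlen_lower_bound[OF g(1)] g(4) by simp
  qed
  moreover have "Inf (tlens (tproj z) (tproj w)) < \<infinity>"
    by (rule tlens_finite; unfold topspace_ptorus) (use assms in auto)
  ultimately have "enn2real (ennreal (norm (wF w - wF z))) \<le> tdist (tproj z) (tproj w)"
    unfolding tdist_def by (intro enn2real_mono) auto
  then show ?thesis
    by simp
qed

text \<open>The straight segment stays in a compact ball free of lattice points, on which the three
  coefficients are bounded. Convergence in the coordinate thus implies convergence in
  \<open>tdist\<close>, and \<open>w\<close> = \<open>z\<close> gives distance 0 from a point to
  itself.\<close>

lemma tdist_upper_bound:
  assumes z: "z \<notin> gauss_ints"
  obtains r C where "r > 0" "\<And>w. w \<in> ball z r \<Longrightarrow> tdist (tproj w) (tproj z) \<le> C * dist w z"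
proof -
  obtain r where r: "r > 0" "cball z r \<subseteq> - gauss_ints"
    using open_gauss_ints_compl z by (meson ComplI open_contains_cball)
  have "bounded (wform_coeff k ` cball z r)" for k
    using holomorphic_on_imp_continuous_on[OF holomorphic_on_subset[OF wform_coeff_holomorphic r(2)]]
    by (intro compact_imp_bounded compact_continuous_image) simp_all
  then have ex: "\<exists>B. \<forall>u\<in>cball z r. norm (wform_coeff k u) \<le> B" for k
    unfolding bounded_iff by blast
  define B where "B k = (SOME B. \<forall>u\<in>cball z r. norm (wform_coeff k u) \<le> B)" for k
  have B: "norm (wform_coeff k u) \<le> B k" if "u \<in> cball z r" for k u
    using someI_ex[OF ex[of k]] that unfolding B_def by blast
  define C where "C = (\<Sum>k\<in>UNIV. B k)"
  show ?thesis
  proof (rule that[OF r(1)])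
    fix w assume w: "w \<in> ball z r"
    define g where "g = linepath w z"
    have img: "path_image g \<subseteq> cball z r"
      unfolding g_def path_image_linepath using w r(1) by (intro closed_segment_subset) auto
    then have tp: "tpath g"
      using r(2) by (auto simp: tpath_def g_def)
    have B_nonneg: "B k \<ge> 0" for k
      by (rule order_trans[OF norm_ge_zero B[of z]]) (use r(1) in simp)
    have vel: "norm (wvel g t) \<le> C * dist w z" if t: "t \<in> {0..1}" for t
    proof -
      have gt: "g t \<in> cball z r"
        using img t by (auto simp: path_image_def image_subset_iff)
      have "vector_derivative g (at t) = z - w"
        unfolding g_def using has_vector_derivative_linepath_within vector_derivative_at by blast
      then have "norm (wvel g t) \<le> (\<Sum>k\<in>UNIV. \<bar>Re (wform_coeff k (g t) * (z - w))\<bar>)"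
        using norm_le_l1_cart[of "wvel g t"] by (simp add: wvel_def)
      also have "\<dots> \<le> (\<Sum>k\<in>UNIV. B k * dist w z)"
      proof (rule sum_mono)
        fix k
        have "\<bar>Re (wform_coeff k (g t) * (z - w))\<bar> \<le> norm (wform_coeff k (g t) * (z - w))"
          by (rule abs_Re_le_cmod)
        also have "\<dots> \<le> B k * norm (z - w)"
          unfolding norm_mult by (intro mult_right_mono B gt) auto
        finally show "\<bar>Re (wform_coeff k (g t) * (z - w))\<bar> \<le> B k * dist w z"
          by (simp add: dist_norm norm_minus_commute)
      qed
      finally show ?thesis
        by (simp add: C_def sum_distrib_right)
    qed
    have C: "C \<ge> 0"
      unfolding C_def by (intro sum_nonneg B_nonneg)
    have "wlen g \<le> (\<integral>\<^sup>+ t. ennreal (C * dist w z) * indicator {0..1::real} t \<partial>lborel)"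
      unfolding wlen_def by (rule nn_integral_mono) (use vel in \<open>auto simp: indicator_def intro: ennreal_leI\<close>)
    also have "\<dots> = ennreal (C * dist w z)"
      by (simp add: nn_integral_cmult_indicator)
    finally have "Inf (tlens (tproj w) (tproj z)) \<le> ennreal (C * dist w z)"
      using tp unfolding tlens_def
      by (intro order_trans[OF Inf_lower]) (auto simp: g_def linepath_def intro!: exI[of _ g])
    then have "tdist (tproj w) (tproj z) \<le> enn2real (ennreal (C * dist w z))"
      unfolding tdist_def by (intro enn2real_mono) auto
    then show "tdist (tproj w) (tproj z) \<le> C * dist w z"
      using C by simp
  qed
qed

lemma tdist_same:
  assumes "z \<notin> gauss_ints"
  shows "tdist (tproj z) (tproj z) = 0"
proof -
  obtain r C where "r > 0" "\<And>w. w \<in> ball z r \<Longrightarrow> tdist (tproj w) (tproj z) \<le> C * dist w z"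
    by (rule tdist_upper_bound[OF assms]) (rule that)
  from this(2)[of z] this(1) have "tdist (tproj z) (tproj z) \<le> 0"
    by simp
  moreover have "tdist (tproj z) (tproj z) \<ge> 0"
    by (simp add: tdist_def)
  ultimately show ?thesis
    by simp
qed

lemma Metric_space_tdist: "Metric_space (topspace torus - {torigin}) tdist"
proof
  fix x y z :: "complex set"
  show "0 \<le> tdist x y"
    by (simp add: tdist_def)
  show "tdist x y = tdist y x"
    by (simp add: tdist_def tlens_commute)
  assume x: "x \<in> topspace torus - {torigin}" and y: "y \<in> topspace torus - {torigin}"
  then obtain u v where uv: "x = tproj u" "u \<notin> gauss_ints" "y = tproj v" "v \<notin> gauss_ints"
    unfolding punctured_torus by blast
  show "tdist x y = 0 \<longleftrightarrow> x = y"
  proof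
    assume "tdist x y = 0"
    then have "wF u = wF v"
      using tdist_lower_bound[of u v] uv by simp
    then have "u - v \<in> gauss_ints"
      using torus_injective uv by (simp add: wF_eq_iff)
    then show "x = y"
      by (simp add: uv tproj_eq_iff)
  qed (use tdist_same uv in auto)
  assume z: "z \<in> topspace torus - {torigin}"
  have fin: "Inf (tlens a b) < \<infinity>" if "a \<in> {x, y, z}" "b \<in> {x, y, z}" for a b
    using x y z that by (intro tlens_finite) (auto simp: topspace_ptorus simp flip: punctured_torus)
  have "tdist x z \<le> enn2real (Inf (tlens x y) + Inf (tlens y z))"
    unfolding tdist_def using fin by (intro enn2real_mono tlens_triangle) auto
  also have "\<dots> = tdist x y + tdist y z"
    unfolding tdist_def using fin by (intro enn2real_plus) auto
  finally show "tdist x z \<le> tdist x y + tdist y z" .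
qed

lemma wG_bounded_away:
  obtains d where "d > 0" "\<And>z. z \<notin> gauss_ints \<Longrightarrow> norm z < d \<Longrightarrow> norm (wG z) > R"
proof -
  have "eventually (\<lambda>z. norm (wG z) \<ge> \<bar>R\<bar> + 1) (at 0)"
    using filterlim_wG_0 filterlim_at_infinity[of 0 wG] by (auto elim!: allE[of _ "\<bar>R\<bar> + 1"])
  then obtain d where d: "d > 0" "\<And>z. z \<noteq> 0 \<Longrightarrow> dist z 0 < d \<Longrightarrow> norm (wG z) \<ge> \<bar>R\<bar> + 1"
    by (auto simp: eventually_at)
  show ?thesis
  proof (rule that[OF d(1)])
    fix z assume "z \<notin> gauss_ints" "norm z < d"
    then have "norm (wG z) \<ge> \<bar>R\<bar> + 1"
      using d(2)[of z] by auto
    then show "norm (wG z) > R"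
      by linarith
  qed
qed

lemma norm_wG_le_norm_wF: "norm (wG z) \<le> norm (wF z)"
proof -
  have "norm (wG z) ^ 2 \<le> norm (wF z) ^ 2"
    by (simp add: norm_vec_def L2_set_def sum_3 wF_component cmod_def)
  then show ?thesis
    by (rule power2_le_imp_le) simp
qed

text \<open>The function \<open>wG\<close> is bounded on a Cauchy sequence, which therefore stays away from the puncture.\<close>

lemma complete_surface_torus: "complete_surface torus tatlas {torigin} tmap"
proof -
  let ?M = "topspace torus - {torigin}"
  interpret Metric_space ?M tdist
    by (rule Metric_space_tdist)
  have "mcomplete"
    unfolding mcomplete_def
  proof (intro allI impI)
    fix \<sigma> assume \<sigma>: "MCauchy \<sigma>"
    then have range: "\<sigma> n \<in> tproj ` (- gauss_ints)" for n
      by (auto simp: MCauchy_def punctured_torus[symmetric])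
    have "\<exists>z. z \<in> unit_square \<and> z \<notin> gauss_ints \<and> \<sigma> n = tproj z" for n
    proof -
      obtain w where w: "\<sigma> n = tproj w" "w \<notin> gauss_ints"
        using range[of n] by blast
      obtain l where l: "l \<in> gauss_ints" "w - l \<in> unit_square"
        by (rule unit_square_representative)
      have "tproj w = tproj (w - l)"
        using l(1) by (simp add: tproj_eq_iff)
      then show ?thesis
        using w l by (intro exI[of _ "w - l"]) auto
    qed
    then obtain s where s: "\<And>n. s n \<in> unit_square" "\<And>n. s n \<notin> gauss_ints" "\<And>n. \<sigma> n = tproj (s n)"
      by metis
    obtain N where N: "\<And>n m. n \<ge> N \<Longrightarrow> m \<ge> N \<Longrightarrow> tdist (\<sigma> n) (\<sigma> m) < 1"
      using \<sigma> unfolding MCauchy_def by (meson zero_less_one)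
    define R where "R = norm (wF (s N)) + 1"
    have R: "norm (wG (s n)) \<le> R" if "n \<ge> N" for n
    proof -
      have "norm (wF (s n) - wF (s N)) \<le> tdist (\<sigma> N) (\<sigma> n)"
        unfolding s(3) by (rule tdist_lower_bound[OF s(2) s(2)])
      also have "\<dots> < 1"
        using N that by auto
      finally have "norm (wF (s n)) \<le> R"
        using norm_triangle_ineq[of "wF (s n) - wF (s N)" "wF (s N)"] by (simp add: R_def)
      then show ?thesis
        using norm_wG_le_norm_wF order_trans by blast
    qed
    obtain d where d: "d > 0" "\<And>z. z \<notin> gauss_ints \<Longrightarrow> norm z < d \<Longrightarrow> norm (wG z) > R"
      by (rule wG_bounded_away[of R]) (rule that)
    obtain u r where ur: "u \<in> unit_square" "strict_mono r" "((\<lambda>n. s (n + N)) \<circ> r) \<longlonglongrightarrow> u"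
      using compact_unit_square s(1) unfolding compact_eq_seq_compact_metric seq_compact_def by meson
    \<comment> \<open>The shift by \<open>N\<close> puts all terms of the subsequence in the range
      where \<open>R\<close> bounds \<open>wG\<close>.\<close>
    define q where "q n = r n + N" for n
    have q: "strict_mono q" "(\<lambda>n. s (q n)) \<longlonglongrightarrow> u"
      using ur by (auto simp: q_def o_def strict_mono_def)
    have "norm u \<ge> d"
    proof (rule tendsto_lowerbound)
      show "(\<lambda>n. norm (s (q n))) \<longlonglongrightarrow> norm u"
        using q(2) by (rule tendsto_norm)
      have "norm (s (q n)) \<ge> d" for n
        using R[of "q n"] d(2)[OF s(2)[of "q n"]] by (fastforce simp: q_def)
      then show "eventually (\<lambda>n. norm (s (q n)) \<ge> d) sequentially"
        by simp
    qed simp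
    then have "u \<noteq> 0"
      using d(1) by auto
    then have u: "u \<notin> gauss_ints"
      using unit_square_not_gauss_ints[OF ur(1)] by blast
    obtain \<rho> C where \<rho>: "\<rho> > 0" "\<And>w. w \<in> ball u \<rho> \<Longrightarrow> tdist (tproj w) (tproj u) \<le> C * dist w u"
      by (rule tdist_upper_bound[OF u]) (rule that)
    have "limitin mtopology (\<sigma> \<circ> q) (tproj u) sequentially"
      unfolding limitin_metric
    proof (intro conjI allI impI)
      show "tproj u \<in> ?M"
        using u by (auto simp: punctured_torus)
      fix \<epsilon> :: real assume \<epsilon>: "\<epsilon> > 0"
      have "(\<lambda>n. C * dist (s (q n)) u) \<longlonglongrightarrow> C * dist u u"
        using q(2) by (intro tendsto_intros)
      then have "eventually (\<lambda>n. C * dist (s (q n)) u < \<epsilon>) sequentially"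
        using \<epsilon> by (intro order_tendstoD) auto
      moreover have "eventually (\<lambda>n. dist (s (q n)) u < \<rho>) sequentially"
        using q(2) \<rho>(1) by (rule tendstoD)
      ultimately show "eventually (\<lambda>n. (\<sigma> \<circ> q) n \<in> ?M \<and> tdist ((\<sigma> \<circ> q) n) (tproj u) < \<epsilon>) sequentially"
      proof eventually_elim
        case (elim n)
        have "tdist (tproj (s (q n))) (tproj u) \<le> C * dist (s (q n)) u"
          using elim by (intro \<rho>) (simp add: dist_commute)
        then show ?case
          using elim range[of "q n"] by (simp add: s(3) punctured_torus)
      qed
    qed
    then show "\<exists>x. limitin mtopology \<sigma> x sequentially"
      using MCauchy_convergent_subsequence[OF \<sigma> q(1)] by blast
  qed
  then show ?thesis
    unfolding complete_surface_def induced_dist_torus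
    using immersion_torus Metric_space_tdist by simp
qed

section \<open>Properness, genus and the type of the end\<close>

lemma openin_punctured_torus: "openin torus (topspace torus - {torigin})"
  unfolding punctured_torus by (rule open_tproj_image[OF open_gauss_ints_compl])

lemma isCont_wF: "z \<notin> gauss_ints \<Longrightarrow> isCont wF z"
  using wF_has_derivative by (rule has_derivative_continuous)

lemma continuous_map_tmap: "continuous_map ptorus euclidean tmap"
  unfolding continuous_map
proof (intro conjI allI impI)
  fix V :: "(real^3) set" assume "openin euclidean V"
  then have V: "open V"
    by simp
  have "continuous_on (- gauss_ints) wF"
    using isCont_wF by (intro continuous_at_imp_continuous_on) simp
  then have "open (- gauss_ints \<inter> wF -` V)"
    by (rule continuous_open_preimage[OF _ open_gauss_ints_compl V])
  then have "openin torus (tproj ` (- gauss_ints \<inter> wF -` V))"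
    by (rule open_tproj_image)
  moreover have "{x \<in> topspace ptorus. tmap x \<in> V} = tproj ` (- gauss_ints \<inter> wF -` V)"
    unfolding topspace_ptorus by (auto simp: tmap_tproj)
  moreover have "tproj ` (- gauss_ints \<inter> wF -` V) \<subseteq> topspace torus - {torigin}"
    unfolding punctured_torus by blast
  ultimately show "openin ptorus {x \<in> topspace ptorus. tmap x \<in> V}"
    by (simp add: openin_open_subtopology[OF openin_punctured_torus])
qed simp

text \<open>On the preimage of a bounded set \<open>wG\<close> is bounded, so representatives in the
  unit square keep a distance \<open>d\<close> from the puncture. The preimage is the projection of
  a compact subset of the square without this ball.\<close>

lemma proper_map_tmap: "proper_map ptorus euclidean tmap"
proof (rule compact_imp_proper_map)
  show "k_space (euclidean :: (real^3) topology)"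
    by (rule metrizable_imp_k_space[OF metrizable_space_euclidean])
  show "kc_space (euclidean :: (real^3) topology)"
    by (rule Hausdorff_imp_kc_space) simp
  show "continuous_map ptorus euclidean tmap \<or> kc_space ptorus"
    using continuous_map_tmap by blast
  fix K :: "(real^3) set" assume "compactin euclidean K"
  then have K: "compact K"
    by simp
  obtain R where R: "\<And>v. v \<in> K \<Longrightarrow> norm v \<le> R"
    using compact_imp_bounded[OF K] unfolding bounded_iff by blast
  obtain d where d: "d > 0" "\<And>z. z \<notin> gauss_ints \<Longrightarrow> norm z < d \<Longrightarrow> norm (wG z) > R"
    by (rule wG_bounded_away[of R]) (rule that)
  define C where "C = unit_square - ball 0 d"
  have "z \<notin> gauss_ints" if "z \<in> C" for z
  proof -
    have "z \<noteq> 0"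
      using that d(1) by (auto simp: C_def)
    then show ?thesis
      using that unit_square_not_gauss_ints[of z] by (simp add: C_def)
  qed
  then have C: "compact C" "C \<subseteq> - gauss_ints"
    using compact_unit_square by (auto simp: C_def compact_diff)
  have "continuous_on C wF"
    using isCont_wF C(2) by (intro continuous_at_imp_continuous_on) blast
  then have "compact (C \<inter> wF -` K)"
    using K C(1) by (meson closedin_compact compact_imp_closed continuous_closedin_preimage)
  then have "compactin torus (tproj ` (C \<inter> wF -` K))"
    by (intro image_compactin[OF _ continuous_map_tproj]) simp
  moreover have "tproj ` (C \<inter> wF -` K) = {x \<in> topspace ptorus. tmap x \<in> K}"
  proof (intro equalityI subsetI)
    fix x assume "x \<in> {x \<in> topspace ptorus. tmap x \<in> K}"
    then obtain w where w: "x = tproj w" "w \<notin> gauss_ints" "tmap x \<in> K"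
      unfolding topspace_ptorus by blast
    obtain l where l: "l \<in> gauss_ints" "w - l \<in> unit_square"
      by (rule unit_square_representative)
    have x: "x = tproj (w - l)"
      using w l by (simp add: tproj_eq_iff)
    have nz: "w - l \<notin> gauss_ints"
      using w l by simp
    then have "wF (w - l) \<in> K"
      using w(3) by (simp add: x tmap_tproj)
    moreover from this have "norm (wG (w - l)) \<le> R"
      using R norm_wG_le_norm_wF order_trans by blast
    then have "w - l \<notin> ball 0 d"
      using d(2)[OF nz] by force
    ultimately show "x \<in> tproj ` (C \<inter> wF -` K)"
      unfolding x C_def using l(2) by blast
  next
    fix x assume "x \<in> tproj ` (C \<inter> wF -` K)"
    then obtain z where "x = tproj z" "z \<in> C" "wF z \<in> K"
      by blast
    then show "x \<in> {x \<in> topspace ptorus. tmap x \<in> K}"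
      unfolding topspace_ptorus using C(2) by (auto simp: tmap_tproj)
  qed
  ultimately show "compactin ptorus {x \<in> topspace ptorus. tmap x \<in> K}"
    by (simp add: compactin_subtopology topspace_subtopology) auto
qed simp

lemma properly_embedded_torus: "properly_embedded torus tatlas {torigin} tmap"
proof -
  have "inj_on tmap (topspace torus - {torigin})"
  proof (rule inj_onI)
    fix x y assume xy: "x \<in> topspace torus - {torigin}" "y \<in> topspace torus - {torigin}" "tmap x = tmap y"
    then obtain z w where zw: "x = tproj z" "z \<notin> gauss_ints" "y = tproj w" "w \<notin> gauss_ints"
      unfolding punctured_torus by blast
    then have "z - w \<in> gauss_ints"
      using xy(3) torus_injective by (simp add: tmap_tproj wF_eq_iff)
    then show "x = y"
      using zw by (simp add: tproj_eq_iff)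
  qed
  then show ?thesis
    unfolding properly_embedded_def
    using continuous_map_tmap proper_map_tmap immersion_torus by blast
qed

text \<open>All transition maps have derivative 1, so the coefficients in the different charts agree
  and lift to one entire doubly periodic function, which is constant by Liouville's theorem.\<close>

lemma holomorphic_form_torus_constant:
  assumes \<omega>: "holomorphic_form_on tatlas (topspace torus) \<omega>"
  obtains k where "\<And>c x. c \<in> tatlas \<Longrightarrow> x \<in> fst c \<Longrightarrow> \<omega> c x = k"
proof -
  have eq: "\<omega> (tchart a) x = \<omega> (tchart b) x" if x: "x \<in> fst (tchart a)" "x \<in> fst (tchart b)" for a b x
  proof -
    have "\<forall>c\<in>tatlas. \<forall>d\<in>tatlas. \<forall>x\<in>fst c \<inter> fst d \<inter> topspace torus.
        \<omega> c x = \<omega> d x * deriv (snd d \<circ> chart_inv c) (snd c x)"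
      using \<omega> unfolding holomorphic_form_on_def by (rule conjunct2)
    moreover have "x \<in> fst (tchart a) \<inter> fst (tchart b) \<inter> topspace torus"
      using x by (auto simp: fst_tchart topspace_torus)
    ultimately have 1: "\<omega> (tchart a) x =
        \<omega> (tchart b) x * deriv (snd (tchart b) \<circ> chart_inv (tchart a)) (snd (tchart a) x)"
      unfolding tatlas_def by blast
    have "deriv (snd (tchart b) \<circ> chart_inv (tchart a)) (snd (tchart a) x) = 1"
      by (rule DERIV_imp_deriv[OF tchart_transition])
         (use snd_tchart[OF x(1)] x(2) in \<open>simp_all del: mem_ball\<close>)
    then show ?thesis
      using 1 by (simp only: mult_1_right)
  qed
  define g where "g z = \<omega> (tchart z) (tproj z)" for z
  have centre: "tproj z \<in> fst (tchart z)" for z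
    by (auto simp: fst_tchart)
  have g_eq: "g z = \<omega> (tchart a) (tproj z)" if "tproj z \<in> fst (tchart a)" for z a
    unfolding g_def by (rule eq[OF centre that])
  have "g holomorphic_on ball a (1/2)" for a
  proof -
    have "fst (tchart a) \<inter> topspace torus = fst (tchart a)"
      by (auto simp: fst_tchart topspace_torus)
    moreover have "coeff_in (tchart a) \<omega> holomorphic_on snd (tchart a) ` (fst (tchart a) \<inter> topspace torus)"
      using \<omega> unfolding holomorphic_form_on_def tatlas_def by blast
    ultimately have "coeff_in (tchart a) \<omega> holomorphic_on ball a (1/2)"
      by (simp add: snd_tchart_image)
    then show ?thesis
    proof (rule holomorphic_transform)
      fix z assume z: "z \<in> ball a (1/2)"
      then have "tproj z \<in> fst (tchart a)"
        unfolding fst_tchart by blast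
      then show "coeff_in (tchart a) \<omega> z = g z"
        using z by (simp add: coeff_in_def chart_inv_tchart g_eq del: mem_ball)
    qed
  qed
  then have holo: "g holomorphic_on UNIV"
    by (intro analytic_imp_holomorphic) (auto simp: analytic_on_def intro!: exI[of _ "1/2 :: real"])
  have per: "g (z - l) = g z" if "l \<in> gauss_ints" for z l
  proof -
    have "tproj (z - l) = tproj z"
      using that by (simp add: tproj_eq_iff)
    then show ?thesis
      using g_eq[of "z - l" z] centre[of z] by (simp add: g_def)
  qed
  have "range g \<subseteq> g ` unit_square"
  proof safe
    fix z
    obtain l where l: "l \<in> gauss_ints" "z - l \<in> unit_square"
      by (rule unit_square_representative)
    then show "g z \<in> g ` unit_square"
      using per[OF l(1), of z] by (intro image_eqI[of _ _ "z - l"]) auto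
  qed
  moreover have "bounded (g ` unit_square)"
    using holo compact_unit_square
    by (intro compact_imp_bounded compact_continuous_image)
       (auto intro: holomorphic_on_imp_continuous_on holomorphic_on_subset)
  ultimately have "bounded (range g)"
    by (metis bounded_subset)
  then obtain k where k: "\<And>z. g z = k"
    using Liouville_theorem[OF holo] unfolding constant_on_def by blast
  show ?thesis
  proof (rule that[of k])
    fix c x assume c: "c \<in> tatlas" and x: "x \<in> fst c"
    then obtain a where a: "c = tchart a"
      by (auto simp: tatlas_def)
    then obtain z where "x = tproj z"
      using x by (auto simp: fst_tchart)
    then show "\<omega> c x = k"
      using g_eq[of z a] k x a by simp
  qed
qed

lemma genus_torus: "genus torus tatlas = 1"
proof -
  let ?s = "\<lambda>a (\<omega> :: complex set form) c x. a * \<omega> c x :: complex"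
  interpret V: vector_space ?s
    by standard (auto simp: algebra_simps fun_eq_iff)
  \<comment> \<open>The form dz, with coefficients 0 where the normalisation of
    \<open>holomorphic_forms\<close> asks for it.\<close>
  define \<omega>0 :: "complex set form" where "\<omega>0 c x = (if c \<in> tatlas \<and> x \<in> fst c then 1 else 0)" for c x
  have "\<omega>0 (tchart 0) (tproj 0) = 1"
    by (auto simp: \<omega>0_def tatlas_def fst_tchart)
  then have nz: "\<omega>0 \<noteq> 0"
    by auto
  have mem: "\<omega>0 \<in> holomorphic_forms torus tatlas"
    unfolding holomorphic_forms_def holomorphic_form_on_def
  proof (intro CollectI conjI ballI allI impI)
    fix c assume "c \<in> tatlas"
    then obtain a where c: "c = tchart a"
      by (auto simp: tatlas_def)
    have "(\<lambda>z. 1) holomorphic_on (snd c ` (fst c \<inter> topspace torus))"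
      by simp
    then show "coeff_in c \<omega>0 holomorphic_on (snd c ` (fst c \<inter> topspace torus))"
    proof (rule holomorphic_transform)
      fix z assume "z \<in> snd c ` (fst c \<inter> topspace torus)"
      then have z: "z \<in> ball a (1/2)"
        using snd_tchart_image[of a] by (auto simp: c simp del: mem_ball)
      then have "tproj z \<in> fst c"
        unfolding c fst_tchart by blast
      then show "1 = coeff_in c \<omega>0 z"
        using z by (simp add: coeff_in_def c chart_inv_tchart \<omega>0_def tatlas_def del: mem_ball)
    qed
  next
    fix c d x assume "c \<in> tatlas" "d \<in> tatlas" and x: "x \<in> fst c \<inter> fst d \<inter> topspace torus"
    then obtain a b where cd: "c = tchart a" "d = tchart b"
      by (auto simp: tatlas_def)
    have "deriv (snd d \<circ> chart_inv c) (snd c x) = 1"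
      unfolding cd by (rule DERIV_imp_deriv[OF tchart_transition])
        (use snd_tchart[of x a] x cd in \<open>auto simp del: mem_ball\<close>)
    then show "\<omega>0 c x = \<omega>0 d x * deriv (snd d \<circ> chart_inv c) (snd c x)"
      using x \<open>c \<in> tatlas\<close> \<open>d \<in> tatlas\<close> by (simp add: \<omega>0_def)
  qed (auto simp: \<omega>0_def)
  have "holomorphic_forms torus tatlas \<subseteq> V.span {\<omega>0}"
  proof
    fix \<omega> assume "\<omega> \<in> holomorphic_forms torus tatlas"
    then have \<omega>: "holomorphic_form_on tatlas (topspace torus) \<omega>"
      "\<And>c x. c \<notin> tatlas \<or> x \<notin> fst c \<Longrightarrow> \<omega> c x = 0"
      by (auto simp: holomorphic_forms_def)
    obtain k where k: "\<And>c x. c \<in> tatlas \<Longrightarrow> x \<in> fst c \<Longrightarrow> \<omega> c x = k"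
      by (rule holomorphic_form_torus_constant[OF \<omega>(1)]) (rule that)
    have "\<omega> = ?s k \<omega>0"
      using k \<omega>(2) by (auto simp: fun_eq_iff \<omega>0_def)
    then show "\<omega> \<in> V.span {\<omega>0}"
      using V.span_scale[OF V.span_base[of \<omega>0 "{\<omega>0}"], of k] by simp
  qed
  moreover have "V.independent {\<omega>0}"
    using nz by (simp add: V.dependent_single)
  ultimately have "V.dim (holomorphic_forms torus tatlas) = 1"
    using mem by (intro V.dim_unique[of "{\<omega>0}"]) auto
  then show ?thesis
    by (simp add: genus_def)
qed

section \<open>Pole orders and the type of the end\<close>

lemma pole_order_eqI:
  assumes "open S" "z \<in> S" "g holomorphic_on S" "g z \<noteq> 0" "n > 0"
    and eq: "eventually (\<lambda>w. f w = g w / (w - z) ^ n) (at z)"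
  shows "pole_order f z = n"
proof -
  have "is_pole (\<lambda>w. g w / (w - z) ^ n) z"
    by (rule is_pole_basic[OF assms(3,1,2,4,5)])
  then have "is_pole f z"
    using is_pole_cong_at[OF eq] by blast
  moreover have "zorder f z = zorder (\<lambda>w. g w / (w - z) ^ n) z"
    by (rule zorder_cong[OF eq refl])
  moreover have "zorder (\<lambda>w. g w / (w - z) ^ n) z = - int n"
    by (rule zorder_eqI[OF assms(1-4)]) (simp add: power_int_minus divide_inverse)
  ultimately show ?thesis
    by (simp add: pole_order_def)
qed

lemma pole_order_shift:
  "pole_order f (z + c) = pole_order (\<lambda>w. f (w + c)) z"
proof -
  have "zorder f (z + c) = zorder (\<lambda>w. f (w + c)) z"
    using zorder_shift[of f "z + c"] zorder_shift[of "\<lambda>w. f (w + c)" z] by (simp add: algebra_simps)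
  then show ?thesis
    by (simp add: pole_order_def is_pole_shift_iff)
qed

lemma pole_order_cong:
  assumes "eventually (\<lambda>w. f w = g w) (at z)"
  shows "pole_order f z = pole_order g z"
  using is_pole_cong_at[OF assms] zorder_cong[OF assms refl] by (simp add: pole_order_def)

text \<open>The coefficient of the double pole is - r1 + i r2, which for real r1, r2 vanishes only
  if both do; so real combinations never lower the order 2. Complex ones would, as i times the first
  coefficient plus the second is constant. A nonzero r3 brings in the triple pole of the derivative
  of \<open>wp\<close>.\<close>

lemma pole_order_combination:
  fixes r1 r2 r3 :: real
  assumes "r1 \<noteq> 0 \<or> r2 \<noteq> 0 \<or> r3 \<noteq> 0"
  shows "pole_order (\<lambda>z. of_real r1 * wform_coeff 1 z + of_real r2 * wform_coeff 2 z + of_real r3 * wform_coeff 3 z) 0 =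
    (if r3 = 0 then 2 else 3)"
proof -
  define \<alpha> where "\<alpha> = - of_real r1 + \<i> * of_real r2"
  define \<beta> where "\<beta> = - of_real wkappa * (of_real r1 + \<i> * of_real r2)"
  have sub: "ball 0 1 \<subseteq> - gauss_ints'"
    using norm_gauss_int_ge_1 by force
  have holo: "wp_sum holomorphic_on ball 0 1" "deriv wp_sum holomorphic_on ball 0 1"
    using holomorphic_on_subset[OF wp_sum_holomorphic sub] by (auto intro!: holomorphic_deriv)
  have eq: "eventually (\<lambda>z. of_real r1 * wform_coeff 1 z + of_real r2 * wform_coeff 2 z + of_real r3 * wform_coeff 3 z =
      \<alpha> * (1 / z ^ 2 + wp_sum z) + \<beta> + of_real r3 * (- 2 / z ^ 3 + deriv wp_sum z)) (at 0)"
    using eventually_not_gauss_ints[of 0]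
  proof eventually_elim
    case (elim z)
    show ?case
      by (simp add: wform_coeff_def deriv_wp_eq[OF elim] wp_def \<alpha>_def \<beta>_def algebra_simps diff_divide_distrib)
  qed
  show ?thesis
  proof (cases "r3 = 0")
    case True
    then have "\<alpha> \<noteq> 0"
      using assms by (auto simp: \<alpha>_def complex_eq_iff)
    moreover have "eventually (\<lambda>z. \<alpha> * (1 / z ^ 2 + wp_sum z) + \<beta> + of_real r3 * (- 2 / z ^ 3 + deriv wp_sum z) =
        (\<alpha> + z ^ 2 * (\<alpha> * wp_sum z + \<beta>)) / (z - 0) ^ 2) (at 0)"
      using eventually_neq_at_within[of "0::complex"]
      by eventually_elim (simp add: True field_simps)
    with eq have "eventually (\<lambda>z. of_real r1 * wform_coeff 1 z + of_real r2 * wform_coeff 2 z + of_real r3 * wform_coeff 3 z =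
        (\<alpha> + z ^ 2 * (\<alpha> * wp_sum z + \<beta>)) / (z - 0) ^ 2) (at 0)"
      by eventually_elim simp
    ultimately show ?thesis
      using True holo(1)
      by (subst pole_order_eqI[of "ball 0 1" 0 "\<lambda>z. \<alpha> + z ^ 2 * (\<alpha> * wp_sum z + \<beta>)" 2])
         (auto intro!: holomorphic_intros)
  next
    case False
    have "eventually (\<lambda>z. \<alpha> * (1 / z ^ 2 + wp_sum z) + \<beta> + of_real r3 * (- 2 / z ^ 3 + deriv wp_sum z) =
        (- 2 * of_real r3 + \<alpha> * z + z ^ 3 * (\<alpha> * wp_sum z + \<beta> + of_real r3 * deriv wp_sum z)) / (z - 0) ^ 3) (at 0)"
      using eventually_neq_at_within[of "0::complex"]
      by eventually_elim (simp add: field_simps power2_eq_square power3_eq_cube)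
    with eq have "eventually (\<lambda>z. of_real r1 * wform_coeff 1 z + of_real r2 * wform_coeff 2 z + of_real r3 * wform_coeff 3 z =
        (- 2 * of_real r3 + \<alpha> * z + z ^ 3 * (\<alpha> * wp_sum z + \<beta> + of_real r3 * deriv wp_sum z)) / (z - 0) ^ 3) (at 0)"
      by eventually_elim simp
    then show ?thesis
      using False holo
      by (subst pole_order_eqI[of "ball 0 1" 0 "\<lambda>z. - 2 * of_real r3 + \<alpha> * z + z ^ 3 * (\<alpha> * wp_sum z + \<beta> + of_real r3 * deriv wp_sum z)" 3])
         (auto intro!: holomorphic_on_add holomorphic_on_diff holomorphic_on_mult holomorphic_on_power holomorphic_on_const holomorphic_on_ident)
  qed
qed

lemma has_pole_order_combination:
  fixes r :: "3 \<Rightarrow> real"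
  assumes "r 1 \<noteq> 0 \<or> r 2 \<noteq> 0 \<or> r 3 \<noteq> 0"
  shows "has_pole_order tatlas torigin (\<lambda>c x. \<Sum>j\<in>UNIV. of_real (r j) * tform j c x) m \<longleftrightarrow>
    m = (if r 3 = 0 then 2 else 3)"
proof -
  define h where "h z = of_real (r 1) * wform_coeff 1 z + of_real (r 2) * wform_coeff 2 z + of_real (r 3) * wform_coeff 3 z" for z
  have "pole_order (coeff_in c (\<lambda>c x. \<Sum>j\<in>UNIV. of_real (r j) * tform j c x)) (snd c torigin) = (if r 3 = 0 then 2 else 3)"
    if c0: "c \<in> tatlas" "torigin \<in> fst c" for c
  proof -
    obtain a where c: "c = tchart a"
      using c0(1) by (auto simp: tatlas_def)
    \<comment> \<open>The chart may see the puncture at a lattice point other than 0; periodicity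
      moves the computation back to 0.\<close>
    define l where "l = snd c torigin"
    have l: "l \<in> ball a (1/2)" "l \<in> gauss_ints"
      using snd_tchart[of torigin a] c0(2) tproj_eq_torigin_iff[of l] by (auto simp: c l_def simp del: mem_ball)
    have "eventually (\<lambda>w. w \<in> ball a (1/2)) (at l)"
      using l(1) by (intro eventually_at_in_open') auto
    then have "eventually (\<lambda>w. w + l \<in> ball a (1/2)) (at 0)"
      using eventually_at_shift[of "\<lambda>w. w \<in> ball a (1/2)" 0 l] by simp
    then have "eventually (\<lambda>w. coeff_in c (\<lambda>c x. \<Sum>j\<in>UNIV. of_real (r j) * tform j c x) (w + l) = h w) (at 0)"
      using eventually_not_gauss_ints[of 0]
    proof eventually_elim
      case (elim w)
      have "tproj (w + l) = tproj w"
        using l(2) by simp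
      then have "tform j c (chart_inv c (w + l)) = wform_coeff j w" for j
        using elim tform_tproj[OF elim(2), of j c] by (simp add: c chart_inv_tchart del: mem_ball)
      then show ?case
        by (simp add: coeff_in_def h_def sum_3)
    qed
    then have "pole_order (\<lambda>w. coeff_in c (\<lambda>c x. \<Sum>j\<in>UNIV. of_real (r j) * tform j c x) (w + l)) 0 = pole_order h 0"
      by (rule pole_order_cong)
    moreover have "pole_order h 0 = (if r 3 = 0 then 2 else 3)"
      unfolding h_def[abs_def] by (rule pole_order_combination[OF assms])
    ultimately show ?thesis
      using pole_order_shift[of _ 0 l] by (simp add: l_def)
  qed
  then have *: "has_pole_order tatlas torigin (\<lambda>c x. \<Sum>j\<in>UNIV. of_real (r j) * tform j c x) (if r 3 = 0 then 2 else 3)"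
    unfolding has_pole_order_def by blast
  have "tchart 0 \<in> tatlas" "torigin \<in> fst (tchart 0)"
    by (auto simp: tatlas_def fst_tchart torigin_def)
  then have "n = m" if "has_pole_order tatlas torigin \<omega> n" "has_pole_order tatlas torigin \<omega> m" for \<omega> n m
    using that unfolding has_pole_order_def by blast
  then show ?thesis
    using * by blast
qed

text \<open>By invertibility no row of \<open>L\<close> is zero, so each new form has order 2 or 3,
  according to whether its entry in the third column vanishes. That column is not zero either, so at
  least one order is 3, and (2, 2, 3) is the lexicographically least such triple.\<close>

lemma has_end_type_torus: "has_end_type tatlas torigin (tform, tmap) (2, 2, 3)"
proof -
  have refl: "affinely_equivalent (tform, tmap) (tform, tmap)"
    unfolding affinely_equivalent_def prod.case
  proof (intro exI[of _ "mat 1"] exI[of _ 0] conjI)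
    show "invertible (mat 1 :: real^3^3)"
      by (metis invertible_def matrix_mul_lid)
    show "tmap = (\<lambda>x. mat 1 *v tmap x + 0)"
      by simp
    show "tform = (\<lambda>k c x. \<Sum>j\<in>UNIV. of_real ((mat 1 :: real^3^3) $ k $ j) * tform j c x)"
      by (simp add: mat_def if_distrib if_distribR cong: if_cong)
  qed
  have single: "has_pole_order tatlas torigin (tform k) (if k = 3 then 3 else 2)" for k
  proof -
    have "tform k = (\<lambda>c x. \<Sum>j\<in>UNIV. of_real (if j = k then 1 else 0) * tform j c x)"
      by (simp add: if_distrib if_distribR cong: if_cong)
    moreover have "has_pole_order tatlas torigin (\<lambda>c x. \<Sum>j\<in>UNIV. of_real (if j = k then 1 else 0) * tform j c x)
        (if k = 3 then 3 else 2)"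
      by (subst has_pole_order_combination) (use exhaust_3[of k] in auto)
    ultimately show ?thesis
      by simp
  qed
  have orders: "has_pole_orders tatlas torigin tform (2, 2, 3)"
    using single[of 1] single[of 2] single[of 3] by (simp add: has_pole_orders_def)
  have not_less: "(m, (2, 2, 3)) \<notin> lex_less"
    if E': "affinely_equivalent (tform, tmap) E'" and m: "has_pole_orders tatlas torigin (fst E') m" for E' m
  proof
    assume less: "(m, (2, 2, 3)) \<in> lex_less"
    obtain L :: "real^3^3" where L: "invertible L"
      "fst E' = (\<lambda>k c x. \<Sum>j\<in>UNIV. of_real (L $ k $ j) * tform j c x)"
      using E' by (cases E') (auto simp: affinely_equivalent_def)
    obtain M where M: "L ** M = mat 1" "M ** L = mat 1"
      using L(1) by (auto simp: invertible_def)
    have row: "L $ k $ 1 \<noteq> 0 \<or> L $ k $ 2 \<noteq> 0 \<or> L $ k $ 3 \<noteq> 0" for k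
    proof (rule ccontr)
      assume "\<not> ?thesis"
      then have "(L ** M) $ k $ k = 0"
        by (simp add: matrix_matrix_mult_def sum_3)
      then show False
        by (simp add: M mat_def)
    qed
    have col: "L $ 1 $ 3 \<noteq> 0 \<or> L $ 2 $ 3 \<noteq> 0 \<or> L $ 3 $ 3 \<noteq> 0"
    proof (rule ccontr)
      assume "\<not> ?thesis"
      then have "(M ** L) $ 3 $ 3 = 0"
        by (simp add: matrix_matrix_mult_def sum_3)
      then show False
        by (simp add: M mat_def)
    qed
    obtain m1 m2 m3 where mm: "m = (m1, m2, m3)"
      by (cases m)
    have "m1 = (if L $ 1 $ 3 = 0 then 2 else 3)" "m2 = (if L $ 2 $ 3 = 0 then 2 else 3)"
      "m3 = (if L $ 3 $ 3 = 0 then 2 else 3)"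
      using m has_pole_order_combination[of "\<lambda>j. L $ 1 $ j", OF row]
        has_pole_order_combination[of "\<lambda>j. L $ 2 $ j", OF row]
        has_pole_order_combination[of "\<lambda>j. L $ 3 $ j", OF row]
      unfolding has_pole_orders_def L(2) mm prod.case by blast+
    then show False
      using less col unfolding lex_less_def mm by (auto split: if_splits)
  qed
  have "\<forall>E' m. affinely_equivalent (tform, tmap) E' \<and> has_pole_orders tatlas torigin (fst E') m \<longrightarrow>
      (m, (2, 2, 3)) \<notin> lex_less"
    using not_less by blast
  then have "reduced_end tatlas torigin (tform, tmap) (2, 2, 3)"
    using orders by (simp only: reduced_end_def prod.case fst_conv) simp
  then show ?thesis
    using refl unfolding has_end_type_def by blast
qed

theorem theorem5p4:
  shows "\<exists>(X :: complex set topology) A p \<omega> f.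
    harmonic_surface X A {p} \<omega> f \<and> genus X A = 1 \<and>
    complete_surface X A {p} f \<and> properly_embedded X A {p} f \<and>
    has_end_type A p (\<omega>, f) (2, 2, 3)"
  using harmonic_surface_torus genus_torus complete_surface_torus properly_embedded_torus has_end_type_torus
  by blast

end
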